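(* Let $M$ be a compact integral-integral affine manifold. Then its number of integral points is equal to its total volume: $\#M_{\mathbb{Z}}=\operatorname{vol}(M)$.
   Context: Manifolds are smooth and without boundary. $\mathrm{Aff}_{\mathbb{Z}}(\mathbb{R}^n)$ denotes the set of maps $\mathbb{R}^n\to\mathbb{R}^n$ of the form $x\mapsto Ax+b$ with $A\in \mathsf{GL}(n,\mathbb{Z})$ and $b\in\mathbb{Z}^n$. A map $f\colon\Omega\to\mathbb{R}^n$ on an open subset $\Omega\subseteq\mathbb{R}^n$ is locally integral-integral affine if each point of $\Omega$ has a neighbourhood on which $f$ agrees with an element of $\mathrm{Aff}_{\mathbb{Z}}(\mathbb{R}^n)$. An atlas $\{\varphi_i\colon U_i\to\Omega_i\subseteq\mathbb{R}^n\}_{i\in I}$ for an $n$-dimensional manifold $M$ is an integral-integral affine atlas if $\varphi_j\circ\varphi_i^{-1}$ is locally integral-integral affine on $\varphi_i(U_i\cap U_j)$ for all $i,j\in I$. An integral-integral affine structure on $M$ is a maximal (with respect to inclusion) integral-integral affine atlas; an integral-integral affine manifold is a manifold equipped with such a structure; an integral chart is an element of the maximal atlas. Measure: since locally integral-integral affine maps preserve Lebesgue measure, there is a unique Borel measure on $M$ such that each integral chart $\varphi\colon U\to\Omega\subseteq\mathbb{R}^n$ is measure preserving (with Lebesgue measure on $\Omega$); $\operatorname{vol}(M)$ is the total mass of $M$ for this measure. Integral points: $M_{\mathbb{Z}}$ is the set of $x\in M$ for which there exists an integral chart $\psi\colon U\to\Omega\subseteq\mathbb{R}^n$ whose domain contains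 $x$ and such that $\psi(x)\in\mathbb{Z}^n$. *)

theory Defs
  imports "HOL-Analysis.Analysis"
begin

text \<open>
  The dimension \<open>n\<close> is a natural number, with \<open>n = 0\<close> allowed. The space \<open>\<real>\<^sup>n\<close> is the
  set \<open>{..<n} \<rightarrow>\<^sub>E UNIV\<close> of extensional real-valued functions, i.e. functions that are
  \<open>undefined\<close> at all arguments \<open>i \<ge> n\<close>. This is the carrier of both the library's product
  topology and its product measure.
\<close>

definition Rn :: "nat \<Rightarrow> (nat \<Rightarrow> real) topology"
  where "Rn n = product_topology (\<lambda>_. euclideanreal) {..<n}"

definition lebesgue_Rn :: "nat \<Rightarrow> (nat \<Rightarrow> real) measure"
  where "lebesgue_Rn n = PiM {..<n} (\<lambda>_. lborel)"

definition Zn :: "nat \<Rightarrow> (nat \<Rightarrow> real) set"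
  where "Zn n = {..<n} \<rightarrow>\<^sub>E \<int>"

definition GL_int :: "nat \<Rightarrow> (nat \<Rightarrow> nat \<Rightarrow> int) set"
  where "GL_int n = {A. \<exists>B. \<forall>i<n. \<forall>j<n.
     (\<Sum>k<n. A i k * B k j) = (if i = j then 1 else 0) \<and>
     (\<Sum>k<n. B i k * A k j) = (if i = j then 1 else 0)}"

definition affine_map :: "nat \<Rightarrow> (nat \<Rightarrow> nat \<Rightarrow> int) \<Rightarrow> (nat \<Rightarrow> int) \<Rightarrow> (nat \<Rightarrow> real) \<Rightarrow> nat \<Rightarrow> real"
  where "affine_map n A b x = (\<lambda>i\<in>{..<n}. (\<Sum>j<n. of_int (A i j) * x j) + of_int (b i))"

definition Aff_int :: "nat \<Rightarrow> ((nat \<Rightarrow> real) \<Rightarrow> nat \<Rightarrow> real) set"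
  where "Aff_int n = {affine_map n A b | A b. A \<in> GL_int n}"

definition locally_int_affine ::
  "nat \<Rightarrow> (nat \<Rightarrow> real) set \<Rightarrow> ((nat \<Rightarrow> real) \<Rightarrow> nat \<Rightarrow> real) \<Rightarrow> bool"
  where "locally_int_affine n \<Omega> f \<longleftrightarrow> openin (Rn n) \<Omega> \<and>
     (\<forall>x\<in>\<Omega>. \<exists>N g. openin (Rn n) N \<and> x \<in> N \<and> N \<subseteq> \<Omega> \<and> g \<in> Aff_int n \<and> (\<forall>y\<in>N. f y = g y))"

text \<open>
  A chart \<open>\<phi> : U \<rightarrow> \<Omega> \<subseteq> \<real>\<^sup>n\<close> is the pair \<open>(U, \<phi>)\<close>, with \<open>\<Omega> = \<phi> ` U\<close>. The function \<open>\<phi>\<close> is total in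
  HOL, but its values outside \<open>U\<close> play no role in any of the notions below.
\<close>

type_synonym 'a chart = "'a set \<times> ('a \<Rightarrow> nat \<Rightarrow> real)"

definition is_chart :: "nat \<Rightarrow> 'a topology \<Rightarrow> 'a chart \<Rightarrow> bool"
  where "is_chart n M = (\<lambda>(U, \<phi>). openin M U \<and> openin (Rn n) (\<phi> ` U) \<and>
     homeomorphic_map (subtopology M U) (subtopology (Rn n) (\<phi> ` U)) \<phi>)"

definition int_affine_atlas :: "nat \<Rightarrow> 'a topology \<Rightarrow> 'a chart set \<Rightarrow> bool"
  where "int_affine_atlas n M \<A> \<longleftrightarrow>
     (\<forall>c\<in>\<A>. is_chart n M c) \<and>
     (\<Union>c\<in>\<A>. fst c) = topspace M \<and>
     (\<forall>(U, \<phi>)\<in>\<A>. \<forall>(V, \<psi>)\<in>\<A>. locally_int_affine n (\<phi> ` (U \<inter> V)) (\<psi> \<circ> inv_into U \<phi>))"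

definition int_affine_structure :: "nat \<Rightarrow> 'a topology \<Rightarrow> 'a chart set \<Rightarrow> bool"
  where "int_affine_structure n M \<A> \<longleftrightarrow> int_affine_atlas n M \<A> \<and>
     (\<forall>\<B>. int_affine_atlas n M \<B> \<and> \<A> \<subseteq> \<B> \<longrightarrow> \<B> = \<A>)"

text \<open>
  Integral affine maps are smooth, so an integral affine atlas on a topological manifold determines
  the unique smooth structure in which its charts are smooth. No separate smooth structure is
  therefore recorded. That \<open>M\<close> is locally Euclidean of dimension \<open>n\<close> is part of having an atlas.
\<close>

definition int_affine_manifold :: "nat \<Rightarrow> 'a topology \<Rightarrow> 'a chart set \<Rightarrow> bool"
  where "int_affine_manifold n M \<A> \<longleftrightarrow>
     Hausdorff_space M \<and> second_countable M \<and> int_affine_structure n M \<A>"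

definition chart_measure_preserving :: "nat \<Rightarrow> 'a measure \<Rightarrow> 'a chart \<Rightarrow> bool"
  where "chart_measure_preserving n \<mu> = (\<lambda>(U, \<phi>).
     \<forall>B\<in>sets (lebesgue_Rn n). B \<subseteq> \<phi> ` U \<longrightarrow>
       emeasure \<mu> (U \<inter> \<phi> -` B) = emeasure (lebesgue_Rn n) B)"

definition manifold_measure :: "nat \<Rightarrow> 'a topology \<Rightarrow> 'a chart set \<Rightarrow> 'a measure"
  where "manifold_measure n M \<A> = (THE \<mu>.
     space \<mu> = topspace M \<and>
     sets \<mu> = sigma_sets (topspace M) {U. openin M U} \<and>
     (\<forall>c\<in>\<A>. chart_measure_preserving n \<mu> c))"

definition vol :: "nat \<Rightarrow> 'a topology \<Rightarrow> 'a chart set \<Rightarrow> ennreal"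
  where "vol n M \<A> = emeasure (manifold_measure n M \<A>) (topspace M)"

definition integral_points :: "nat \<Rightarrow> 'a topology \<Rightarrow> 'a chart set \<Rightarrow> 'a set"
  where "integral_points n M \<A> = {x \<in> topspace M. \<exists>(U, \<psi>)\<in>\<A>. x \<in> U \<and> \<psi> x \<in> Zn n}"

end

theory Submission
  imports Defs
begin

text \<open>
For \<open>k \<ge> 1\<close> let \<open>N k\<close> be the number of points of \<open>M\<close> whose coordinates in an integral chart lie
in the lattice \<open>(1/k) \<int>\<^sup>n\<close>. Integral affine maps preserve this lattice, so the choice of the chart does
not matter, and the theorem says that \<open>N 1 = vol M\<close>. It results from two descriptions of the
function \<open>N\<close>, one of which controls large \<open>k\<close> very precisely and the other of which carries
information from large \<open>k\<close> back to \<open>k = 1\<close>.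

\<^item> Choose a partition of unity of class \<open>C\<^bsup>n+1\<^esup>\<close> subordinate to finitely many charts. It writes \<open>N k\<close> as a
  finite sum of sums of compactly supported functions on \<open>\<real>\<^sup>n\<close> over \<open>(1/k) \<int>\<^sup>n\<close>. Such a sum differs from
  \<open>k\<^sup>n\<close> times the integral only by \<open>O(1/k)\<close>, since no boundary terms occur
  (\<open>smooth_lattice_sum_asymptotics\<close>). Hence \<open>N k = k\<^sup>n vol M + O(1/k)\<close>
  (\<open>card_lattice_points_asymptotics\<close> and \<open>vol_eq\<close>).

\<^item> Cut \<open>M\<close> into finitely many pieces, each of which is given in a chart by linear inequalities with
  rational coefficients. By a form of Ehrhart's theorem (\<open>Ehrhart_quasi_polynomial\<close>) the number of
  points of \<open>(1/k) \<int>\<^sup>n\<close> in such a bounded set is a quasi-polynomial in \<open>k\<close>. The cone over the set is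
  described by homogeneous inequalities, and for that reason the formula holds from \<open>k = 1\<close> on,
  without exceptions for small \<open>k\<close>. Hence there are \<open>q > 0\<close> and a polynomial \<open>p\<close> with
  \<open>N (1 + q j) = p j\<close> for all \<open>j \<ge> 0\<close> (\<open>card_lattice_points_polynomial\<close>).

Therefore the polynomial \<open>p(j) - (1 + q j)\<^sup>n vol M\<close> tends to \<open>0\<close> as \<open>j\<close> tends to infinity, so it is zero, and its
value at \<open>j = 0\<close> is \<open>N 1 - vol M\<close>.

The measure of \<open>M\<close> is built from the same partition of unity, which makes its total mass the constant
in the asymptotic formula. That it does not depend on the charts rests on the invariance of Lebesgue
measure under integral affine maps: a translation invariant measure is determined by the mass of a
fundamental domain of the lattice, and an element of \<open>GL(n, \<int>)\<close> maps fundamental domains to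
fundamental domains.
\<close>

section \<open>Quasi-polynomials in one variable\<close>

text \<open>
The difference operator lowers the degree of a monomial by one and multiplies the leading
coefficient by the old degree, so the leading term of \<open>p\<close> can be removed.
\<close>

lemma poly_antidifference:
  fixes p :: "real poly"
  shows "\<exists>s. \<forall>x. poly s (x + 1) - poly s x = poly p x"
proof (induction "degree p" arbitrary: p rule: less_induct)
  case less
  define d where "d = degree p"
  define c where "c = lead_coeff p / real (Suc d)"
  define u where "u = monom c (Suc d)"
  define du where "du = (\<Sum>i\<le>d. monom (c * real (Suc d choose i)) i)"
  have du: "poly u (x + 1) - poly u x = poly du x" for x
  proof -
    have "(x + 1) ^ Suc d = (\<Sum>i\<le>Suc d. real (Suc d choose i) * x ^ i)"
      by (subst binomial_ring) (simp only: power_one mult_1_right)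
    also have "\<dots> = (\<Sum>i\<le>d. real (Suc d choose i) * x ^ i) + x ^ Suc d"
      by (subst sum.atMost_Suc) simp
    finally show ?thesis
      by (simp only: u_def du_def poly_monom poly_sum)
        (simp add: algebra_simps sum_distrib_left)
  qed
  have coeff: "coeff (p - du) i = 0" if "i \<ge> d" for i
  proof (cases "i = d")
    case True
    have "coeff du d = (\<Sum>j\<le>d. if j = d then c * real (Suc d choose d) else 0)"
      unfolding du_def coeff_sum by (intro sum.cong) auto
    also have "\<dots> = lead_coeff p" by (simp add: c_def)
    finally show ?thesis using True by (simp add: d_def)
  next
    case False
    with that have "i > d" by simp
    moreover have "coeff du i = 0"
      unfolding du_def coeff_sum using \<open>i > d\<close> by (intro sum.neutral) auto
    ultimately show ?thesis by (simp add: d_def coeff_eq_0)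
  qed
  show ?case
  proof (cases "p - du = 0")
    case True
    then show ?thesis using du by (metis eq_iff_diff_eq_0)
  next
    case False
    then have "degree (p - du) < degree p"
      using coeff d_def by (metis leading_coeff_neq_0 linorder_not_less)
    from less[OF this] obtain s where s: "poly s (x + 1) - poly s x = poly (p - du) x" for x
      by blast
    have "poly (s + u) (x + 1) - poly (s + u) x = poly p x" for x
      using s[of x] du[of x] by simp
    then show ?thesis by blast
  qed
qed

text \<open>
Polynomial on each residue class of some modulus. Arguments of both signs are included, because
arguments such as \<open>- (y div c)\<close> are substituted later.
\<close>

definition quasi_poly :: "(int \<Rightarrow> real) set" where
  "quasi_poly = {f. \<exists>q>0. \<forall>s. \<exists>P. \<forall>j. f (s + int q * j) = poly P (of_int j)}"

text \<open>
Every multiple of a period is a period; in this form two quasi-polynomials get a common period.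
\<close>

lemma quasi_poly_E:
  assumes "f \<in> quasi_poly"
  obtains q where "q > 0"
    "\<And>m s. \<exists>P. \<forall>j. f (s + int q * (int m * j)) = poly P (of_int j)"
proof -
  from assms obtain q where q: "q > 0" "\<And>s. \<exists>P. \<forall>j. f (s + int q * j) = poly P (of_int j)"
    unfolding quasi_poly_def by blast
  have "\<exists>P. \<forall>j. f (s + int q * (int m * j)) = poly P (of_int j)" for m s
  proof -
    obtain P where P: "\<And>j. f (s + int q * j) = poly P (of_int j)" using q(2) by blast
    show ?thesis
      by (rule exI[of _ "pcompose P [:0, of_nat m:]"]) (simp add: P poly_pcompose mult.commute)
  qed
  with q(1) show ?thesis by (rule that)
qed

lemma quasi_poly_binop:
  assumes f: "f \<in> quasi_poly" and g: "g \<in> quasi_poly"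
    and op: "\<And>P Q. \<exists>R. \<forall>x::real. poly R x = op (poly P x) (poly Q x)"
  shows "(\<lambda>y. op (f y) (g y)) \<in> quasi_poly"
proof -
  from quasi_poly_E[OF f] obtain q where q: "q > 0"
    "\<And>m s. \<exists>P. \<forall>j. f (s + int q * (int m * j)) = poly P (of_int j)" by metis
  from quasi_poly_E[OF g] obtain r where r: "r > 0"
    "\<And>m s. \<exists>P. \<forall>j. g (s + int r * (int m * j)) = poly P (of_int j)" by metis
  \<comment> \<open>The product of the periods is a common period.\<close>
  have "\<exists>R. \<forall>j. op (f (s + int (q * r) * j)) (g (s + int (q * r) * j)) = poly R (of_int j)" for s
  proof -
    obtain P where P: "\<And>j. f (s + int q * (int r * j)) = poly P (of_int j)" using q(2) by blast
    obtain Q where Q: "\<And>j. g (s + int r * (int q * j)) = poly Q (of_int j)" using r(2) by blast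
    obtain R where R: "\<And>x. poly R x = op (poly P x) (poly Q x)" using op by blast
    show ?thesis
    proof (intro exI[of _ R] allI)
      fix j
      have "s + int (q * r) * j = s + int q * (int r * j)" "s + int (q * r) * j = s + int r * (int q * j)"
        by (simp_all add: algebra_simps)
      then show "op (f (s + int (q * r) * j)) (g (s + int (q * r) * j)) = poly R (of_int j)"
        using P Q R by metis
    qed
  qed
  moreover have "q * r > 0" using q(1) r(1) by simp
  ultimately show ?thesis unfolding quasi_poly_def by blast
qed

lemma quasi_poly_mult: "f \<in> quasi_poly \<Longrightarrow> g \<in> quasi_poly \<Longrightarrow> (\<lambda>y. f y * g y) \<in> quasi_poly"
  by (rule quasi_poly_binop) (auto intro: poly_mult)

lemma quasi_poly_const: "(\<lambda>y. c) \<in> quasi_poly"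
  unfolding quasi_poly_def by (auto intro!: exI[of _ 1] exI[of _ "[:c:]"])

lemma quasi_poly_of_int: "(\<lambda>y. of_int y) \<in> quasi_poly"
  unfolding quasi_poly_def
proof (rule CollectI, rule exI[of _ 1], intro conjI allI)
  fix s :: int
  show "\<exists>P. \<forall>j. (of_int (s + int 1 * j) :: real) = poly P (of_int j)"
    by (rule exI[of _ "[:of_int s, 1:]"]) simp
qed simp

lemma quasi_poly_residue: "q > 0 \<Longrightarrow> (\<lambda>y. of_bool (y mod int q = r)) \<in> quasi_poly"
  unfolding quasi_poly_def
proof (intro CollectI exI[of _ q] conjI allI)
  fix s :: int
  show "\<exists>P. \<forall>j. (of_bool ((s + int q * j) mod int q = r) :: real) = poly P (of_int j)"
    by (rule exI[of _ "[:of_bool (s mod int q = r):]"]) simp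
qed simp

text \<open>
The least \<open>y\<close> with \<open>c * y + u \<ge> d\<close> is \<open>- ((u - d) div c)\<close>. The lemma thus evaluates an antidifference
just below the lower end of a summation range; \<open>(u - d) div c\<close> is itself affine along residue
classes modulo multiples of \<open>c\<close>.
\<close>

lemma quasi_poly_ceiling:
  assumes f: "f \<in> quasi_poly" and c: "c > 0"
  shows "(\<lambda>u. f (- ((u - d) div int c) - 1)) \<in> quasi_poly"
proof -
  from f obtain q where q: "q > 0" "\<And>s. \<exists>P. \<forall>j. f (s + int q * j) = poly P (of_int j)"
    unfolding quasi_poly_def by blast
  have "\<exists>P. \<forall>j. f (- ((s + int (c * q) * j - d) div int c) - 1) = poly P (of_int j)" for s
  proof -
    define s' where "s' = - ((s - d) div int c) - 1"
    obtain P where P: "\<And>j. f (s' + int q * j) = poly P (of_int j)" using q(2) by blast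
    have "- ((s + int (c * q) * j - d) div int c) - 1 = s' + int q * (- j)" for j
    proof -
      have "s + int (c * q) * j - d = (s - d) + int c * (int q * j)" by (simp add: algebra_simps)
      also have "\<dots> div int c = (s - d) div int c + int q * j" using c by simp
      finally show ?thesis by (simp add: s'_def)
    qed
    then have "f (- ((s + int (c * q) * j - d) div int c) - 1) = poly (pcompose P [:0, -1:]) (of_int j)" for j
      by (simp only: P poly_pcompose) simp
    then show ?thesis by blast
  qed
  moreover have "c * q > 0" using c q by simp
  ultimately show ?thesis unfolding quasi_poly_def by blast
qed

lemma int_rec_eqI:
  fixes f g :: "int \<Rightarrow> real"
  assumes "f 0 = g 0" and "\<And>j. f (j + 1) - f j = g (j + 1) - g j"
  shows "f j = g j"
proof (induction j rule: int_induct[where k = 0])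
  case base show ?case by (rule assms)
next
  case (step1 i) with assms(2)[of i] show ?case by simp
next
  case (step2 i) with assms(2)[of "i - 1"] show ?case by simp
qed

lemma int_antidifference:
  fixes f :: "int \<Rightarrow> real"
  obtains F where "\<And>y. F y - F (y - 1) = f y"
proof
  fix y
  show "(sum f {0<..y} - sum f {y<..0}) - (sum f {0<..y - 1} - sum f {y - 1<..0}) = f y"
  proof (cases "y > 0")
    case True
    then have "{0<..y} = insert y {0<..y - 1}" by auto
    with True show ?thesis by simp
  next
    case False
    then have "{y - 1<..0} = insert y {y<..0}" by auto
    with False show ?thesis by simp
  qed
qed

text \<open>
Over one full period, starting in a fixed residue class, an antidifference \<open>F\<close> grows by a sum of \<open>q\<close>
values of \<open>f\<close>, which is polynomial in the number of the period. So on each residue class \<open>F\<close> is an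
antidifference of a polynomial.
\<close>

lemma quasi_poly_antidifference:
  assumes f: "f \<in> quasi_poly"
  obtains F where "F \<in> quasi_poly" "\<And>y. F y - F (y - 1) = f y"
proof -
  obtain F where F: "\<And>y. F y - F (y - 1) = f y" using int_antidifference by blast
  from f obtain q where q: "q > 0" "\<And>s. \<exists>P. \<forall>j. f (s + int q * j) = poly P (of_int j)"
    unfolding quasi_poly_def by blast
  have "\<exists>P. \<forall>j. F (s + int q * j) = poly P (of_int j)" for s
  proof -
    obtain P where P: "\<And>t j. f (t + int q * j) = poly (P t) (of_int j)" using q(2) by metis
    define R where "R = (\<Sum>i<q. P (s + int i + 1))"
    obtain S where S: "\<And>x. poly S (x + 1) - poly S x = poly R x" using poly_antidifference by blast
    have block: "F (t + int m) - F t = (\<Sum>i<m. f (t + int i + 1))" for t m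
    proof (induction m)
      case (Suc m)
      have "F (t + int (Suc m)) - F (t + int m) = f (t + int m + 1)"
        using F[of "t + int m + 1"] by (simp add: algebra_simps)
      with Suc show ?case by simp
    qed simp
    have "F (s + int q * j) - F s = poly S (of_int j) - poly S 0" for j
    proof (rule int_rec_eqI[where f = "\<lambda>j. F (s + int q * j) - F s" and g = "\<lambda>j. poly S (of_int j) - poly S 0"])
      fix j
      have "F (s + int q * (j + 1)) - F (s + int q * j) = (\<Sum>i<q. f (s + int q * j + int i + 1))"
        using block[of "s + int q * j" q] by (simp add: algebra_simps)
      also have "\<dots> = (\<Sum>i<q. poly (P (s + int i + 1)) (of_int j))"
        by (intro sum.cong refl) (simp add: P[symmetric] algebra_simps)
      also have "\<dots> = poly S (of_int j + 1) - poly S (of_int j)" by (simp add: S R_def poly_sum)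
      finally show "F (s + int q * (j + 1)) - F s - (F (s + int q * j) - F s) =
          poly S (of_int (j + 1)) - poly S 0 - (poly S (of_int j) - poly S 0)" by simp
    qed simp
    then have "F (s + int q * j) = poly (S + [:F s - poly S 0:]) (of_int j)" for j
      by (simp add: algebra_simps)
    then show ?thesis by blast
  qed
  then have "F \<in> quasi_poly" unfolding quasi_poly_def using q(1) by blast
  then show ?thesis using F by (rule that)
qed

section \<open>Quasi-polynomials on rational cones\<close>

definition lin_form :: "nat \<Rightarrow> (nat \<Rightarrow> int) \<Rightarrow> (nat \<Rightarrow> int) \<Rightarrow> int" where
  "lin_form d a x = (\<Sum>i<d. a i * x i)"

text \<open>
Only the variables \<open>x 0, \<dots>, x (d - 1)\<close> matter; \<open>x 0\<close> will be the dilation factor \<open>k\<close>. The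
conditions \<open>lin_form d a x \<ge> 0\<close> have no constant term. In a function of \<open>x 0\<close> alone they can thus only
depend on the sign of \<open>x 0\<close> and never separate small positive values from large ones. The whole
point of the class is that it is closed under summation over a variable.
\<close>

inductive_set conic_qp :: "nat \<Rightarrow> ((nat \<Rightarrow> int) \<Rightarrow> real) set" for d where
  const: "(\<lambda>x. c) \<in> conic_qp d"
| lin_form: "(\<lambda>x. of_int (lin_form d a x)) \<in> conic_qp d"
| residue: "q > 0 \<Longrightarrow> (\<lambda>x. of_bool (lin_form d a x mod int q = r)) \<in> conic_qp d"
| sign: "(\<lambda>x. of_bool (lin_form d a x \<ge> 0)) \<in> conic_qp d"
| add: "f \<in> conic_qp d \<Longrightarrow> g \<in> conic_qp d \<Longrightarrow> (\<lambda>x. f x + g x) \<in> conic_qp d"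
| mult: "f \<in> conic_qp d \<Longrightarrow> g \<in> conic_qp d \<Longrightarrow> (\<lambda>x. f x * g x) \<in> conic_qp d"

lemma conic_qp_diff: "f \<in> conic_qp d \<Longrightarrow> g \<in> conic_qp d \<Longrightarrow> (\<lambda>x. f x - g x) \<in> conic_qp d"
  using conic_qp.add[OF _ conic_qp.mult[OF conic_qp.const[of "-1"]], of f d g] by simp

lemma conic_qp_sum: "finite I \<Longrightarrow> (\<And>i. i \<in> I \<Longrightarrow> f i \<in> conic_qp d) \<Longrightarrow> (\<lambda>x. \<Sum>i\<in>I. f i x) \<in> conic_qp d"
  by (induction I rule: finite_induct) (auto intro: conic_qp.const conic_qp.add)

lemma conic_qp_poly: "f \<in> conic_qp d \<Longrightarrow> (\<lambda>x. poly p (f x)) \<in> conic_qp d"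
  by (induction p) (auto intro: conic_qp.const conic_qp.add conic_qp.mult)

lemma lin_form_minus: "lin_form d (\<lambda>i. - a i) x = - lin_form d a x"
  by (simp add: lin_form_def sum_negf)

lemma conic_qp_pos: "(\<lambda>x. of_bool (lin_form d a x > 0)) \<in> conic_qp d"
proof -
  have "(\<lambda>x. 1 - of_bool (lin_form d (\<lambda>i. - a i) x \<ge> 0)) \<in> conic_qp d"
    by (intro conic_qp_diff conic_qp.const conic_qp.sign)
  also have "(\<lambda>x. 1 - of_bool (lin_form d (\<lambda>i. - a i) x \<ge> 0)) = (\<lambda>x. of_bool (lin_form d a x > 0) :: real)"
    by (auto simp: lin_form_minus)
  finally show ?thesis .
qed

lemma conic_qp_quasi_poly:
  assumes "U \<in> quasi_poly"
  shows "(\<lambda>x. U (lin_form d a x)) \<in> conic_qp d"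
proof -
  from assms obtain q where q: "q > 0" "\<And>s. \<exists>P. \<forall>j. U (s + int q * j) = poly P (of_int j)"
    unfolding quasi_poly_def by blast
  then obtain P where P: "\<And>s j. U (s + int q * j) = poly (P s) (of_int j)" by metis
  have U_eq: "U u = (\<Sum>s<q. of_bool (u mod int q = int s) * poly (P (int s)) ((of_int u + - real s) * (1 / real q)))"
    for u
  proof -
    define s where "s = nat (u mod int q)"
    have s: "s < q" "u mod int q = int s"
      using q(1) by (auto simp: s_def nat_less_iff)
    have "u = int s + int q * (u div int q)" using s(2) by (metis mod_mult_div_eq)
    then have "U u = poly (P (int s)) (of_int (u div int q))" using P by metis
    also have "of_int (u div int q) = (of_int u + - real s) * (1 / real q)"
    proof -
      have "of_int u = (real s + real q * of_int (u div int q))"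
        using \<open>u = int s + int q * (u div int q)\<close>
        by (metis of_int_add of_int_mult of_int_of_nat_eq)
      then show ?thesis using q(1) by (simp add: field_simps)
    qed
    also have "poly (P (int s)) ((of_int u + - real s) * (1 / real q)) =
      (\<Sum>t<q. if t = s then poly (P (int t)) ((of_int u + - real t) * (1 / real q)) else 0)"
      using s(1) by simp
    also have "\<dots> = (\<Sum>t<q. of_bool (u mod int q = int t) * poly (P (int t)) ((of_int u + - real t) * (1 / real q)))"
      by (intro sum.cong refl) (simp add: s(2))
    finally show ?thesis .
  qed
  have "(\<lambda>x. U (lin_form d a x)) = (\<lambda>x. \<Sum>s<q. of_bool (lin_form d a x mod int q = int s) *
      poly (P (int s)) ((of_int (lin_form d a x) + - real s) * (1 / real q)))" by (intro ext) (rule U_eq)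
  also have "\<dots> \<in> conic_qp d"
    by (intro conic_qp_sum finite_lessThan conic_qp.mult conic_qp.residue conic_qp_poly conic_qp.add conic_qp.lin_form conic_qp.const q(1))
  finally show ?thesis .
qed

lemma lin_form_subst_linear:
  assumes "\<And>i. i < d \<Longrightarrow> \<exists>b. \<forall>x. T x i = lin_form e b x"
  shows "\<exists>b. \<forall>x. lin_form d a (T x) = lin_form e b x"
proof -
  from assms obtain B where B: "\<And>i x. i < d \<Longrightarrow> T x i = lin_form e (B i) x" by metis
  have "lin_form d a (T x) = lin_form e (\<lambda>j. \<Sum>i<d. a i * B i j) x" for x
    unfolding lin_form_def
    by (simp add: B lin_form_def sum_distrib_left sum_distrib_right mult.assoc)
       (rule sum.swap)
  then show ?thesis by blast
qed

lemma conic_qp_subst: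
  assumes "f \<in> conic_qp d" and T: "\<And>i. i < d \<Longrightarrow> \<exists>b. \<forall>x. T x i = lin_form e b x"
  shows "(\<lambda>x. f (T x)) \<in> conic_qp e"
  using assms(1)
proof induction
  case (lin_form a)
  obtain b where "\<And>x. lin_form d a (T x) = lin_form e b x" using lin_form_subst_linear[of d T e a] T by blast
  then show ?case by (simp add: conic_qp.lin_form)
next
  case (residue q a r)
  obtain b where "\<And>x. lin_form d a (T x) = lin_form e b x" using lin_form_subst_linear[of d T e a] T by blast
  with residue show ?case by (simp add: conic_qp.residue)
next
  case (sign a)
  obtain b where "\<And>x. lin_form d a (T x) = lin_form e b x" using lin_form_subst_linear[of d T e a] T by blast
  then show ?case by (simp add: conic_qp.sign)
qed (auto intro: conic_qp.intros)

lemma lin_form_unit: "i < d \<Longrightarrow> lin_form d (\<lambda>j. if j = i then c else 0) x = c * x i"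
  unfolding lin_form_def by (subst sum.cong[OF refl, of _ _ "\<lambda>j. if j = i then c * x i else 0"]) auto

lemma conic_qp_mono:
  assumes "f \<in> conic_qp d" "d \<le> e"
  shows "f \<in> conic_qp e"
proof (rule conic_qp_subst[OF assms(1), of "\<lambda>x. x"])
  fix i assume "i < d"
  with assms(2) have "i < e" by simp
  then have "\<forall>x. x i = lin_form e (\<lambda>j. if j = i then 1 else 0) x" by (simp add: lin_form_unit)
  then show "\<exists>b. \<forall>x. x i = lin_form e b x" by blast
qed

lemma conic_qp_indep:
  assumes "f \<in> conic_qp d" "\<And>i. i < d \<Longrightarrow> x i = y i"
  shows "f x = f y"
  using assms(1)
proof induction
qed (use assms(2) in \<open>auto simp: lin_form_def\<close>)

lemma lin_form_Suc: "lin_form (Suc d) a x = lin_form d a x + a d * x d"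
  by (simp add: lin_form_def)

section \<open>Summation over a variable\<close>

text \<open>
Lower bounds for the last variable \<open>x d\<close> in terms of the others; on integers a strict bound is
expressed by \<open>\<delta> = True\<close>.
\<close>

definition threshold :: "nat \<Rightarrow> ((nat \<Rightarrow> int) \<Rightarrow> bool) set" where
  "threshold d = insert (\<lambda>x. True) {\<lambda>x. int c * x d + lin_form d a x \<ge> of_bool \<delta> | c a \<delta>. c > 0}"

text \<open>
A normal form in which the last variable is separated: in each summand it occurs only in a
quasi-polynomial of its own and in a single lower bound. Such summands can be summed explicitly.
\<close>

inductive_set conic_nf :: "nat \<Rightarrow> ((nat \<Rightarrow> int) \<Rightarrow> real) set" for d where
  mono: "g \<in> conic_qp d \<Longrightarrow> p \<in> quasi_poly \<Longrightarrow> T \<in> threshold d \<Longrightarrow> (\<lambda>x. g x * p (x d) * of_bool (T x)) \<in> conic_nf d"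
| add: "f \<in> conic_nf d \<Longrightarrow> g \<in> conic_nf d \<Longrightarrow> (\<lambda>x. f x + g x) \<in> conic_nf d"

lemma True_threshold: "(\<lambda>x. True) \<in> threshold d"
  by (simp add: threshold_def)

lemma lin_form_combine: "lin_form d (\<lambda>i. c * a i - e * b i) x = c * lin_form d a x - e * lin_form d b x"
  by (simp add: lin_form_def sum_distrib_left sum_subtractf algebra_simps)

text \<open>
Of two lower bounds for the last variable the larger one decides, and which of them is larger is
again a homogeneous condition on the remaining variables. Cross-multiplying two bounds on
\<open>c * x d + u\<close> and \<open>e * x d + v\<close> shows that this is the sign of \<open>e * u - c * v\<close>; ties are resolved in
favour of the strict bound.
\<close>

lemma threshold_combine:
  assumes "S \<in> threshold d" "T \<in> threshold d"
  shows "\<exists>k\<in>conic_qp d. \<forall>x. (of_bool (S x \<and> T x) :: real) = k x * of_bool (T x) + (1 - k x) * of_bool (S x)"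
proof -
  consider "S = (\<lambda>x. True)" | "T = (\<lambda>x. True)"
    | c a \<delta> e b \<epsilon> where "c > 0" "e > 0" "S = (\<lambda>x. int c * x d + lin_form d a x \<ge> of_bool \<delta>)"
       "T = (\<lambda>x. int e * x d + lin_form d b x \<ge> of_bool \<epsilon>)"
    using assms by (auto simp: threshold_def)
  then show ?thesis
  proof cases
    case 1
    then show ?thesis by (intro bexI[OF _ conic_qp.const[of 1]]) auto
  next
    case 2
    then show ?thesis by (intro bexI[OF _ conic_qp.const[of 0]]) auto
  next
    case 3
    define w where "w x = lin_form d (\<lambda>i. int e * a i - int c * b i) x" for x
    \<comment> \<open>\<open>k x\<close> states that the second bound is the stronger one.\<close>
    define k where "k x = (if \<delta> \<and> \<not> \<epsilon> then w x > 0 else w x \<ge> 0)" for x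
    have kQ: "(\<lambda>x. of_bool (k x)) \<in> conic_qp d"
      unfolding k_def w_def by (cases "\<delta> \<and> \<not> \<epsilon>") (auto intro: conic_qp.sign conic_qp_pos)
    have eq: "of_bool (S x \<and> T x) = of_bool (k x) * of_bool (T x) + (1 - of_bool (k x)) * (of_bool (S x) :: real)" for x
    proof -
      define s where "s = int c * x d + lin_form d a x"
      define t where "t = int e * x d + lin_form d b x"
      have wst: "w x = int e * s - int c * t"
        by (simp add: w_def lin_form_combine s_def t_def algebra_simps)
      have ST: "S x \<longleftrightarrow> s \<ge> of_bool \<delta>" "T x \<longleftrightarrow> t \<ge> of_bool \<epsilon>"
        using 3 by (simp_all add: s_def t_def)
      have "S x" if "k x" "T x"
      proof (rule ccontr)
        assume "\<not> S x"
        then have s: "s < of_bool \<delta>" using ST by simp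
        have t: "t \<ge> of_bool \<epsilon>" using that ST by simp
        then have t0: "t \<ge> 0" by (cases \<epsilon>) auto
        show False
        proof (cases "s < 0")
          case True
          then have "int e * s < 0" using \<open>e > 0\<close> by (simp add: mult_less_0_iff)
          moreover have "int c * t \<ge> 0" using t0 by simp
          ultimately show False using wst that(1) by (auto simp: k_def split: if_splits)
        next
          case False
          with s have "s = 0" \<delta> by (auto simp: of_bool_def split: if_splits)
          then have "w x = - (int c * t)" using wst by simp
          moreover have "int c * t \<ge> 0" "\<epsilon> \<Longrightarrow> int c * t > 0" using t t0 \<open>c > 0\<close> by simp_all
          ultimately show False using that(1) \<open>\<delta>\<close> by (auto simp: k_def split: if_splits)
        qed
      qed
      moreover have "T x" if "\<not> k x" "S x"
      proof (rule ccontr)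
        assume "\<not> T x"
        then have t: "t < of_bool \<epsilon>" using ST by simp
        have s: "s \<ge> of_bool \<delta>" using that ST by simp
        then have s0: "s \<ge> 0" by (cases \<delta>) auto
        show False
        proof (cases "t < 0")
          case True
          then have "int c * t < 0" using \<open>c > 0\<close> by (simp add: mult_less_0_iff)
          moreover have "int e * s \<ge> 0" using s0 by simp
          ultimately show False using wst that(1) by (auto simp: k_def split: if_splits)
        next
          case False
          with t have "t = 0" \<epsilon> by (auto simp: of_bool_def split: if_splits)
          then have "w x = int e * s" using wst by simp
          moreover have "int e * s \<ge> 0" "\<delta> \<Longrightarrow> int e * s > 0" using s s0 \<open>e > 0\<close> by simp_all
          ultimately show False using that(1) \<open>\<epsilon>\<close> by (auto simp: k_def split: if_splits)
        qed
      qed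
      ultimately show ?thesis by auto
    qed
    show ?thesis using eq by (rule bexI[OF allI kQ])
  qed
qed

lemma conic_nf_mult_mono:
  assumes "g \<in> conic_qp d" "p \<in> quasi_poly" "T \<in> threshold d" "h \<in> conic_qp d" "r \<in> quasi_poly" "S \<in> threshold d"
  shows "(\<lambda>x. (g x * p (x d) * of_bool (T x)) * (h x * r (x d) * of_bool (S x))) \<in> conic_nf d"
proof -
  from threshold_combine[OF assms(3,6)] obtain k where k: "k \<in> conic_qp d"
    "\<And>x. (of_bool (T x \<and> S x) :: real) = k x * of_bool (S x) + (1 - k x) * of_bool (T x)" by blast
  have "(\<lambda>x. (g x * h x * k x) * (p (x d) * r (x d)) * of_bool (S x) +
      (g x * h x * (1 - k x)) * (p (x d) * r (x d)) * of_bool (T x)) \<in> conic_nf d"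
    by (intro conic_nf.add conic_nf.mono[of _ _ "\<lambda>y. p y * r y"] conic_qp.mult conic_qp_diff conic_qp.const quasi_poly_mult assms k(1))
  also have "(\<lambda>x. (g x * h x * k x) * (p (x d) * r (x d)) * of_bool (S x) +
      (g x * h x * (1 - k x)) * (p (x d) * r (x d)) * of_bool (T x)) =
      (\<lambda>x. (g x * h x * (p (x d) * r (x d))) * of_bool (T x \<and> S x))"
    unfolding k(2) by (simp add: algebra_simps)
  also have "\<dots> = (\<lambda>x. (g x * p (x d) * of_bool (T x)) * (h x * r (x d) * of_bool (S x)))"
    by auto
  finally show ?thesis .
qed

lemma conic_nf_mult:
  assumes "f \<in> conic_nf d" "g \<in> conic_nf d"
  shows "(\<lambda>x. f x * g x) \<in> conic_nf d"
  using assms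
proof (induction arbitrary: g)
  case (mono h p T)
  from mono(4) show ?case
  proof induction
    case (mono k r S)
    with \<open>h \<in> conic_qp d\<close> \<open>p \<in> quasi_poly\<close> \<open>T \<in> threshold d\<close> show ?case by (intro conic_nf_mult_mono)
  next
    case (add g1 g2)
    then show ?case using conic_nf.add by (simp add: distrib_left)
  qed
next
  case (add f1 f2)
  then show ?case using conic_nf.add by (simp add: distrib_right)
qed

lemma conic_nf_const_mult: "g \<in> conic_qp d \<Longrightarrow> p \<in> quasi_poly \<Longrightarrow> (\<lambda>x. g x * p (x d)) \<in> conic_nf d"
  using conic_nf.mono[OF _ _ True_threshold, of g d p] by simp

lemma conic_nf_conic_qp: "g \<in> conic_qp d \<Longrightarrow> g \<in> conic_nf d"
  using conic_nf_const_mult[OF _ quasi_poly_const[of 1], of g d] by simp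

lemma conic_nf_sum: "finite I \<Longrightarrow> (\<And>i. i \<in> I \<Longrightarrow> f i \<in> conic_nf d) \<Longrightarrow> (\<lambda>x. \<Sum>i\<in>I. f i x) \<in> conic_nf d"
  by (induction I rule: finite_induct) (auto intro: conic_nf_conic_qp conic_qp.const conic_nf.add)

lemma conic_nf_threshold: "T \<in> threshold d \<Longrightarrow> (\<lambda>x. of_bool (T x)) \<in> conic_nf d"
  using conic_nf.mono[OF conic_qp.const[of 1] quasi_poly_const[of 1], of T d] by simp

text \<open>
For residues, the last variable contributes through its own residue. A sign condition in which it
has a negative coefficient is an upper bound, that is, the complement of a strict lower bound.
\<close>

lemma conic_qp_imp_nf:
  assumes "f \<in> conic_qp (Suc d)"
  shows "f \<in> conic_nf d"
  using assms
proof induction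
  case (const c)
  show ?case by (intro conic_nf_conic_qp conic_qp.const)
next
  case (lin_form a)
  have "(\<lambda>x. of_int (lin_form d a x) + of_int (a d) * of_int (x d)) \<in> conic_nf d"
    by (intro conic_nf.add conic_nf_conic_qp conic_qp.lin_form conic_nf_const_mult conic_qp.const quasi_poly_of_int)
  then show ?case by (simp add: lin_form_Suc)
next
  case (residue q a r)
  have "(\<lambda>x. \<Sum>s<q. of_bool (lin_form d a x mod int q = (r - a d * int s) mod int q \<and> 0 \<le> r \<and> r < int q)
      * of_bool (x d mod int q = int s)) \<in> conic_nf d"
  proof (intro conic_nf_sum finite_lessThan conic_nf_const_mult quasi_poly_residue residue)
    fix s
    show "(\<lambda>x. of_bool (lin_form d a x mod int q = (r - a d * int s) mod int q \<and> 0 \<le> r \<and> r < int q)) \<in> conic_qp d"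
      using residue by (cases "0 \<le> r \<and> r < int q") (auto intro: conic_qp.residue conic_qp.const)
  qed
  also have "(\<lambda>x. \<Sum>s<q. of_bool (lin_form d a x mod int q = (r - a d * int s) mod int q \<and> 0 \<le> r \<and> r < int q)
      * of_bool (x d mod int q = int s)) = (\<lambda>x. of_bool (lin_form (Suc d) a x mod int q = r) :: real)"
  proof
    fix x
    define t where "t = nat (x d mod int q)"
    have t: "t < q" "x d mod int q = int t" using residue by (auto simp: t_def nat_less_iff)
    have "(\<Sum>s<q. of_bool (lin_form d a x mod int q = (r - a d * int s) mod int q \<and> 0 \<le> r \<and> r < int q)
      * of_bool (x d mod int q = int s)) =
      (\<Sum>s<q. if s = t then of_bool (lin_form d a x mod int q = (r - a d * int t) mod int q \<and> 0 \<le> r \<and> r < int q) else (0::real))"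
      by (intro sum.cong refl) (use t in auto)
    also have "\<dots> = of_bool (lin_form d a x mod int q = (r - a d * int t) mod int q \<and> 0 \<le> r \<and> r < int q)"
      using t by simp
    also have "(lin_form d a x mod int q = (r - a d * int t) mod int q) \<longleftrightarrow> ((lin_form d a x + a d * int t) mod int q = r mod int q)"
      by (simp add: mod_eq_dvd_iff algebra_simps)
    also have "(lin_form d a x + a d * int t) mod int q = lin_form (Suc d) a x mod int q"
      unfolding lin_form_Suc t(2)[symmetric] by (metis mod_add_right_eq mod_mult_right_eq)
    also have "(lin_form (Suc d) a x mod int q = r mod int q \<and> 0 \<le> r \<and> r < int q) \<longleftrightarrow> lin_form (Suc d) a x mod int q = r"
      using residue by auto
    finally show "(\<Sum>s<q. of_bool (lin_form d a x mod int q = (r - a d * int s) mod int q \<and> 0 \<le> r \<and> r < int q)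
      * of_bool (x d mod int q = int s)) = (of_bool (lin_form (Suc d) a x mod int q = r) :: real)" .
  qed
  finally show ?case .
next
  case (sign a)
  consider "a d = 0" | "a d > 0" | "a d < 0" by linarith
  then show ?case
  proof cases
    case 1
    then show ?thesis by (simp add: lin_form_Suc conic_nf_conic_qp conic_qp.sign)
  next
    case 2
    have "(\<lambda>x. int (nat (a d)) * x d + lin_form d a x \<ge> of_bool False) \<in> threshold d"
      unfolding threshold_def using 2 by (intro insertI2 CollectI exI[of _ "nat (a d)"] exI[of _ a] exI[of _ False]) simp
    from conic_nf_threshold[OF this] show ?thesis using 2 by (simp add: lin_form_Suc add.commute)
  next
    case 3
    have "(\<lambda>x. int (nat (- a d)) * x d + lin_form d (\<lambda>i. - a i) x \<ge> of_bool True) \<in> threshold d"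
      unfolding threshold_def using 3
      by (intro insertI2 CollectI exI[of _ "nat (- a d)"] exI[of _ "\<lambda>i. - a i"] exI[of _ True]) simp
    from conic_nf_threshold[OF this]
    have "(\<lambda>x. of_bool (int (nat (- a d)) * x d + lin_form d (\<lambda>i. - a i) x \<ge> of_bool True)) \<in> conic_nf d" .
    from conic_nf.add[OF conic_nf_conic_qp[OF conic_qp.const[of 1]] conic_nf_mult[OF conic_nf_conic_qp[OF conic_qp.const[of "-1"]] this]]
    have "(\<lambda>x. 1 + - 1 * of_bool (int (nat (- a d)) * x d + lin_form d (\<lambda>i. - a i) x \<ge> of_bool True)) \<in> conic_nf d" .
    also have "(\<lambda>x. 1 + - 1 * of_bool (int (nat (- a d)) * x d + lin_form d (\<lambda>i. - a i) x \<ge> of_bool True)) =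
      (\<lambda>x. of_bool (lin_form (Suc d) a x \<ge> 0) :: real)"
      using 3 by (auto simp: lin_form_Suc lin_form_minus)
    finally show ?thesis .
  qed
next
  case (add f g)
  then show ?case by (intro conic_nf.add)
next
  case (mult f g)
  then show ?case by (intro conic_nf_mult)
qed

lemma lin_form_upd_ge: "d \<le> e \<Longrightarrow> lin_form d a (x(e := y)) = lin_form d a x"
  by (simp add: lin_form_def)

lemma threshold_conic_qp:
  assumes "T \<in> threshold d"
  shows "(\<lambda>x. of_bool (T x)) \<in> conic_qp (Suc d)"
proof -
  consider "T = (\<lambda>x. True)" | c a \<delta> where "T = (\<lambda>x. int c * x d + lin_form d a x \<ge> of_bool \<delta>)"
    using assms by (auto simp: threshold_def)
  then show ?thesis
  proof cases
    case 1
    then show ?thesis by (simp add: conic_qp.const)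
  next
    case 2
    have l: "lin_form (Suc d) (a(d := int c)) x = int c * x d + lin_form d a x" for x
      by (simp add: lin_form_Suc) (simp add: lin_form_def)
    have "T x \<longleftrightarrow> (if \<delta> then lin_form (Suc d) (a(d := int c)) x > 0 else lin_form (Suc d) (a(d := int c)) x \<ge> 0)" for x
      by (auto simp: 2 l)
    then show ?thesis by (cases \<delta>) (auto simp: conic_qp.sign conic_qp_pos)
  qed
qed

text \<open>
On a summand with the lower bound \<open>x d \<ge> y\<^sub>0\<close>, let \<open>P\<close> be an antidifference of the quasi-polynomial in
the last variable and take \<open>P (x d) - P (y\<^sub>0 - 1)\<close> on the range and \<open>0\<close> below it. The correction
\<open>P (y\<^sub>0 - 1)\<close>, called \<open>V\<close> below, involves only the other variables and makes the jump at \<open>y\<^sub>0\<close> right.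
\<close>

lemma conic_qp_antidifference:
  assumes "f \<in> conic_qp (Suc d)"
  shows "\<exists>F\<in>conic_qp (Suc d). \<forall>x. F x - F (x(d := x d - 1)) = f x"
  using conic_qp_imp_nf[OF assms]
proof induction
  case (mono g p T)
  obtain P where P: "P \<in> quasi_poly" "\<And>y. P y - P (y - 1) = p y" using quasi_poly_antidifference mono by metis
  have last: "(\<lambda>x. P (x d)) \<in> conic_qp (Suc d)"
    using conic_qp_quasi_poly[OF P(1), of "Suc d" "\<lambda>j. if j = d then 1 else 0"] by (simp add: lin_form_unit)
  have g: "g \<in> conic_qp (Suc d)" "g (x(d := y)) = g x" for x y
    using mono by (auto intro: conic_qp_mono conic_qp_indep)
  have "T = (\<lambda>x. True) \<or> (\<exists>c a \<delta>. c > 0 \<and> T = (\<lambda>x. int c * x d + lin_form d a x \<ge> of_bool \<delta>))"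
    using mono(3) unfolding threshold_def by blast
  then obtain V where V: "V \<in> conic_qp d" and jump: "\<And>x. T x \<Longrightarrow> \<not> T (x(d := x d - 1)) \<Longrightarrow> P (x d - 1) = V x"
     and up: "\<And>x. T (x(d := x d - 1)) \<Longrightarrow> T x"
  proof (elim disjE exE conjE)
    assume T: "T = (\<lambda>x. True)"
    show thesis by (rule that[OF conic_qp.const[of 0]]) (use T in auto)
  next
    fix c a \<delta> assume c: "c > 0" and T: "T = (\<lambda>x. int c * x d + lin_form d a x \<ge> of_bool \<delta>)"
    show thesis
    proof (rule that[OF conic_qp_quasi_poly[OF quasi_poly_ceiling[OF P(1) c, of "of_bool \<delta>"]]])
      fix x assume T1: "T x" and T2: "\<not> T (x(d := x d - 1))"
      define u where "u = lin_form d a x - of_bool \<delta>"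
      have "int c * x d + u \<ge> 0" using T1 by (simp add: T u_def)
      moreover have "int c * x d + u < int c" using T2 by (simp add: T u_def lin_form_upd_ge algebra_simps)
      ultimately have "u div int c = - x d"
        by (intro int_div_pos_eq[of _ _ _ "int c * x d + u"]) auto
      then show "P (x d - 1) = P (- ((lin_form d a x - of_bool \<delta>) div int c) - 1)"
        by (simp add: u_def)
    next
      fix x assume "T (x(d := x d - 1))"
      then show "T x" by (simp add: T lin_form_upd_ge algebra_simps)
    qed
  qed
  have FQ: "(\<lambda>x. g x * (P (x d) - V x) * of_bool (T x)) \<in> conic_qp (Suc d)"
    by (intro conic_qp.mult conic_qp_diff g last threshold_conic_qp mono) (auto intro: conic_qp_mono[OF V])
  have "g x * (P (x d) - V x) * of_bool (T x) -
     g (x(d := x d - 1)) * (P ((x(d := x d - 1)) d) - V (x(d := x d - 1))) * of_bool (T (x(d := x d - 1))) =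
     g x * p (x d) * of_bool (T x)" for x
  proof -
    have "V (x(d := x d - 1)) = V x" by (rule conic_qp_indep[OF V]) auto
    then show ?thesis
      using jump[of x] up[of x] P(2)[of "x d"]
      by (cases "T x"; cases "T (x(d := x d - 1))") (auto simp: g algebra_simps)
  qed
  then show ?case by (rule bexI[OF allI FQ])
next
  case (add f g)
  then obtain F G where F: "F \<in> conic_qp (Suc d)" "\<And>x. F x - F (x(d := x d - 1)) = f x"
    and G: "G \<in> conic_qp (Suc d)" "\<And>x. G x - G (x(d := x d - 1)) = g x" by blast
  have "(F x + G x) - (F (x(d := x d - 1)) + G (x(d := x d - 1))) = f x + g x" for x
    using F(2)[of x] G(2)[of x] by linarith
  then show ?case by (rule bexI[OF allI conic_qp.add[OF F(1) G(1)]])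
qed

lemma telescope_int:
  fixes F f :: "int \<Rightarrow> real"
  assumes "\<And>y. F y - F (y - 1) = f y"
  shows "(\<Sum>y\<in>{a..a + int m}. f y) = F (a + int m) - F (a - 1)"
proof (induction m)
  case 0
  then show ?case using assms[of a] by simp
next
  case (Suc m)
  have "{a..a + int (Suc m)} = insert (a + int (Suc m)) {a..a + int m}" by auto
  then show ?case using Suc assms[of "a + int (Suc m)"] by simp
qed

text \<open>
The sum telescopes to values of an antidifference \<open>F\<close> at the ends of the range. The upper end
\<open>R * x 0\<close> is a homogeneous substitution. The lower end \<open>- R * x 0 - 1\<close> is not, but \<open>F\<close> there equals
\<open>F - f\<close> at \<open>- R * x 0\<close>.
\<close>

lemma conic_qp_sum_last:
  assumes f: "f \<in> conic_qp (Suc d)" and d: "d > 0"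
  shows "\<exists>S\<in>conic_qp d. \<forall>x. x 0 \<ge> 0 \<longrightarrow> S x = (\<Sum>y\<in>{- (int R * x 0)..int R * x 0}. f (x(d := y)))"
proof -
  obtain F where F: "F \<in> conic_qp (Suc d)" "\<And>x. F x - F (x(d := x d - 1)) = f x"
    using conic_qp_antidifference[OF f] by blast
  have sub: "(\<lambda>x. h (x(d := c * x 0))) \<in> conic_qp d" if "h \<in> conic_qp (Suc d)" for h c
  proof (rule conic_qp_subst[OF that])
    fix i assume "i < Suc d"
    show "\<exists>b. \<forall>x. (x(d := c * x 0)) i = lin_form d b x"
      using \<open>i < Suc d\<close> d lin_form_unit[of 0 d c] lin_form_unit[of i d 1]
      by (cases "i = d") (auto intro: exI[of _ "\<lambda>j. if j = 0 then c else 0"]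
          exI[of _ "\<lambda>j. if j = i then 1 else 0"])
  qed
  define S where "S x = F (x(d := int R * x 0)) - (F (x(d := - int R * x 0)) - f (x(d := - int R * x 0)))" for x
  have "S \<in> conic_qp d" unfolding S_def by (intro conic_qp_diff sub F f)
  moreover have "S x = (\<Sum>y\<in>{- (int R * x 0)..int R * x 0}. f (x(d := y)))" if "x 0 \<ge> 0" for x
  proof -
    have tel: "F (x(d := y)) - F (x(d := y - 1)) = f (x(d := y))" for y
      using F(2)[of "x(d := y)"] by simp
    define m where "m = nat (2 * (int R * x 0))"
    have m: "int m = 2 * (int R * x 0)" using that by (simp add: m_def)
    show ?thesis
      using telescope_int[of "\<lambda>y. F (x(d := y))" "\<lambda>y. f (x(d := y))" "- (int R * x 0)" m, OF tel]
        tel[of "- (int R * x 0)"]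
      by (simp add: S_def m)
  qed
  ultimately show ?thesis by blast
qed

lemma conic_qp_sum_all:
  assumes "f \<in> conic_qp (Suc n)"
  shows "\<exists>S\<in>conic_qp 1. \<forall>x. x 0 \<ge> 0 \<longrightarrow> S x =
    (\<Sum>y\<in>{1..n} \<rightarrow>\<^sub>E {- (int R * x 0)..int R * x 0}. f (\<lambda>i. if i \<in> {1..n} then y i else x i))"
  using assms
proof (induction n arbitrary: f)
  case 0
  then show ?case by auto
next
  case (Suc n)
  obtain f' where f': "f' \<in> conic_qp (Suc n)"
    "\<And>x. x 0 \<ge> 0 \<Longrightarrow> f' x = (\<Sum>y\<in>{- (int R * x 0)..int R * x 0}. f (x(Suc n := y)))"
    using conic_qp_sum_last[OF Suc.prems] by blast
  obtain S where S: "S \<in> conic_qp 1" "\<And>x. x 0 \<ge> 0 \<Longrightarrow> S x =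
    (\<Sum>y\<in>{1..n} \<rightarrow>\<^sub>E {- (int R * x 0)..int R * x 0}. f' (\<lambda>i. if i \<in> {1..n} then y i else x i))"
    using Suc.IH[OF f'(1)] by blast
  have "S x = (\<Sum>y\<in>{1..Suc n} \<rightarrow>\<^sub>E {- (int R * x 0)..int R * x 0}. f (\<lambda>i. if i \<in> {1..Suc n} then y i else x i))"
    if "x 0 \<ge> 0" for x
  proof -
    define J where "J = {- (int R * x 0)..int R * x 0}"
    have ins: "{1..Suc n} = insert (Suc n) {1..n}" by auto
    have inj: "inj_on (\<lambda>(z, y). y(Suc n := z)) (J \<times> ({1..n} \<rightarrow>\<^sub>E J))"
      by (rule inj_combinator) simp
    have "(\<Sum>y\<in>{1..Suc n} \<rightarrow>\<^sub>E J. f (\<lambda>i. if i \<in> {1..Suc n} then y i else x i)) =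
      (\<Sum>(z, y)\<in>J \<times> ({1..n} \<rightarrow>\<^sub>E J). f (\<lambda>i. if i \<in> {1..Suc n} then (y(Suc n := z)) i else x i))"
      unfolding ins PiE_insert_eq sum.reindex[OF inj] by (simp only: o_def case_prod_unfold)
    also have "\<dots> = (\<Sum>z\<in>J. \<Sum>y\<in>{1..n} \<rightarrow>\<^sub>E J. f (\<lambda>i. if i \<in> {1..Suc n} then (y(Suc n := z)) i else x i))"
      by (simp add: sum.cartesian_product)
    also have "\<dots> = (\<Sum>y\<in>{1..n} \<rightarrow>\<^sub>E J. \<Sum>z\<in>J. f (\<lambda>i. if i \<in> {1..Suc n} then (y(Suc n := z)) i else x i))"
      by (rule sum.swap)
    also have "\<dots> = (\<Sum>y\<in>{1..n} \<rightarrow>\<^sub>E J. f' (\<lambda>i. if i \<in> {1..n} then y i else x i))"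
    proof (intro sum.cong refl)
      fix y assume "y \<in> {1..n} \<rightarrow>\<^sub>E J"
      have "f' (\<lambda>i. if i \<in> {1..n} then y i else x i) =
         (\<Sum>z\<in>J. f ((\<lambda>i. if i \<in> {1..n} then y i else x i)(Suc n := z)))"
        using that by (subst f'(2)) (auto simp: J_def)
      also have "\<dots> = (\<Sum>z\<in>J. f (\<lambda>i. if i \<in> {1..Suc n} then (y(Suc n := z)) i else x i))"
        by (intro sum.cong refl arg_cong[of _ _ f]) (auto simp: fun_eq_iff)
      finally show "(\<Sum>z\<in>J. f (\<lambda>i. if i \<in> {1..Suc n} then (y(Suc n := z)) i else x i)) =
         f' (\<lambda>i. if i \<in> {1..n} then y i else x i)" by simp
    qed
    also have "\<dots> = S x" using S(2)[of x, OF that] by (simp add: J_def)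
    finally show ?thesis by (simp add: J_def)
  qed
  with S(1) show ?case by blast
qed

text \<open>
The additional factor \<open>m\<close> provides common steps for several functions.
\<close>

definition poly_on_progressions :: "((nat \<Rightarrow> int) \<Rightarrow> real) \<Rightarrow> bool" where
  "poly_on_progressions f \<longleftrightarrow> (\<exists>q>0. \<forall>m. \<exists>p. \<forall>j. f (\<lambda>_. 1 + int (q * m) * int j) = poly p (real j))"

lemma poly_on_progressions_binop:
  assumes "poly_on_progressions f" "poly_on_progressions g"
    and op: "\<And>p r. \<exists>s. \<forall>y::real. poly s y = op (poly p y) (poly r y)"
  shows "poly_on_progressions (\<lambda>x. op (f x) (g x))"
proof -
  obtain q r where q: "q > 0" "\<And>m. \<exists>p. \<forall>j. f (\<lambda>_. 1 + int (q * m) * int j) = poly p (real j)"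
    and r: "r > 0" "\<And>m. \<exists>p. \<forall>j. g (\<lambda>_. 1 + int (r * m) * int j) = poly p (real j)"
    using assms(1,2) unfolding poly_on_progressions_def by blast
  show ?thesis
    unfolding poly_on_progressions_def
  proof (rule exI[of _ "q * r"], intro conjI allI)
    fix m
    obtain p1 where p1: "\<And>j. f (\<lambda>_. 1 + int (q * r * m) * int j) = poly p1 (real j)"
      using q(2)[of "r * m"] by (auto simp: mult.assoc)
    obtain p2 where p2: "\<And>j. g (\<lambda>_. 1 + int (q * r * m) * int j) = poly p2 (real j)"
      using r(2)[of "q * m"] by (auto simp: mult_ac)
    show "\<exists>p. \<forall>j. op (f (\<lambda>_. 1 + int (q * r * m) * int j)) (g (\<lambda>_. 1 + int (q * r * m) * int j)) = poly p (real j)"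
    proof -
      obtain s where "\<And>y. poly s y = op (poly p1 y) (poly p2 y)" using op by blast
      then show ?thesis unfolding p1 p2 by (intro exI[of _ s]) simp
    qed
  qed (use q r in simp)
qed

text \<open>
Along \<open>k = 1 + q j\<close> residues modulo divisors of \<open>q\<close> are constant, and the sign of a multiple of \<open>k\<close> is
constant because \<open>k > 0\<close>. This includes \<open>j = 0\<close>, which is the value needed in the end.
\<close>

lemma conic_qp_arith_progression:
  assumes "f \<in> conic_qp 1"
  shows "poly_on_progressions f"
  using assms
proof induction
  case (const c)
  show ?case unfolding poly_on_progressions_def by (auto intro!: exI[of _ 1] exI[of _ "[:c:]"])
next
  case (lin_form a)
  show ?case
    unfolding poly_on_progressions_def
  proof (rule exI[of _ 1], intro conjI allI)
    fix m
    show "\<exists>p. \<forall>j. real_of_int (lin_form 1 a (\<lambda>_. 1 + int (1 * m) * int j)) = poly p (real j)"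
      by (rule exI[of _ "[:of_int (a 0), of_int (a 0) * real m:]"]) (simp add: lin_form_def algebra_simps)
  qed simp
next
  case (residue q a r)
  show ?case
    unfolding poly_on_progressions_def
  proof (rule exI[of _ q], intro conjI allI)
    fix m
    have "lin_form 1 a (\<lambda>_. 1 + int (q * m) * int j) mod int q = a 0 mod int q" for j
    proof -
      have "lin_form 1 a (\<lambda>_. 1 + int (q * m) * int j) = a 0 + int q * (a 0 * int m * int j)"
        by (simp add: lin_form_def algebra_simps)
      then show ?thesis by simp
    qed
    then show "\<exists>p. \<forall>j. of_bool (lin_form 1 a (\<lambda>_. 1 + int (q * m) * int j) mod int q = r) = poly p (real j)"
      by (intro exI[of _ "[:of_bool (a 0 mod int q = r):]"]) simp
  qed (rule residue)
next
  case (sign a)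
  show ?case
    unfolding poly_on_progressions_def
  proof (rule exI[of _ 1], intro conjI allI)
    fix m
    have "lin_form 1 a (\<lambda>_. 1 + int (1 * m) * int j) \<ge> 0 \<longleftrightarrow> a 0 \<ge> 0" for j
    proof -
      have "1 + int m * int j > 0" by (simp add: add_pos_nonneg)
      then show ?thesis by (simp add: lin_form_def zero_le_mult_iff)
    qed
    then show "\<exists>p. \<forall>j. of_bool (lin_form 1 a (\<lambda>_. 1 + int (1 * m) * int j) \<ge> 0) = poly p (real j)"
      by (intro exI[of _ "[:of_bool (a 0 \<ge> 0):]"]) simp
  qed simp
next
  case (add f g)
  then show ?case by (intro poly_on_progressions_binop[where op = "(+)"]) (auto intro: poly_add)
next
  case (mult f g)
  then show ?case by (intro poly_on_progressions_binop[where op = "(*)"]) (auto intro: poly_mult)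
qed

section \<open>Ehrhart's theorem\<close>

text \<open>
The lattice \<open>(1/k) \<int>\<^sup>n\<close>.
\<close>

definition grid :: "nat \<Rightarrow> nat \<Rightarrow> (nat \<Rightarrow> real) set" where
  "grid n k = {..<n} \<rightarrow>\<^sub>E {r. real k * r \<in> \<int>}"

definition obox :: "nat \<Rightarrow> (nat \<Rightarrow> real) \<Rightarrow> (nat \<Rightarrow> real) \<Rightarrow> (nat \<Rightarrow> real) set" where
  "obox n a b = (\<Pi>\<^sub>E i\<in>{..<n}. {a i<..<b i})"

definition cbox_Rn :: "nat \<Rightarrow> (nat \<Rightarrow> real) \<Rightarrow> (nat \<Rightarrow> real) \<Rightarrow> (nat \<Rightarrow> real) set" where
  "cbox_Rn n a b = (\<Pi>\<^sub>E i\<in>{..<n}. {a i..b i})"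

abbreviation space_Rn :: "nat \<Rightarrow> (nat \<Rightarrow> real) set" where
  "space_Rn n \<equiv> {..<n} \<rightarrow>\<^sub>E UNIV"

abbreviation cube :: "nat \<Rightarrow> nat \<Rightarrow> (nat \<Rightarrow> real) set" where
  "cube n R \<equiv> cbox_Rn n (\<lambda>_. - real R) (\<lambda>_. real R)"

abbreviation linear_map :: "nat \<Rightarrow> (nat \<Rightarrow> nat \<Rightarrow> int) \<Rightarrow> (nat \<Rightarrow> real) \<Rightarrow> nat \<Rightarrow> real" where
  "linear_map n A \<equiv> affine_map n A (\<lambda>_. 0)"

abbreviation rational_points :: "nat \<Rightarrow> (nat \<Rightarrow> real) set" where
  "rational_points n \<equiv> {..<n} \<rightarrow>\<^sub>E \<rat>"

definition scaled_point :: "nat \<Rightarrow> (nat \<Rightarrow> int) \<Rightarrow> nat \<Rightarrow> real" where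
  "scaled_point n x = (\<lambda>i\<in>{..<n}. of_int (x (Suc i)) / of_int (x 0))"

text \<open>
These are the sets for which lattice points can be counted: boolean combinations of rational
half-spaces qualify. Membership of the rational point with common denominator \<open>x 0\<close> and numerators
\<open>x 1, \<dots>, x n\<close> is tested by a function that is homogeneous in its sign conditions.
\<close>

definition definable :: "nat \<Rightarrow> (nat \<Rightarrow> real) set \<Rightarrow> bool" where
  "definable n D \<longleftrightarrow> (\<exists>f\<in>conic_qp (Suc n). \<forall>x. x 0 \<ge> 1 \<longrightarrow> f x = of_bool (scaled_point n x \<in> D))"

lemma definable_cong:
  assumes "definable n D" "\<And>y. y \<in> space_Rn n \<Longrightarrow> y \<in> D \<longleftrightarrow> y \<in> D'"
  shows "definable n D'"
proof -
  have "scaled_point n x \<in> D \<longleftrightarrow> scaled_point n x \<in> D'" for x by (rule assms(2)) (auto simp: scaled_point_def)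
  with assms(1) show ?thesis by (simp add: definable_def)
qed

lemma definable_UNIV: "definable n UNIV"
  unfolding definable_def by (rule bexI[OF _ conic_qp.const[of 1]]) simp

lemma definable_Int: 
  assumes "definable n D" "definable n D'"
  shows "definable n (D \<inter> D')"
proof -
  from assms obtain f g where "f \<in> conic_qp (Suc n)" "g \<in> conic_qp (Suc n)"
    and *: "\<And>x. x 0 \<ge> 1 \<Longrightarrow> f x = of_bool (scaled_point n x \<in> D)" "\<And>x. x 0 \<ge> 1 \<Longrightarrow> g x = of_bool (scaled_point n x \<in> D')"
    unfolding definable_def by blast
  then have "(\<lambda>x. f x * g x) \<in> conic_qp (Suc n)" by (intro conic_qp.mult)
  then show ?thesis unfolding definable_def by (rule bexI[rotated]) (use * in auto)
qed

lemma definable_Compl: 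
  assumes "definable n D"
  shows "definable n (- D)"
proof -
  from assms obtain f where "f \<in> conic_qp (Suc n)"
    and *: "\<And>x. x 0 \<ge> 1 \<Longrightarrow> f x = of_bool (scaled_point n x \<in> D)"
    unfolding definable_def by blast
  then have "(\<lambda>x. 1 - f x) \<in> conic_qp (Suc n)" by (intro conic_qp_diff conic_qp.const)
  then show ?thesis unfolding definable_def by (rule bexI[rotated]) (use * in auto)
qed

lemma definable_Un: "definable n D \<Longrightarrow> definable n D' \<Longrightarrow> definable n (D \<union> D')"
  using definable_Compl[OF definable_Int[OF definable_Compl definable_Compl]] by (simp add: Compl_Int)

lemma definable_INT:
  "finite I \<Longrightarrow> (\<And>i. i \<in> I \<Longrightarrow> definable n (D i)) \<Longrightarrow> definable n (\<Inter>i\<in>I. D i)"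
  by (induction I rule: finite_induct) (auto intro: definable_UNIV definable_Int)

lemma definable_UN:
  "finite I \<Longrightarrow> (\<And>i. i \<in> I \<Longrightarrow> definable n (D i)) \<Longrightarrow> definable n (\<Union>i\<in>I. D i)"
  by (induction I rule: finite_induct) (auto intro: definable_Un definable_Compl[OF definable_UNIV, simplified])

text \<open>
Multiplying by the common denominator \<open>x 0\<close> turns the constant term into a multiple of \<open>x 0\<close>, so the
inequality becomes homogeneous.
\<close>

lemma definable_halfspace:
  assumes "r \<in> \<rat>"
  shows "definable n {y. (\<Sum>j<n. of_int (a j) * y j) + r \<ge> 0}"
proof -
  obtain p q where r: "r = of_int p / of_int q" "q > 0"
    using assms by (elim Rats_cases') auto
  \<comment> \<open>The coefficients of the inequality multiplied by \<open>q * x 0\<close>.\<close>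
  define c where "c i = (if i = 0 then p else q * a (i - 1))" for i
  have "scaled_point n x \<in> {y. (\<Sum>j<n. of_int (a j) * y j) + r \<ge> 0} \<longleftrightarrow> lin_form (Suc n) c x \<ge> 0" if "x 0 \<ge> 1" for x
  proof -
    have "lin_form (Suc n) c x = p * x 0 + (\<Sum>j<n. q * a j * x (Suc j))"
      unfolding lin_form_def sum.lessThan_Suc_shift by (simp add: c_def)
    then have "of_int (lin_form (Suc n) c x) = of_int q * of_int (x 0) * ((\<Sum>j<n. of_int (a j) * (of_int (x (Suc j)) / of_int (x 0))) + r)"
      using r that by (simp add: field_simps sum_distrib_left)
    also have "(\<Sum>j<n. of_int (a j) * (of_int (x (Suc j)) / of_int (x 0))) = (\<Sum>j<n. of_int (a j) * scaled_point n x j)"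
      by (intro sum.cong) (auto simp: scaled_point_def)
    finally have eq: "real_of_int (lin_form (Suc n) c x) = real_of_int q * real_of_int (x 0) * ((\<Sum>j<n. of_int (a j) * scaled_point n x j) + r)" .
    have "real_of_int (lin_form (Suc n) c x) \<ge> 0 \<longleftrightarrow> (\<Sum>j<n. of_int (a j) * scaled_point n x j) + r \<ge> 0"
    proof -
      have "real_of_int q * real_of_int (x 0) > 0" using r that by simp
      then show ?thesis unfolding eq by (metis zero_le_mult_iff not_less order_less_imp_le)
    qed
    then show ?thesis by simp
  qed
  then show ?thesis unfolding definable_def by (intro bexI[OF _ conic_qp.sign[of "Suc n" c]]) auto
qed

lemma definable_open_halfspace:
  assumes "r \<in> \<rat>"
  shows "definable n {y. (\<Sum>j<n. of_int (a j) * y j) + r > 0}"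
proof -
  have "definable n (- {y. (\<Sum>j<n. of_int (- a j) * y j) + - r \<ge> 0})"
    using assms by (intro definable_Compl definable_halfspace) auto
  moreover have "(- {y. (\<Sum>j<n. of_int (- a j) * y j) + - r \<ge> 0}) = {y. (\<Sum>j<n. of_int (a j) * y j) + r > 0}"
    by (auto simp: sum_negf)
  ultimately show ?thesis by simp
qed

lemma definable_affine_preimage:
  assumes "a \<in> rational_points n" "b \<in> rational_points n"
  shows "definable n {y. affine_map n A v y \<in> obox n a b}"
proof -
  define D where "D i = {y. (\<Sum>j<n. of_int (A i j) * y j) + (of_int (v i) - a i) > 0} \<inter>
     {y. (\<Sum>j<n. of_int (- A i j) * y j) + (b i - of_int (v i)) > 0}" for i
  have "definable n (\<Inter>i\<in>{..<n}. D i)"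
    unfolding D_def using assms
    by (intro definable_INT definable_Int definable_open_halfspace finite_lessThan) (auto simp: PiE_iff)
  moreover have "(\<Inter>i\<in>{..<n}. D i) = {y. affine_map n A v y \<in> obox n a b}"
  proof -
    have "y \<in> D i \<longleftrightarrow> a i < affine_map n A v y i \<and> affine_map n A v y i < b i" if "i < n" for y i
      using that by (auto simp: D_def affine_map_def sum_negf)
    moreover have "affine_map n A v y \<in> obox n a b \<longleftrightarrow> (\<forall>i<n. a i < affine_map n A v y i \<and> affine_map n A v y i < b i)" for y
      by (auto simp: obox_def PiE_iff affine_map_def)
    ultimately show ?thesis by auto
  qed
  ultimately show ?thesis by simp
qed

lemma affine_map_id:
  assumes "y \<in> space_Rn n"
  shows "affine_map n (\<lambda>i j. if i = j then 1 else 0) (\<lambda>_. 0) y = y"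
proof
  fix i
  have "(\<Sum>j<n. real_of_int (if i = j then 1 else 0) * y j) = (\<Sum>j<n. if j = i then y j else 0)"
    by (intro sum.cong) auto
  then show "affine_map n (\<lambda>i j. if i = j then 1 else 0) (\<lambda>_. 0) y i = y i"
    using assms by (auto simp: affine_map_def restrict_def PiE_iff extensional_def)
qed

lemma definable_obox:
  assumes "a \<in> rational_points n" "b \<in> rational_points n"
  shows "definable n (obox n a b)"
  by (rule definable_cong[OF definable_affine_preimage[OF assms,
      of "\<lambda>i j. if i = j then 1 else 0" "\<lambda>_. 0"]]) (simp add: affine_map_id)

text \<open>
The points of \<open>D \<inter> grid n k\<close> correspond to their integral numerators, which range over \<open>{-R k..R k}\<close>.
Summing the membership function of \<open>D\<close> over all of them, one variable after the other, leaves a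
function of \<open>k\<close> alone.
\<close>

theorem Ehrhart_quasi_polynomial:
  assumes D: "definable n D" "D \<subseteq> cube n R"
  shows "\<exists>q>0. \<forall>m. \<exists>p. \<forall>j. real (card (D \<inter> grid n (1 + q * m * j))) = poly p (real j)"
proof -
  obtain f where f: "f \<in> conic_qp (Suc n)" "\<And>x. x 0 \<ge> 1 \<Longrightarrow> f x = of_bool (scaled_point n x \<in> D)"
    using D(1) unfolding definable_def by blast
  obtain S where S: "S \<in> conic_qp 1" "\<And>x. x 0 \<ge> 0 \<Longrightarrow> S x =
    (\<Sum>y\<in>{1..n} \<rightarrow>\<^sub>E {- (int R * x 0)..int R * x 0}. f (\<lambda>i. if i \<in> {1..n} then y i else x i))"
    using conic_qp_sum_all[OF f(1)] by blast
  have count: "S (\<lambda>_. int k) = card (D \<inter> grid n k)" if k: "k \<ge> 1" for k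
  proof -
    define J where "J = {- (int R * int k)..int R * int k}"
    define X where "X y = (\<lambda>i. if i \<in> {1..n} then y i else int k)" for y :: "nat \<Rightarrow> int"
    have "S (\<lambda>_. int k) = (\<Sum>y\<in>{1..n} \<rightarrow>\<^sub>E J. f (X y))"
      by (subst S(2)) (simp_all add: J_def X_def)
    also have "\<dots> = (\<Sum>y\<in>{1..n} \<rightarrow>\<^sub>E J. of_bool (scaled_point n (X y) \<in> D))"
      using k by (intro sum.cong refl f(2)) (simp add: X_def)
    also have "\<dots> = real (card {y \<in> {1..n} \<rightarrow>\<^sub>E J. scaled_point n (X y) \<in> D})"
      by (subst sum_of_bool_eq) (auto intro!: finite_PiE simp: J_def Int_def)
    also have "card {y \<in> {1..n} \<rightarrow>\<^sub>E J. scaled_point n (X y) \<in> D} = card (D \<inter> grid n k)"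
    proof (rule bij_betw_same_card, rule bij_betw_byWitness[where f = "\<lambda>y. scaled_point n (X y)"
          and f' = "\<lambda>z. \<lambda>i\<in>{1..n}. \<lfloor>real k * z (i - 1)\<rfloor>"])
      let ?g = "\<lambda>z. \<lambda>i\<in>{1..n}. \<lfloor>real k * z (i - 1)\<rfloor>"
      show "\<forall>y\<in>{y \<in> {1..n} \<rightarrow>\<^sub>E J. scaled_point n (X y) \<in> D}. ?g (scaled_point n (X y)) = y"
      proof (clarify, rule ext)
        fix y i assume "y \<in> {1..n} \<rightarrow>\<^sub>E J"
        then show "?g (scaled_point n (X y)) i = y i"
          using k by (auto simp: scaled_point_def X_def PiE_iff extensional_def)
      qed
      have inv: "scaled_point n (X (?g z)) = z" if "z \<in> D \<inter> grid n k" for z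
      proof
        fix i
        show "scaled_point n (X (?g z)) i = z i"
        proof (cases "i < n")
          case True
          then have "real k * z i \<in> \<int>" using that by (auto simp: grid_def)
          then have fl: "real_of_int \<lfloor>real k * z i\<rfloor> = real k * z i" by (metis Ints_cases floor_of_int)
          have "scaled_point n (X (?g z)) i = real_of_int \<lfloor>real k * z i\<rfloor> / real k"
            using True by (simp add: scaled_point_def X_def)
          also have "\<dots> = z i" unfolding fl using k by simp
          finally show ?thesis .
        next
          case False
          then show ?thesis using that by (simp add: scaled_point_def grid_def PiE_iff extensional_def)
        qed
      qed
      then show "\<forall>z\<in>D \<inter> grid n k. scaled_point n (X (?g z)) = z" by blast
      show "(\<lambda>y. scaled_point n (X y)) ` {y \<in> {1..n} \<rightarrow>\<^sub>E J. scaled_point n (X y) \<in> D} \<subseteq> D \<inter> grid n k"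
      proof (rule image_subsetI)
        fix y assume "y \<in> {y \<in> {1..n} \<rightarrow>\<^sub>E J. scaled_point n (X y) \<in> D}"
        moreover have "scaled_point n (X y) \<in> grid n k"
          unfolding grid_def scaled_point_def
          by (rule restrict_PiE_iff[THEN iffD2]) (use k in \<open>simp add: X_def\<close>)
        ultimately show "scaled_point n (X y) \<in> D \<inter> grid n k" by blast
      qed
      show "?g ` (D \<inter> grid n k) \<subseteq> {y \<in> {1..n} \<rightarrow>\<^sub>E J. scaled_point n (X y) \<in> D}"
      proof (rule image_subsetI, rule CollectI, rule conjI[rotated])
        fix z assume z: "z \<in> D \<inter> grid n k"
        then show "scaled_point n (X (?g z)) \<in> D" using inv by simp
        show "?g z \<in> {1..n} \<rightarrow>\<^sub>E J"
        proof (rule restrict_PiE_iff[THEN iffD2], intro ballI)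
          fix i assume "i \<in> {1..n}"
          then have "i - 1 < n" by auto
          moreover have "z \<in> cube n R" using z D(2) by blast
          ultimately have zi: "- real R \<le> z (i - 1)" "z (i - 1) \<le> real R"
            by (auto simp: cbox_Rn_def PiE_iff)
          have "real k * z (i - 1) \<le> real k * real R" "real k * (- real R) \<le> real k * z (i - 1)"
            using zi by (intro mult_left_mono; simp)+
          then have "real k * z (i - 1) \<le> real_of_int (int R * int k)"
             "real_of_int (- (int R * int k)) \<le> real k * z (i - 1)"
            by (simp_all add: mult.commute)
          then show "\<lfloor>real k * z (i - 1)\<rfloor> \<in> J"
            unfolding J_def atLeastAtMost_iff le_floor_iff by (metis floor_mono floor_of_int)
        qed
      qed
    qed
    finally show ?thesis .
  qed
  obtain q where q: "q > 0" "\<And>m. \<exists>p. \<forall>j. S (\<lambda>_. 1 + int (q * m) * int j) = poly p (real j)"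
    using conic_qp_arith_progression[OF S(1)] unfolding poly_on_progressions_def by blast
  have "real (card (D \<inter> grid n (1 + q * m * j))) = S (\<lambda>_. 1 + int (q * m) * int j)" for m j
    using count[of "1 + q * m * j"] by (simp add: mult.assoc)
  then show ?thesis using q by (intro exI[of _ q]) simp
qed

section \<open>Boxes in the topology of \<open>\<real>\<^sup>n\<close>\<close>

lemma topspace_Rn: "topspace (Rn n) = space_Rn n"
  by (simp add: Rn_def)

lemma openin_obox: "openin (Rn n) (obox n a b)"
  unfolding Rn_def obox_def by (subst openin_PiE) auto

lemma compactin_cbox: "compactin (Rn n) (cbox_Rn n a b)"
  unfolding Rn_def cbox_Rn_def by (subst compactin_PiE) auto

lemma obox_subset_cbox: "obox n a b \<subseteq> cbox_Rn n a b"
  unfolding obox_def cbox_Rn_def by (intro PiE_mono) auto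

lemma obox_nbhd:
  assumes "openin (Rn n) W" "y \<in> W"
  obtains a b where "a \<in> rational_points n" "b \<in> rational_points n" "y \<in> obox n a b" "cbox_Rn n a b \<subseteq> W"
proof -
  obtain U where U: "\<And>i. i < n \<Longrightarrow> open (U i)" "y \<in> (\<Pi>\<^sub>E i\<in>{..<n}. U i)" "(\<Pi>\<^sub>E i\<in>{..<n}. U i) \<subseteq> W"
  proof -
    obtain U where "\<forall>i\<in>{..<n}. openin euclideanreal (U i)" "y \<in> Pi\<^sub>E {..<n} U" "Pi\<^sub>E {..<n} U \<subseteq> W"
      using assms unfolding Rn_def openin_product_topology_alt by blast
    then show thesis by (intro that[of U]) auto
  qed
  have "\<exists>p q. p \<in> \<rat> \<and> q \<in> \<rat> \<and> p < y i \<and> y i < q \<and> {p..q} \<subseteq> U i" if i: "i < n" for i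
  proof -
    have "y i \<in> U i" using U(2) i by auto
    then obtain e where e: "e > 0" "ball (y i) e \<subseteq> U i" using U(1)[OF i] openE by blast
    obtain p where p: "p \<in> \<rat>" "y i - e < p" "p < y i" using Rats_dense_in_real[of "y i - e" "y i"] e by auto
    obtain q where q: "q \<in> \<rat>" "y i < q" "q < y i + e" using Rats_dense_in_real[of "y i" "y i + e"] e by auto
    have "{p..q} \<subseteq> ball (y i) e" using p q by (auto simp: dist_real_def)
    with e p q show ?thesis by blast
  qed
  then obtain a b where ab: "\<And>i. i < n \<Longrightarrow> a i \<in> \<rat> \<and> b i \<in> \<rat> \<and> a i < y i \<and> y i < b i \<and> {a i..b i} \<subseteq> U i"
    by metis
  show thesis
  proof (rule that[of "restrict a {..<n}" "restrict b {..<n}"])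
    have "cbox_Rn n (restrict a {..<n}) (restrict b {..<n}) \<subseteq> (\<Pi>\<^sub>E i\<in>{..<n}. U i)"
      unfolding cbox_Rn_def by (rule PiE_mono) (use ab in auto)
    with U(3) show "cbox_Rn n (restrict a {..<n}) (restrict b {..<n}) \<subseteq> W" by blast
    show "y \<in> obox n (restrict a {..<n}) (restrict b {..<n})"
      using ab U(2) by (auto simp: obox_def PiE_iff)
  qed (use ab in auto)
qed

lemma countable_rational_points: "countable (rational_points n)"
  by (intro countable_PiE) (auto simp: countable_rat)

lemma open_Un_obox:
  assumes "openin (Rn n) W"
  shows "W = (\<Union>(a, b)\<in>{(a, b) \<in> rational_points n \<times> rational_points n. obox n a b \<subseteq> W}. obox n a b)"
proof (intro equalityI subsetI)
  fix y assume "y \<in> W"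
  with assms obtain a b where "a \<in> rational_points n" "b \<in> rational_points n"
    "y \<in> obox n a b" "cbox_Rn n a b \<subseteq> W" by (rule obox_nbhd)
  moreover from this have "obox n a b \<subseteq> W" using obox_subset_cbox by blast
  ultimately show "y \<in> (\<Union>(a, b)\<in>{(a, b) \<in> rational_points n \<times> rational_points n. obox n a b \<subseteq> W}. obox n a b)"
    by blast
qed auto

section \<open>Lebesgue measure and lattices\<close>

lemma space_lebesgue_Rn [simp]: "space (lebesgue_Rn n) = space_Rn n"
  by (simp add: lebesgue_Rn_def space_PiM)

interpretation lborel_product: product_sigma_finite "\<lambda>_::nat. lborel :: real measure"
  by standard

lemma sigma_finite_lebesgue_Rn: "sigma_finite_measure (lebesgue_Rn n)"
  unfolding lebesgue_Rn_def by (rule lborel_product.sigma_finite) simp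

lemma measurable_coord [measurable]: "i < n \<Longrightarrow> (\<lambda>x. x i) \<in> borel_measurable (lebesgue_Rn n)"
  unfolding lebesgue_Rn_def by (rule measurable_compose[OF measurable_component_singleton]) auto

lemma measurable_into_Rn:
  assumes "\<And>i. i < n \<Longrightarrow> f i \<in> borel_measurable N"
  shows "(\<lambda>x. \<lambda>i\<in>{..<n}. f i x) \<in> measurable N (lebesgue_Rn n)"
  unfolding lebesgue_Rn_def by (rule measurable_restrict) (use assms in auto)

lemma measurable_into_Rn':
  assumes "\<And>i. i < n \<Longrightarrow> (\<lambda>x. f x i) \<in> borel_measurable N"
    "\<And>x. x \<in> space N \<Longrightarrow> f x \<in> space_Rn n"
  shows "f \<in> measurable N (lebesgue_Rn n)"
proof -
  have "(\<lambda>x. \<lambda>i\<in>{..<n}. f x i) \<in> measurable N (lebesgue_Rn n)"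
    by (rule measurable_into_Rn) (rule assms)
  moreover have "f x = (\<lambda>i\<in>{..<n}. f x i)" if "x \<in> space N" for x
    using assms(2)[OF that] by (auto simp: PiE_iff extensional_def restrict_def)
  ultimately show ?thesis by (simp cong: measurable_cong)
qed

lemma sets_PiE_Rn: "(\<And>i. i < n \<Longrightarrow> A i \<in> sets borel) \<Longrightarrow> Pi\<^sub>E {..<n} A \<in> sets (lebesgue_Rn n)"
  unfolding lebesgue_Rn_def by (rule sets_PiM_I_finite) auto

lemma emeasure_PiE_Rn:
  "(\<And>i. i < n \<Longrightarrow> A i \<in> sets borel) \<Longrightarrow> emeasure (lebesgue_Rn n) (Pi\<^sub>E {..<n} A) = (\<Prod>i<n. emeasure lborel (A i))"
  unfolding lebesgue_Rn_def by (rule lborel_product.emeasure_PiM) auto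

lemma sets_obox: "obox n a b \<in> sets (lebesgue_Rn n)"
  unfolding obox_def by (rule sets_PiE_Rn) auto

lemma sets_openin_Rn:
  assumes "openin (Rn n) W"
  shows "W \<in> sets (lebesgue_Rn n)"
proof -
  have "countable {(a, b) \<in> rational_points n \<times> rational_points n. obox n a b \<subseteq> W}"
    by (rule countable_subset[of _ "rational_points n \<times> rational_points n"])
      (auto intro: countable_rational_points)
  then show ?thesis
    by (subst open_Un_obox[OF assms]) (auto intro!: sets.countable_UN' sets_obox simp: case_prod_unfold)
qed

definition vadd :: "nat \<Rightarrow> (nat \<Rightarrow> real) \<Rightarrow> (nat \<Rightarrow> real) \<Rightarrow> nat \<Rightarrow> real" where
  "vadd n x y = (\<lambda>i\<in>{..<n}. x i + y i)"

definition vneg :: "nat \<Rightarrow> (nat \<Rightarrow> real) \<Rightarrow> nat \<Rightarrow> real" where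
  "vneg n x = (\<lambda>i\<in>{..<n}. - x i)"

definition lattice_cell :: "nat \<Rightarrow> nat \<Rightarrow> (nat \<Rightarrow> real) set" where
  "lattice_cell n k = {..<n} \<rightarrow>\<^sub>E {0..<1 / real k}"

lemma vadd_E [simp]: "vadd n x y \<in> space_Rn n" and vneg_E [simp]: "vneg n x \<in> space_Rn n"
  by (simp_all add: vadd_def vneg_def)

lemma vadd_vneg_cancel [simp]:
  assumes "x \<in> space_Rn n"
  shows "vadd n (vneg n v) (vadd n v x) = x" "vadd n v (vadd n (vneg n v) x) = x"
  using assms by (auto simp: vadd_def vneg_def restrict_def PiE_iff extensional_def fun_eq_iff)

lemma vadd_commute: "vadd n x y = vadd n y x"
  by (simp add: vadd_def add.commute)

lemma measurable_vadd: "(\<lambda>p. vadd n (fst p) (snd p)) \<in> measurable (lebesgue_Rn n \<Otimes>\<^sub>M lebesgue_Rn n) (lebesgue_Rn n)"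
  unfolding vadd_def by (rule measurable_into_Rn) measurable

lemma measurable_vadd_left [measurable]: "vadd n v \<in> measurable (lebesgue_Rn n) (lebesgue_Rn n)"
  unfolding vadd_def by (rule measurable_into_Rn) measurable

lemma distr_translate: "distr (lebesgue_Rn n) (lebesgue_Rn n) (vadd n v) = lebesgue_Rn n"
proof -
  have "distr (lebesgue_Rn n) (lebesgue_Rn n) (vadd n v) = PiM {..<n} (\<lambda>_. lborel)"
  proof (rule lborel_product.PiM_eqI)
    fix A :: "nat \<Rightarrow> real set" assume A: "\<And>i. i \<in> {..<n} \<Longrightarrow> A i \<in> sets lborel"
    have A': "(+) (v i) -` A i \<in> sets borel" if "i < n" for i
      using measurable_sets[of "(+) (v i)" borel borel "A i"] A[of i] that by auto
    have "vadd n v -` Pi\<^sub>E {..<n} A \<inter> space (lebesgue_Rn n) = (\<Pi>\<^sub>E i\<in>{..<n}. (+) (v i) -` A i)"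
      by (auto simp: vadd_def PiE_iff)
    then have "emeasure (distr (lebesgue_Rn n) (lebesgue_Rn n) (vadd n v)) (Pi\<^sub>E {..<n} A) =
        (\<Prod>i<n. emeasure lborel ((+) (v i) -` A i))"
      using A A' by (subst emeasure_distr) (auto intro!: sets_PiE_Rn simp: emeasure_PiE_Rn)
    also have "\<dots> = (\<Prod>i<n. emeasure lborel (A i))"
    proof (intro prod.cong refl)
      fix i assume "i \<in> {..<n}"
      then have "emeasure (distr lborel borel ((+) (v i))) (A i) = emeasure lborel ((+) (v i) -` A i)"
        using A by (subst emeasure_distr) auto
      then show "emeasure lborel ((+) (v i) -` A i) = emeasure lborel (A i)" by (simp add: lborel_distr_plus)
    qed
    finally show "emeasure (distr (lebesgue_Rn n) (lebesgue_Rn n) (vadd n v)) (Pi\<^sub>E {..<n} A) = \<dots>" .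
  qed (auto simp: lebesgue_Rn_def)
  then show ?thesis by (simp add: lebesgue_Rn_def)
qed

lemma nn_integral_translate:
  assumes "f \<in> borel_measurable (lebesgue_Rn n)"
  shows "(\<integral>\<^sup>+x. f (vadd n v x) \<partial>lebesgue_Rn n) = (\<integral>\<^sup>+x. f x \<partial>lebesgue_Rn n)"
proof -
  have "(\<integral>\<^sup>+x. f x \<partial>distr (lebesgue_Rn n) (lebesgue_Rn n) (vadd n v)) = (\<integral>\<^sup>+x. f (vadd n v x) \<partial>lebesgue_Rn n)"
    using assms by (intro nn_integral_distr) auto
  then show ?thesis by (simp add: distr_translate)
qed

lemma sets_lattice_cell [measurable]: "lattice_cell n k \<in> sets (lebesgue_Rn n)"
  unfolding lattice_cell_def by (rule sets_PiE_Rn) auto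

lemma emeasure_lattice_cell: "k > 0 \<Longrightarrow> emeasure (lebesgue_Rn n) (lattice_cell n k) = ennreal (1 / real k ^ n)"
  unfolding lattice_cell_def
  by (subst emeasure_PiE_Rn) (auto simp: power_one_over ennreal_power)

text \<open>
The half-open cell is a fundamental domain of the lattice.
\<close>

lemma grid_cell:
  assumes k: "k > 0" and x: "x \<in> space_Rn n"
  shows "{y \<in> grid n k. vadd n (vneg n y) x \<in> lattice_cell n k} = {\<lambda>i\<in>{..<n}. \<lfloor>real k * x i\<rfloor> / real k}"
proof (intro equalityI subsetI)
  fix y assume y: "y \<in> {y \<in> grid n k. vadd n (vneg n y) x \<in> lattice_cell n k}"
  have "y i = \<lfloor>real k * x i\<rfloor> / real k" if i: "i < n" for i
  proof -
    have "real k * y i \<in> \<int>" using y i by (auto simp: grid_def PiE_iff)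
    then obtain m where m: "real k * y i = of_int m" by (auto elim: Ints_cases)
    have "vadd n (vneg n y) x i \<in> {0..<1 / real k}" using y i by (auto simp: lattice_cell_def PiE_iff)
    then have "x i - y i \<ge> 0" "x i - y i < 1 / real k" using i by (auto simp: vadd_def vneg_def)
    then have "real k * (x i - y i) \<ge> 0" "real k * (x i - y i) < real k * (1 / real k)"
      using k mult_strict_left_mono[of "x i - y i" "1 / real k" "real k"] by simp_all
    then have "real k * x i \<ge> of_int m" "real k * x i < of_int m + 1"
      using k m by (simp_all add: right_diff_distrib)
    then have "\<lfloor>real k * x i\<rfloor> = m" by (simp add: floor_eq_iff)
    then show ?thesis using m k by (simp add: field_simps)
  qed
  then show "y \<in> {\<lambda>i\<in>{..<n}. \<lfloor>real k * x i\<rfloor> / real k}"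
    using y by (auto simp: grid_def PiE_iff extensional_def restrict_def fun_eq_iff)
next
  fix y assume "y \<in> {\<lambda>i\<in>{..<n}. \<lfloor>real k * x i\<rfloor> / real k}"
  then have y: "y = (\<lambda>i\<in>{..<n}. \<lfloor>real k * x i\<rfloor> / real k)" by simp
  have "y \<in> grid n k" unfolding y grid_def by (rule restrict_PiE_iff[THEN iffD2]) (use k in simp)
  moreover have "vadd n (vneg n y) x \<in> lattice_cell n k"
    unfolding vadd_def lattice_cell_def
  proof (rule restrict_PiE_iff[THEN iffD2], intro ballI)
    fix i assume "i \<in> {..<n}"
    moreover have "real_of_int \<lfloor>real k * x i\<rfloor> \<le> real k * x i" "real k * x i < real_of_int \<lfloor>real k * x i\<rfloor> + 1"
      by linarith+
    moreover have "x i - \<lfloor>real k * x i\<rfloor> / real k = (real k * x i - \<lfloor>real k * x i\<rfloor>) / real k"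
      using k by (simp add: field_simps)
    ultimately show "vneg n y i + x i \<in> {0..<1 / real k}"
      using k by (simp add: y vneg_def divide_less_cancel less_diff_eq diff_less_eq add.commute)
  qed
  ultimately show "y \<in> {y \<in> grid n k. vadd n (vneg n y) x \<in> lattice_cell n k}" by simp
qed

lemma grid_rational: "k > 0 \<Longrightarrow> grid n k \<subseteq> rational_points n"
  unfolding grid_def
proof (intro PiE_mono subsetI)
  fix r assume k: "k > 0" and "r \<in> {r. real k * r \<in> \<int>}"
  then obtain m where "real k * r = of_int m" by (auto elim: Ints_cases)
  then have "r = of_int m / of_nat k" using k by (simp add: field_simps)
  then show "r \<in> \<rat>" by simp
qed

lemma countable_grid: "k > 0 \<Longrightarrow> countable (grid n k)"
  by (rule countable_subset[OF grid_rational countable_rational_points])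

lemma nn_integral_count_space_singleton:
  assumes "{y \<in> Y. P y} = {y0}"
  shows "(\<integral>\<^sup>+y. c * of_bool (P y) \<partial>count_space Y) = (c::ennreal)"
proof -
  have "(\<integral>\<^sup>+y. c * of_bool (P y) \<partial>count_space Y) = (\<Sum>y\<in>{y0}. c * of_bool (P y))"
    using assms by (intro nn_integral_count_space') (auto simp: of_bool_def)
  moreover have "P y0" using assms by blast
  ultimately show ?thesis by simp
qed

text \<open>
The lattice translates of the cell tile \<open>\<real>\<^sup>n\<close>; each of them is translated back to the cell.
\<close>

lemma nn_integral_tiling:
  assumes f [measurable]: "f \<in> borel_measurable (lebesgue_Rn n)" and k: "k > 0"
  shows "(\<integral>\<^sup>+x. f x \<partial>lebesgue_Rn n) =
    (\<integral>\<^sup>+t. (\<integral>\<^sup>+y. f (vadd n y t) \<partial>count_space (grid n k)) * indicator (lattice_cell n k) t \<partial>lebesgue_Rn n)"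
proof -
  let ?F = "\<lambda>y x. f x * indicator (lattice_cell n k) (vadd n (vneg n y) x)"
  have "(\<integral>\<^sup>+x. f x \<partial>lebesgue_Rn n) = (\<integral>\<^sup>+x. \<integral>\<^sup>+y. ?F y x \<partial>count_space (grid n k) \<partial>lebesgue_Rn n)"
    by (intro nn_integral_cong)
      (simp add: indicator_def nn_integral_count_space_singleton[OF grid_cell[OF k]])
  also have "\<dots> = (\<integral>\<^sup>+y. \<integral>\<^sup>+x. ?F y x \<partial>lebesgue_Rn n \<partial>count_space (grid n k))"
    by (rule nn_integral_count_space_nn_integral) (use countable_grid[OF k] in auto)
  also have "\<dots> = (\<integral>\<^sup>+y. \<integral>\<^sup>+t. f (vadd n y t) * indicator (lattice_cell n k) t \<partial>lebesgue_Rn n \<partial>count_space (grid n k))"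
  proof (rule nn_integral_cong)
    fix y
    have "(\<integral>\<^sup>+x. ?F y x \<partial>lebesgue_Rn n) = (\<integral>\<^sup>+t. ?F y (vadd n y t) \<partial>lebesgue_Rn n)"
      by (rule nn_integral_translate[symmetric]) measurable
    also have "\<dots> = (\<integral>\<^sup>+t. f (vadd n y t) * indicator (lattice_cell n k) t \<partial>lebesgue_Rn n)"
      by (intro nn_integral_cong) simp
    finally show "(\<integral>\<^sup>+x. ?F y x \<partial>lebesgue_Rn n) = \<dots>" .
  qed
  also have "\<dots> = (\<integral>\<^sup>+t. \<integral>\<^sup>+y. f (vadd n y t) * indicator (lattice_cell n k) t \<partial>count_space (grid n k) \<partial>lebesgue_Rn n)"
    by (rule nn_integral_count_space_nn_integral[symmetric]) (use countable_grid[OF k] in auto)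
  also have "\<dots> = (\<integral>\<^sup>+t. (\<integral>\<^sup>+y. f (vadd n y t) \<partial>count_space (grid n k)) * indicator (lattice_cell n k) t \<partial>lebesgue_Rn n)"
    by (simp add: nn_integral_multc)
  finally show ?thesis .
qed

text \<open>
Let \<open>D\<close> be the unit cell and integrate \<open>1\<^sub>B(x) 1\<^sub>D(x + y)\<close> with respect to \<open>d\<nu>(x) dy\<close>. Integrating over \<open>y\<close>
first gives \<open>\<nu>(B)\<close>. In the other order, replace \<open>x\<close> by \<open>x - y\<close>: the integral over \<open>y\<close> then yields the
Lebesgue measure of \<open>- B\<close>, and the remaining integral over \<open>x\<close> is \<open>\<nu>(D) = 1\<close>. So \<open>\<nu>(B)\<close> is the
Lebesgue measure of \<open>- B\<close>. Since \<open>\<nu>\<close> may be Lebesgue measure itself, all such measures agree.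
\<close>

lemma translation_invariant_unique:
  assumes sets [measurable_cong]: "sets \<nu> = sets (lebesgue_Rn n)"
    and inv: "\<And>f v. f \<in> borel_measurable (lebesgue_Rn n) \<Longrightarrow> v \<in> space_Rn n \<Longrightarrow>
       (\<integral>\<^sup>+x. f (vadd n v x) \<partial>\<nu>) = (\<integral>\<^sup>+x. f x \<partial>\<nu>)"
    and unit: "emeasure \<nu> (lattice_cell n 1) = 1"
  shows "\<nu> = lebesgue_Rn n"
proof -
  have sp: "space \<nu> = space_Rn n" using sets_eq_imp_space_eq[OF sets] by simp
  have "sigma_finite_measure \<nu>"
  proof
    define T where "T y = vadd n (vneg n y) -` lattice_cell n 1 \<inter> space (lebesgue_Rn n)" for y
    have T: "T y \<in> sets \<nu>" for y unfolding T_def sets by measurable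
    have "emeasure \<nu> (T y) = 1" for y
    proof -
      have "emeasure \<nu> (T y) = (\<integral>\<^sup>+x. indicator (lattice_cell n 1) (vadd n (vneg n y) x) \<partial>\<nu>)"
        by (subst nn_integral_indicator[OF T, symmetric], intro nn_integral_cong)
          (auto simp: T_def indicator_def sp)
      also have "\<dots> = (\<integral>\<^sup>+x. indicator (lattice_cell n 1) x \<partial>\<nu>)"
        by (rule inv) auto
      also have "\<dots> = 1" using unit by (simp add: sets)
      finally show ?thesis .
    qed
    moreover have "\<Union>(T ` grid n 1) = space \<nu>"
      using grid_cell[of 1 _ n] unfolding sp T_def by auto
    ultimately show "\<exists>A. countable A \<and> A \<subseteq> sets \<nu> \<and> \<Union>A = space \<nu> \<and> (\<forall>a\<in>A. emeasure \<nu> a \<noteq> \<infinity>)"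
      using T countable_grid[of 1 n] by (intro exI[of _ "T ` grid n 1"]) auto
  qed
  then interpret nu: sigma_finite_measure \<nu> .
  interpret lam: sigma_finite_measure "lebesgue_Rn n" by (rule sigma_finite_lebesgue_Rn)
  \<comment> \<open>The computation is made for both measures at once.\<close>
  have main: "emeasure \<mu> B = (\<integral>\<^sup>+y. indicator B (vneg n y) \<partial>lebesgue_Rn n)"
    if B [measurable]: "B \<in> sets (lebesgue_Rn n)" and \<mu>: "\<mu> = \<nu> \<or> \<mu> = lebesgue_Rn n" for B \<mu>
  proof -
    have sets\<mu> [measurable_cong]: "sets \<mu> = sets (lebesgue_Rn n)" using \<mu> sets by auto
    have sp\<mu>: "space \<mu> = space_Rn n" using sets_eq_imp_space_eq[OF sets\<mu>] by simp
    have inv\<mu>: "(\<integral>\<^sup>+x. f (vadd n v x) \<partial>\<mu>) = (\<integral>\<^sup>+x. f x \<partial>\<mu>)" if "f \<in> borel_measurable (lebesgue_Rn n)" "v \<in> space_Rn n" for f v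
      using \<mu> inv[OF that] nn_integral_translate[OF that(1)] by auto
    have unit\<mu>: "emeasure \<mu> (lattice_cell n 1) = 1" using \<mu> unit emeasure_lattice_cell[of 1 n] by auto
    interpret mu: sigma_finite_measure \<mu> using \<mu> nu.sigma_finite_measure_axioms lam.sigma_finite_measure_axioms by auto
    interpret pair_sigma_finite \<mu> "lebesgue_Rn n" ..
    note measurable_vadd[measurable]
    have vadd2: "(\<lambda>p. vadd n (fst p) (snd p)) \<in> measurable (\<mu> \<Otimes>\<^sub>M lebesgue_Rn n) (lebesgue_Rn n)"
      using measurable_vadd by (simp cong: measurable_cong_sets add: sets_pair_measure_cong[OF sets\<mu> refl])
    let ?D = "lattice_cell n 1"
    have "emeasure \<mu> B = (\<integral>\<^sup>+x. indicator B x \<partial>\<mu>)" using B by (simp add: sets\<mu>)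
    also have "\<dots> = (\<integral>\<^sup>+x. (\<integral>\<^sup>+y. indicator B x * indicator ?D (vadd n x y) \<partial>lebesgue_Rn n) \<partial>\<mu>)"
    proof (rule nn_integral_cong)
      fix x assume "x \<in> space \<mu>"
      have "(\<integral>\<^sup>+y. indicator B x * indicator ?D (vadd n x y) \<partial>lebesgue_Rn n) =
         indicator B x * (\<integral>\<^sup>+y. indicator ?D (vadd n x y) \<partial>lebesgue_Rn n)"
        by (rule nn_integral_cmult) measurable
      also have "(\<integral>\<^sup>+y. indicator ?D (vadd n x y) \<partial>lebesgue_Rn n) = (\<integral>\<^sup>+y. indicator ?D y \<partial>lebesgue_Rn n)"
        by (rule nn_integral_translate) measurable
      also have "\<dots> = 1" using emeasure_lattice_cell[of 1 n] by simp
      finally show "indicator B x = (\<integral>\<^sup>+y. indicator B x * indicator ?D (vadd n x y) \<partial>lebesgue_Rn n)" by simp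
    qed
    also have "\<dots> = (\<integral>\<^sup>+y. (\<integral>\<^sup>+x. indicator B x * indicator ?D (vadd n x y) \<partial>\<mu>) \<partial>lebesgue_Rn n)"
    proof (rule Fubini'[symmetric])
      have "(\<lambda>p. indicator B (fst p) * indicator ?D (vadd n (fst p) (snd p)) :: ennreal) \<in> borel_measurable (\<mu> \<Otimes>\<^sub>M lebesgue_Rn n)"
        using vadd2 by measurable
      then show "(\<lambda>(x, y). indicator B x * indicator ?D (vadd n x y) :: ennreal) \<in> borel_measurable (\<mu> \<Otimes>\<^sub>M lebesgue_Rn n)"
        by (simp add: case_prod_unfold)
    qed
    also have "\<dots> = (\<integral>\<^sup>+y. (\<integral>\<^sup>+x. indicator B (vadd n (vneg n y) x) * indicator ?D x \<partial>\<mu>) \<partial>lebesgue_Rn n)"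
    proof (rule nn_integral_cong)
      fix y assume y: "y \<in> space (lebesgue_Rn n)"
      have [measurable]: "(\<lambda>x. vadd n x y) \<in> measurable (lebesgue_Rn n) (lebesgue_Rn n)"
        using measurable_vadd_left[of n y] unfolding vadd_commute[of n y] .
      have "(\<integral>\<^sup>+x. indicator B x * indicator ?D (vadd n x y) \<partial>\<mu>) =
        (\<integral>\<^sup>+x. indicator B (vadd n (vneg n y) x) * indicator ?D (vadd n (vadd n (vneg n y) x) y) \<partial>\<mu>)"
        by (rule inv\<mu>[symmetric]) auto
      also have "\<dots> = (\<integral>\<^sup>+x. indicator B (vadd n (vneg n y) x) * indicator ?D x \<partial>\<mu>)"
      proof (rule nn_integral_cong)
        fix x assume "x \<in> space \<mu>"
        then have "vadd n (vadd n (vneg n y) x) y = x"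
          using sp\<mu> by (simp add: vadd_commute[of n _ y])
        then show "indicator B (vadd n (vneg n y) x) * indicator ?D (vadd n (vadd n (vneg n y) x) y) =
           (indicator B (vadd n (vneg n y) x) * indicator ?D x :: ennreal)" by simp
      qed
      finally show "(\<integral>\<^sup>+x. indicator B x * indicator ?D (vadd n x y) \<partial>\<mu>) = \<dots>" .
    qed
    also have "\<dots> = (\<integral>\<^sup>+x. (\<integral>\<^sup>+y. indicator B (vadd n (vneg n y) x) * indicator ?D x \<partial>lebesgue_Rn n) \<partial>\<mu>)"
    proof (rule Fubini')
      have [measurable]: "(\<lambda>p. vadd n (vneg n (snd p)) (fst p)) \<in> measurable (\<mu> \<Otimes>\<^sub>M lebesgue_Rn n) (lebesgue_Rn n)"
        unfolding vadd_def vneg_def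
      proof (rule measurable_into_Rn)
        fix i assume i: "i < n"
        then have [measurable]: "(\<lambda>x. x i) \<in> borel_measurable \<mu>" 
          using measurable_coord by (simp cong: measurable_cong_sets add: sets\<mu>)
        show "(\<lambda>x. (\<lambda>i\<in>{..<n}. - snd x i) i + fst x i) \<in> borel_measurable (\<mu> \<Otimes>\<^sub>M lebesgue_Rn n)"
          using i by simp measurable
      qed
      have "(\<lambda>p. indicator B (vadd n (vneg n (snd p)) (fst p)) * indicator ?D (fst p) :: ennreal) \<in> borel_measurable (\<mu> \<Otimes>\<^sub>M lebesgue_Rn n)"
        by measurable
      then show "(\<lambda>(x, y). indicator B (vadd n (vneg n y) x) * indicator ?D x :: ennreal) \<in> borel_measurable (\<mu> \<Otimes>\<^sub>M lebesgue_Rn n)"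
        by (simp add: case_prod_unfold)
    qed
    also have "\<dots> = (\<integral>\<^sup>+x. (\<integral>\<^sup>+y. indicator B (vneg n y) \<partial>lebesgue_Rn n) * indicator ?D x \<partial>\<mu>)"
    proof (rule nn_integral_cong)
      fix x assume x: "x \<in> space \<mu>"
      have [measurable]: "vneg n \<in> measurable (lebesgue_Rn n) (lebesgue_Rn n)"
        unfolding vneg_def by (rule measurable_into_Rn) measurable
      have [measurable]: "(\<lambda>y. vadd n (vneg n y) x) \<in> measurable (lebesgue_Rn n) (lebesgue_Rn n)"
        using measurable_compose[OF \<open>vneg n \<in> _\<close> measurable_vadd_left[of n x]] unfolding vadd_commute[of n x] .
      have "(\<integral>\<^sup>+y. indicator B (vadd n (vneg n y) x) * indicator ?D x \<partial>lebesgue_Rn n) =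
         (\<integral>\<^sup>+y. indicator B (vadd n (vneg n y) x) \<partial>lebesgue_Rn n) * indicator ?D x"
        by (rule nn_integral_multc) measurable
      also have "(\<integral>\<^sup>+y. indicator B (vadd n (vneg n y) x) \<partial>lebesgue_Rn n) =
         (\<integral>\<^sup>+y. indicator B (vadd n (vneg n (vadd n x y)) x) \<partial>lebesgue_Rn n)"
        by (rule nn_integral_translate[symmetric]) measurable
      also have "\<dots> = (\<integral>\<^sup>+y. indicator B (vneg n y) \<partial>lebesgue_Rn n)"
      proof -
        have "vadd n (vneg n (vadd n x y)) x = vneg n y" for y
          by (rule ext) (simp add: vadd_def vneg_def restrict_def)
        then show ?thesis by simp
      qed
      finally show "(\<integral>\<^sup>+y. indicator B (vadd n (vneg n y) x) * indicator ?D x \<partial>lebesgue_Rn n) =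
         (\<integral>\<^sup>+y. indicator B (vneg n y) \<partial>lebesgue_Rn n) * indicator ?D x" .
    qed
    also have "\<dots> = (\<integral>\<^sup>+y. indicator B (vneg n y) \<partial>lebesgue_Rn n) * emeasure \<mu> ?D"
      by (subst nn_integral_cmult) (auto simp: sets\<mu>)
    finally show ?thesis unfolding unit\<mu> by simp
  qed
  show ?thesis
  proof (rule measure_eqI[OF sets])
    fix B assume "B \<in> sets \<nu>"
    then have B: "B \<in> sets (lebesgue_Rn n)" by (simp add: sets)
    show "emeasure \<nu> B = emeasure (lebesgue_Rn n) B" using main[OF B] by metis
  qed
qed

section \<open>Invariance of Lebesgue measure under integral affine maps\<close>

lemma matrix_inverse_apply:
  fixes v :: "nat \<Rightarrow> real"
  assumes "\<forall>i<n. \<forall>j<n. (\<Sum>k<n. A i k * B k j) = (if i = j then 1 else (0::int))" "i < n"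
  shows "(\<Sum>k<n. of_int (A i k) * (\<Sum>j<n. of_int (B k j) * v j)) = v i"
proof -
  have "(\<Sum>k<n. of_int (A i k) * (\<Sum>j<n. of_int (B k j) * v j)) =
      (\<Sum>j<n. (\<Sum>k<n. of_int (A i k * B k j)) * v j)"
    by (simp add: sum_distrib_left sum_distrib_right mult.assoc) (rule sum.swap)
  also have "\<dots> = (\<Sum>j<n. of_int (\<Sum>k<n. A i k * B k j) * v j)" by (simp only: of_int_sum)
  also have "\<dots> = (\<Sum>j<n. if j = i then v j else 0)"
    by (intro sum.cong refl) (use assms in auto)
  also have "\<dots> = v i" using assms(2) by simp
  finally show ?thesis .
qed

lemma affine_map_E [simp]: "affine_map n A b x \<in> space_Rn n"
  by (simp add: affine_map_def)

lemma affine_map_vadd: "affine_map n A b (vadd n y x) = vadd n (linear_map n A y) (affine_map n A b x)"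
  by (rule ext) (simp add: affine_map_def vadd_def restrict_def algebra_simps sum.distrib)

lemma affine_map_grid:
  assumes "y \<in> grid n k"
  shows "linear_map n A y \<in> grid n k"
  unfolding grid_def affine_map_def
proof (rule restrict_PiE_iff[THEN iffD2], intro ballI CollectI)
  fix i assume "i \<in> {..<n}"
  have "real k * ((\<Sum>j<n. of_int (A i j) * y j) + of_int 0) = (\<Sum>j<n. of_int (A i j) * (real k * y j))"
    by (simp add: sum_distrib_left mult_ac)
  also have "\<dots> \<in> \<int>" using assms by (intro Ints_sum Ints_mult[OF Ints_of_int]) (auto simp: grid_def PiE_iff)
  finally show "real k * ((\<Sum>j<n. of_int (A i j) * y j) + of_int 0) \<in> \<int>" .
qed

lemma GL_int_inverse:
  assumes "A \<in> GL_int n"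
  shows "\<exists>B\<in>GL_int n. \<forall>x\<in>space_Rn n. linear_map n A (linear_map n B x) = x \<and>
    linear_map n B (linear_map n A x) = x"
proof -
  from assms obtain B where B: "\<forall>i<n. \<forall>j<n. (\<Sum>k<n. A i k * B k j) = (if i = j then 1 else 0)"
     "\<forall>i<n. \<forall>j<n. (\<Sum>k<n. B i k * A k j) = (if i = j then 1 else 0)"
    unfolding GL_int_def by blast
  have inv: "linear_map n A (linear_map n B x) = x"
    if "\<forall>i<n. \<forall>j<n. (\<Sum>k<n. A i k * B k j) = (if i = j then 1 else 0)" "x \<in> space_Rn n" for A B x
  proof
    fix i
    show "linear_map n A (linear_map n B x) i = x i"
      using that(2) matrix_inverse_apply[OF that(1), of i x]
      by (cases "i < n") (auto simp: affine_map_def PiE_iff extensional_def)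
  qed
  have "B \<in> GL_int n" using B unfolding GL_int_def by blast
  then show ?thesis using inv[OF B(1)] inv[OF B(2)] by blast
qed

lemma affine_map_translate: "affine_map n A b x = vadd n (\<lambda>i\<in>{..<n}. of_int (b i)) (linear_map n A x)"
  by (rule ext) (simp add: affine_map_def vadd_def restrict_def)

lemma Aff_int_inverse:
  assumes "g \<in> Aff_int n"
  shows "\<exists>h\<in>Aff_int n. \<forall>x\<in>space_Rn n. g (h x) = x \<and> h (g x) = x"
proof -
  from assms obtain A b where A: "A \<in> GL_int n" and g: "g = affine_map n A b" unfolding Aff_int_def by blast
  obtain B where B: "B \<in> GL_int n"
    and AB: "\<And>x. x \<in> space_Rn n \<Longrightarrow> linear_map n A (linear_map n B x) = x"
    and BA: "\<And>x. x \<in> space_Rn n \<Longrightarrow> linear_map n B (linear_map n A x) = x"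
    using GL_int_inverse[OF A] by blast
  define c where "c i = (\<Sum>j<n. B i j * - b j)" for i
  define bb where "bb = (\<lambda>i\<in>{..<n}. real_of_int (b i))"
  have c: "(\<lambda>i\<in>{..<n}. of_int (c i)) = linear_map n B (vneg n bb)"
    by (rule ext) (simp add: c_def affine_map_def vneg_def bb_def restrict_def)
  have h: "affine_map n B c x = linear_map n B (vadd n (vneg n bb) x)" for x
    by (subst affine_map_translate, subst c, simp only: affine_map_vadd)
  have g': "g x = vadd n bb (linear_map n A x)" for x
    unfolding g bb_def by (rule affine_map_translate)
  show ?thesis
  proof (intro bexI[of _ "affine_map n B c"] ballI conjI)
    show "affine_map n B c \<in> Aff_int n" using B unfolding Aff_int_def by blast
  next
    fix x assume "x \<in> space_Rn n"
    then show "g (affine_map n B c x) = x" "affine_map n B c (g x) = x"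
      by (simp_all add: h g' AB BA)
  qed
qed

lemma Aff_int_E: "g \<in> Aff_int n \<Longrightarrow> g x \<in> space_Rn n"
proof -
  assume "g \<in> Aff_int n"
  then obtain A b where "g = affine_map n A b" unfolding Aff_int_def by blast
  then show ?thesis by (simp only: affine_map_E)
qed

lemma Aff_int_inj_on:
  assumes "g \<in> Aff_int n"
  shows "inj_on g (space_Rn n)"
proof -
  obtain h where "h \<in> Aff_int n" "\<And>x. x \<in> space_Rn n \<Longrightarrow> g (h x) = x"
    and "\<And>x. x \<in> space_Rn n \<Longrightarrow> h (g x) = x" using Aff_int_inverse[OF assms] by blast
  then show ?thesis by (intro inj_on_inverseI[where g = h]) auto
qed

lemma Aff_int_grid:
  assumes "g \<in> Aff_int n" "x \<in> space_Rn n" "k > 0"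
  shows "g x \<in> grid n k \<longleftrightarrow> x \<in> grid n k"
proof -
  have imp: "g x \<in> grid n k" if "x \<in> grid n k" "g \<in> Aff_int n" for g x
  proof -
    from that obtain A b where g: "g = affine_map n A b" unfolding Aff_int_def by blast
    have "vadd n (\<lambda>i\<in>{..<n}. of_int (b i)) y \<in> grid n k" if "y \<in> grid n k" for y
      unfolding grid_def vadd_def
    proof (rule restrict_PiE_iff[THEN iffD2], intro ballI CollectI)
      fix i assume i: "i \<in> {..<n}"
      then have "real k * y i \<in> \<int>" using that unfolding grid_def by blast
      then have "real k * of_int (b i) + real k * y i \<in> \<int>" by (intro Ints_add Ints_mult[OF Ints_of_nat Ints_of_int])
      then show "real k * ((\<lambda>i\<in>{..<n}. of_int (b i)) i + y i) \<in> \<int>" using i by (simp add: distrib_left)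
    qed
    then show ?thesis unfolding g affine_map_translate[of n A b x] using affine_map_grid[OF that(1)] by simp
  qed
  obtain h where h: "h \<in> Aff_int n" "\<And>x. x \<in> space_Rn n \<Longrightarrow> g (h x) = x"
    "\<And>x. x \<in> space_Rn n \<Longrightarrow> h (g x) = x" using Aff_int_inverse[OF assms(1)] by blast
  show ?thesis using imp[OF _ assms(1), of x] imp[OF _ h(1), of "g x"] unfolding h(3)[OF assms(2)] by (rule iffI[rotated])
qed

lemma measurable_affine_map [measurable]: "affine_map n A b \<in> measurable (lebesgue_Rn n) (lebesgue_Rn n)"
  unfolding affine_map_def
  by (rule measurable_into_Rn, intro borel_measurable_add borel_measurable_sum borel_measurable_times
      borel_measurable_const) (auto intro: measurable_coord)

lemma measurable_Aff_int: "g \<in> Aff_int n \<Longrightarrow> g \<in> measurable (lebesgue_Rn n) (lebesgue_Rn n)"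
proof -
  assume "g \<in> Aff_int n"
  then obtain A b where "g = affine_map n A b" unfolding Aff_int_def by blast
  then show ?thesis by (simp only: measurable_affine_map)
qed

text \<open>
The image measure is invariant under translations, and the preimage of the unit cell under \<open>g\<close> is
again a fundamental domain of the lattice, hence has measure \<open>1\<close> by \<open>nn_integral_tiling\<close>.
\<close>

lemma distr_Aff_int:
  assumes "g \<in> Aff_int n"
  shows "distr (lebesgue_Rn n) (lebesgue_Rn n) g = lebesgue_Rn n"
proof (rule translation_invariant_unique)
  from assms obtain A b where A: "A \<in> GL_int n" and g: "g = affine_map n A b" unfolding Aff_int_def by blast
  obtain B where B: "B \<in> GL_int n"
    and AB: "\<And>x. x \<in> space_Rn n \<Longrightarrow> linear_map n A (linear_map n B x) = x"
    and BA: "\<And>x. x \<in> space_Rn n \<Longrightarrow> linear_map n B (linear_map n A x) = x"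
    using GL_int_inverse[OF A] by blast
  note [measurable] = measurable_Aff_int[OF assms]
  show "sets (distr (lebesgue_Rn n) (lebesgue_Rn n) g) = sets (lebesgue_Rn n)" by simp
  show "(\<integral>\<^sup>+x. f (vadd n v x) \<partial>distr (lebesgue_Rn n) (lebesgue_Rn n) g) = (\<integral>\<^sup>+x. f x \<partial>distr (lebesgue_Rn n) (lebesgue_Rn n) g)"
    if f [measurable]: "f \<in> borel_measurable (lebesgue_Rn n)" and v: "v \<in> space_Rn n" for f v
  proof -
    define w where "w = linear_map n B v"
    have "(\<integral>\<^sup>+x. f (vadd n v x) \<partial>distr (lebesgue_Rn n) (lebesgue_Rn n) g) = (\<integral>\<^sup>+x. f (vadd n v (g x)) \<partial>lebesgue_Rn n)"
      by (rule nn_integral_distr) measurable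
    also have "\<dots> = (\<integral>\<^sup>+x. f (g (vadd n w x)) \<partial>lebesgue_Rn n)"
      unfolding g affine_map_vadd w_def AB[OF v] ..
    also have "\<dots> = (\<integral>\<^sup>+x. f (g x) \<partial>lebesgue_Rn n)"
      by (rule nn_integral_translate[of "\<lambda>x. f (g x)"]) measurable
    also have "\<dots> = (\<integral>\<^sup>+x. f x \<partial>distr (lebesgue_Rn n) (lebesgue_Rn n) g)"
      by (rule nn_integral_distr[symmetric]) measurable
    finally show ?thesis .
  qed
  have "emeasure (distr (lebesgue_Rn n) (lebesgue_Rn n) g) (lattice_cell n 1) = (\<integral>\<^sup>+x. of_bool (g x \<in> lattice_cell n 1) \<partial>lebesgue_Rn n)"
  proof -
    have "emeasure (distr (lebesgue_Rn n) (lebesgue_Rn n) g) (lattice_cell n 1) = emeasure (lebesgue_Rn n) (g -` lattice_cell n 1 \<inter> space (lebesgue_Rn n))"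
      by (rule emeasure_distr) measurable
    also have "\<dots> = (\<integral>\<^sup>+x. indicator (g -` lattice_cell n 1 \<inter> space (lebesgue_Rn n)) x \<partial>lebesgue_Rn n)"
      by (rule nn_integral_indicator[symmetric]) measurable
    also have "\<dots> = (\<integral>\<^sup>+x. of_bool (g x \<in> lattice_cell n 1) \<partial>lebesgue_Rn n)"
      by (rule nn_integral_cong) (simp add: indicator_def)
    finally show ?thesis .
  qed
  also have "\<dots> = (\<integral>\<^sup>+t. (\<integral>\<^sup>+y. of_bool (g (vadd n y t) \<in> lattice_cell n 1) \<partial>count_space (grid n 1)) * indicator (lattice_cell n 1) t \<partial>lebesgue_Rn n)"
  proof (rule nn_integral_tiling)
    have "(\<lambda>x. indicator (lattice_cell n 1) (g x) :: ennreal) \<in> borel_measurable (lebesgue_Rn n)" by measurable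
    then show "(\<lambda>x. of_bool (g x \<in> lattice_cell n 1) :: ennreal) \<in> borel_measurable (lebesgue_Rn n)"
      by (simp add: indicator_def)
  qed simp
  also have "\<dots> = (\<integral>\<^sup>+t. 1 * indicator (lattice_cell n 1) t \<partial>lebesgue_Rn n)"
  proof (rule nn_integral_cong)
    fix t assume t: "t \<in> space (lebesgue_Rn n)"
    define z0 where "z0 = (\<lambda>i\<in>{..<n}. \<lfloor>real 1 * g t i\<rfloor> / real 1)"
    have z0: "{z \<in> grid n 1. vadd n (vneg n z) (g t) \<in> lattice_cell n 1} = {z0}"
      unfolding z0_def by (rule grid_cell) (auto simp: Aff_int_E[OF assms])
    have neg: "vneg n z \<in> grid n 1" "vneg n (vneg n z) = z" if "z \<in> grid n 1" for z
      using that by (auto simp: vneg_def grid_def restrict_PiE_iff PiE_iff extensional_def fun_eq_iff restrict_def)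
    have gE: "z \<in> space_Rn n" if "z \<in> grid n 1" for z using that by (auto simp: grid_def PiE_iff)
    have "{y \<in> grid n 1. g (vadd n y t) \<in> lattice_cell n 1} = {linear_map n B (vneg n z0)}"
    proof (intro equalityI subsetI)
      fix y assume y: "y \<in> {y \<in> grid n 1. g (vadd n y t) \<in> lattice_cell n 1}"
      define z where "z = vneg n (linear_map n A y)"
      have z: "z \<in> grid n 1" "vneg n z = linear_map n A y"
        using neg affine_map_grid[of y n 1 A] y by (auto simp: z_def)
      moreover have "vadd n (vneg n z) (g t) \<in> lattice_cell n 1"
        using y unfolding g affine_map_vadd z(2) by simp
      ultimately have "z = z0" using z0 by blast
      then have "linear_map n A y = vneg n z0" using z(2) by simp
      then show "y \<in> {linear_map n B (vneg n z0)}" using BA[OF gE, of y] y by simp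
    next
      fix y assume y: "y \<in> {linear_map n B (vneg n z0)}"
      have "z0 \<in> grid n 1" "vadd n (vneg n z0) (g t) \<in> lattice_cell n 1" using z0 by blast+
      then show "y \<in> {y \<in> grid n 1. g (vadd n y t) \<in> lattice_cell n 1}"
        using y affine_map_grid[of "vneg n z0" n 1 B] neg unfolding g affine_map_vadd by (simp add: AB)
    qed
    then have "(\<integral>\<^sup>+y. 1 * of_bool (g (vadd n y t) \<in> lattice_cell n 1) \<partial>count_space (grid n 1)) = 1"
      by (rule nn_integral_count_space_singleton)
    then show "(\<integral>\<^sup>+y. of_bool (g (vadd n y t) \<in> lattice_cell n 1) \<partial>count_space (grid n 1)) * indicator (lattice_cell n 1) t = 1 * indicator (lattice_cell n 1) t"
      by simp
  qed
  also have "\<dots> = 1" using emeasure_lattice_cell[of 1 n] by simp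
  finally show "emeasure (distr (lebesgue_Rn n) (lebesgue_Rn n) g) (lattice_cell n 1) = 1" .
qed

lemma nn_integral_Aff_int:
  assumes "g \<in> Aff_int n" "f \<in> borel_measurable (lebesgue_Rn n)"
  shows "(\<integral>\<^sup>+x. f (g x) \<partial>lebesgue_Rn n) = (\<integral>\<^sup>+x. f x \<partial>lebesgue_Rn n)"
proof -
  have "(\<integral>\<^sup>+x. f x \<partial>distr (lebesgue_Rn n) (lebesgue_Rn n) g) = (\<integral>\<^sup>+x. f (g x) \<partial>lebesgue_Rn n)"
    using nn_integral_distr[OF measurable_Aff_int[OF assms(1)]] assms(2) by simp
  then show ?thesis by (simp add: distr_Aff_int[OF assms(1)])
qed

lemma sets_Aff_int_image:
  assumes g: "g \<in> Aff_int n" and S: "S \<in> sets (lebesgue_Rn n)"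
  shows "g ` S \<in> sets (lebesgue_Rn n)"
proof -
  obtain h where h: "h \<in> Aff_int n"
    "\<And>x. x \<in> space_Rn n \<Longrightarrow> g (h x) = x" "\<And>x. x \<in> space_Rn n \<Longrightarrow> h (g x) = x"
    using Aff_int_inverse[OF g] by blast
  have SE: "S \<subseteq> space_Rn n" using sets.sets_into_space[OF S] by simp
  have "g ` S = h -` S \<inter> space (lebesgue_Rn n)"
  proof (intro equalityI subsetI)
    fix y assume "y \<in> g ` S"
    then show "y \<in> h -` S \<inter> space (lebesgue_Rn n)" using h(3) SE Aff_int_E[OF g] by auto
  next
    fix y assume y: "y \<in> h -` S \<inter> space (lebesgue_Rn n)"
    then have "y = g (h y)" using h(2) by simp
    then show "y \<in> g ` S" using y by blast
  qed
  then show ?thesis using measurable_sets[OF measurable_Aff_int[OF h(1)] S] by simp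
qed

lemma id_Aff_int: "\<exists>g\<in>Aff_int n. \<forall>x \<in> space_Rn n. g x = x"
proof -
  have "(\<lambda>i j. if i = j then 1 else 0) \<in> GL_int n"
    unfolding GL_int_def
  proof (intro CollectI exI[of _ "\<lambda>i j. if i = j then 1 else 0"] allI impI)
    fix i j assume "i < n" "j < n"
    have "(\<Sum>k<n. (if i = k then 1 else 0) * (if k = j then 1 else 0)) = (\<Sum>k<n. if k = i then if k = j then 1 else 0 else (0::int))"
      by (intro sum.cong) auto
    also have "\<dots> = (if i = j then 1 else 0)" using \<open>i < n\<close> by simp
    finally show "(\<Sum>k<n. (if i = k then 1 else 0) * (if k = j then 1 else 0)) = (if i = j then 1 else (0::int)) \<and>
       (\<Sum>k<n. (if i = k then 1 else 0) * (if k = j then 1 else 0)) = (if i = j then 1 else (0::int))" by simp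
  qed
  then have "affine_map n (\<lambda>i j. if i = j then 1 else 0) (\<lambda>_. 0) \<in> Aff_int n"
    unfolding Aff_int_def by blast
  then show ?thesis using affine_map_id by blast
qed

text \<open>
Countably many rational boxes on which \<open>f\<close> is given by a single integral affine map cover \<open>\<Omega>\<close>; made
disjoint, they reduce the claim to \<open>nn_integral_Aff_int\<close>. Injectivity makes the images disjoint too.
\<close>

lemma nn_integral_locally_int_affine:
  assumes f: "locally_int_affine n \<Omega> f" "inj_on f \<Omega>"
    and h [measurable]: "h \<in> borel_measurable (lebesgue_Rn n)"
  shows "(\<integral>\<^sup>+x\<in>\<Omega>. h (f x) \<partial>lebesgue_Rn n) = (\<integral>\<^sup>+y\<in>f ` \<Omega>. h y \<partial>lebesgue_Rn n)"
proof -
  have open\<Omega>: "openin (Rn n) \<Omega>" using f(1) by (simp add: locally_int_affine_def)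
  then have \<Omega>E: "\<Omega> \<subseteq> space_Rn n" using openin_subset topspace_Rn by metis
  define \<B> where "\<B> = {S \<in> (\<lambda>(a, b). obox n a b) ` (rational_points n \<times> rational_points n).
      S \<subseteq> \<Omega> \<and> (\<exists>g\<in>Aff_int n. \<forall>x\<in>S. f x = g x)}"
  have "countable \<B>" unfolding \<B>_def
    by (rule countable_subset[of _ "(\<lambda>(a, b). obox n a b) ` (rational_points n \<times> rational_points n)"])
      (auto intro: countable_rational_points)
  have "\<Union>\<B> = \<Omega>"
  proof (intro equalityI subsetI)
    fix x assume "x \<in> \<Omega>"
    then obtain N g where N: "openin (Rn n) N" "x \<in> N" "N \<subseteq> \<Omega>" "g \<in> Aff_int n" "\<forall>y\<in>N. f y = g y"
      using f(1) unfolding locally_int_affine_def by blast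
    from obox_nbhd[OF N(1,2)] obtain a b where ab: "a \<in> rational_points n" "b \<in> rational_points n"
      "x \<in> obox n a b" "cbox_Rn n a b \<subseteq> N" .
    then have "obox n a b \<subseteq> N" using obox_subset_cbox by blast
    then have "obox n a b \<in> \<B>" unfolding \<B>_def using ab N by blast
    then show "x \<in> \<Union>\<B>" using ab by blast
  qed (auto simp: \<B>_def)
  \<comment> \<open>The empty set is added so that the family can be enumerated even if \<open>\<Omega>\<close> is empty.\<close>
  define R where "R = from_nat_into (insert {} \<B>)"
  have rangeR: "range R = insert {} \<B>" unfolding R_def using \<open>countable \<B>\<close> by (intro range_from_nat_into) auto
  have "\<exists>g\<in>Aff_int n. \<forall>x\<in>R l. f x = g x" for l
  proof -
    have "R l \<in> insert {} \<B>" using rangeR by blast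
    then show ?thesis using id_Aff_int[of n] by (auto simp: \<B>_def)
  qed
  then obtain G where G: "\<And>l. G l \<in> Aff_int n" "\<And>l x. x \<in> R l \<Longrightarrow> f x = G l x" by metis
  define D where "D = disjointed R"
  have RS: "R l \<in> sets (lebesgue_Rn n)" for l
  proof -
    have "R l \<in> insert {} \<B>" using rangeR by blast
    then show ?thesis by (auto simp: \<B>_def sets_obox)
  qed
  then have DS [measurable]: "D l \<in> sets (lebesgue_Rn n)" for l
    unfolding D_def using sets.range_disjointed_sets[of R "lebesgue_Rn n"] by blast
  have DR: "D l \<subseteq> R l" for l unfolding D_def by (rule disjointed_subset)
  have disj: "disjoint_family D" unfolding D_def by (rule disjoint_family_disjointed)
  have UD: "(\<Union>l. D l) = \<Omega>" unfolding D_def UN_disjointed_eq using rangeR \<open>\<Union>\<B> = \<Omega>\<close> by auto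
  have fD: "f ` D l = G l ` D l" for l using G(2) DR by (intro image_cong) auto
  have fDS [measurable]: "f ` D l \<in> sets (lebesgue_Rn n)" for l
    unfolding fD by (rule sets_Aff_int_image[OF G(1) DS])
  have disjf: "disjoint_family (\<lambda>l. f ` D l)"
    unfolding disjoint_family_on_def
  proof (intro ballI impI)
    fix l m :: nat assume "l \<noteq> m"
    then have "D l \<inter> D m = {}" using disj by (auto simp: disjoint_family_on_def)
    moreover have "f ` D l \<inter> f ` D m = f ` (D l \<inter> D m)"
      using UD by (intro inj_on_image_Int[OF f(2), symmetric]) auto
    ultimately show "f ` D l \<inter> f ` D m = {}" by simp
  qed
  have Gm [measurable]: "G l \<in> measurable (lebesgue_Rn n) (lebesgue_Rn n)" for l
    by (rule measurable_Aff_int[OF G(1)])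
  have piece: "(\<integral>\<^sup>+x\<in>D l. h (f x) \<partial>lebesgue_Rn n) = (\<integral>\<^sup>+y\<in>f ` D l. h y \<partial>lebesgue_Rn n)" for l
  proof -
    have "(\<integral>\<^sup>+x\<in>D l. h (f x) \<partial>lebesgue_Rn n) = (\<integral>\<^sup>+x. h (G l x) * indicator (f ` D l) (G l x) \<partial>lebesgue_Rn n)"
    proof (rule nn_integral_cong)
      fix x assume x: "x \<in> space (lebesgue_Rn n)"
      have "G l x \<in> G l ` D l \<longleftrightarrow> x \<in> D l"
        using x UD \<Omega>E by (intro inj_on_image_mem_iff[OF Aff_int_inj_on[OF G(1)]]) auto
      then show "h (f x) * indicator (D l) x = h (G l x) * indicator (f ` D l) (G l x)"
        using G(2)[of x l] DR[of l] by (auto simp: fD indicator_def)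
    qed
    also have "\<dots> = (\<integral>\<^sup>+y\<in>f ` D l. h y \<partial>lebesgue_Rn n)"
      by (rule nn_integral_Aff_int[OF G(1)]) measurable
    finally show ?thesis .
  qed
  have "(\<integral>\<^sup>+x\<in>\<Omega>. h (f x) \<partial>lebesgue_Rn n) = (\<integral>\<^sup>+x. (\<Sum>l. h (f x) * indicator (D l) x) \<partial>lebesgue_Rn n)"
    by (intro nn_integral_cong) (simp only: ennreal_suminf_cmult suminf_indicator[OF disj] UD)
  also have "\<dots> = (\<Sum>l. \<integral>\<^sup>+x. h (f x) * indicator (D l) x \<partial>lebesgue_Rn n)"
  proof (rule nn_integral_suminf)
    fix l
    have "(\<lambda>x. h (G l x) * indicator (D l) x) \<in> borel_measurable (lebesgue_Rn n)" by measurable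
    also have "(\<lambda>x. h (G l x) * indicator (D l) x) = (\<lambda>x. h (f x) * indicator (D l) x)"
    proof
      fix x
      show "h (G l x) * indicator (D l) x = h (f x) * indicator (D l) x"
      proof (cases "x \<in> D l")
        case True
        then have "f x = G l x" using G(2) DR by blast
        then show ?thesis by simp
      qed simp
    qed
    finally show "(\<lambda>x. h (f x) * indicator (D l) x) \<in> borel_measurable (lebesgue_Rn n)" .
  qed
  also have "\<dots> = (\<Sum>l. \<integral>\<^sup>+y\<in>f ` D l. h y \<partial>lebesgue_Rn n)" by (simp add: piece)
  also have "\<dots> = (\<integral>\<^sup>+y\<in>(\<Union>l. f ` D l). h y \<partial>lebesgue_Rn n)"
    by (rule nn_integral_disjoint_family[symmetric]) (use disjf in auto)
  also have "(\<Union>l. f ` D l) = f ` \<Omega>" using UD by auto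
  finally show ?thesis .
qed

section \<open>Differentiability along coordinate directions\<close>

text \<open>
Continuous differentiability of order \<open>m\<close> in the direction of the \<open>j\<close>-th coordinate alone. Lattice sums
are estimated one coordinate at a time, so mixed derivatives never enter.
\<close>

fun C_along :: "nat \<Rightarrow> nat \<Rightarrow> nat \<Rightarrow> (nat \<Rightarrow> real) set \<Rightarrow> ((nat \<Rightarrow> real) \<Rightarrow> real) \<Rightarrow> bool" where
  "C_along n j 0 W g \<longleftrightarrow> continuous_map (subtopology (Rn n) W) euclideanreal g"
| "C_along n j (Suc m) W g \<longleftrightarrow> continuous_map (subtopology (Rn n) W) euclideanreal g \<and>
     (\<exists>h. C_along n j m W h \<and> (\<forall>x\<in>W. ((\<lambda>t. g (x(j := t))) has_real_derivative h x) (at (x j))))"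

lemma C_along_continuous: "C_along n j m W g \<Longrightarrow> continuous_map (subtopology (Rn n) W) euclideanreal g"
  by (cases m) auto

lemma C_along_SucD: "C_along n j (Suc m) W g \<Longrightarrow> C_along n j m W g"
proof (induction m arbitrary: g)
  case (Suc m)
  from Suc.prems obtain h where "C_along n j (Suc m) W h"
    and *: "\<forall>x\<in>W. ((\<lambda>t. g (x(j := t))) has_real_derivative h x) (at (x j))"
    unfolding C_along.simps(2)[of n j "Suc m"] by blast
  then have "C_along n j m W h" using Suc.IH by blast
  then show ?case using * C_along_continuous[OF Suc.prems] by auto
qed simp

lemma line_open:
  assumes "openin (Rn n) W" "x \<in> W" "j < n"
  obtains T where "open T" "x j \<in> T" "\<And>t. t \<in> T \<Longrightarrow> x(j := t) \<in> W"
proof -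
  obtain a b where ab: "x \<in> obox n a b" "cbox_Rn n a b \<subseteq> W" using assms by (meson obox_nbhd)
  show thesis
  proof (rule that[of "{a j<..<b j}"])
    show "x j \<in> {a j<..<b j}" using ab assms(3) by (auto simp: obox_def PiE_iff)
    fix t assume "t \<in> {a j<..<b j}"
    then have "x(j := t) \<in> obox n a b" using ab(1) assms(3) by (auto simp: obox_def PiE_iff extensional_def)
    then show "x(j := t) \<in> W" using ab(2) obox_subset_cbox by blast
  qed auto
qed

lemma derivative_line_cong:
  assumes "openin (Rn n) W" "x \<in> W" "j < n" and eq: "\<And>y. y \<in> W \<Longrightarrow> f y = g y"
    and "((\<lambda>t. f (x(j := t))) has_real_derivative d) (at (x j))"
  shows "((\<lambda>t. g (x(j := t))) has_real_derivative d) (at (x j))"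
proof -
  obtain T where T: "open T" "x j \<in> T" "\<And>t. t \<in> T \<Longrightarrow> x(j := t) \<in> W"
    using line_open[OF assms(1-3)] by blast
  show ?thesis
    by (rule has_field_derivative_transform_within_open[OF assms(5) T(1,2)]) (use T(3) eq in blast)
qed

lemma C_along_cong:
  assumes "openin (Rn n) W" "j < n" "\<And>y. y \<in> W \<Longrightarrow> f y = g y" "C_along n j m W f"
  shows "C_along n j m W g"
proof -
  have cont: "continuous_map (subtopology (Rn n) W) euclideanreal g"
    using C_along_continuous[OF assms(4)] by (rule continuous_map_eq) (use assms(3) in auto)
  show ?thesis
  proof (cases m)
    case 0 then show ?thesis using cont by simp
  next
    case (Suc l)
    with assms(4) obtain h where "C_along n j l W h" "\<forall>x\<in>W. ((\<lambda>t. f (x(j := t))) has_real_derivative h x) (at (x j))"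
      by auto
    moreover from this(2) have "\<forall>x\<in>W. ((\<lambda>t. g (x(j := t))) has_real_derivative h x) (at (x j))"
      using derivative_line_cong[OF assms(1) _ assms(2), of _ f g] assms(3) by simp
    ultimately show ?thesis using cont Suc by auto
  qed
qed

lemma continuous_glue:
  assumes "\<And>x. x \<in> W \<Longrightarrow> \<exists>W'. openin (Rn n) W' \<and> x \<in> W' \<and> W' \<subseteq> W \<and>
    continuous_map (subtopology (Rn n) W') euclideanreal g"
  shows "continuous_map (subtopology (Rn n) W) euclideanreal g"
proof -
  from assms obtain T where T: "\<And>x. x \<in> W \<Longrightarrow> openin (Rn n) (T x)" "\<And>x. x \<in> W \<Longrightarrow> x \<in> T x"
      "\<And>x. x \<in> W \<Longrightarrow> T x \<subseteq> W"
      "\<And>x. x \<in> W \<Longrightarrow> continuous_map (subtopology (Rn n) (T x)) euclideanreal g" by metis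
  show ?thesis
  proof (rule pasting_lemma[where I = W and T = T and f = "\<lambda>_. g"])
    show "openin (subtopology (Rn n) W) (T x)" if "x \<in> W" for x
      using openin_subtopology_Int2[OF T(1)[OF that], of W] T(3)[OF that] by (simp add: inf.absorb2)
    show "continuous_map (subtopology (subtopology (Rn n) W) (T x)) euclideanreal g" if "x \<in> W" for x
      using T(3,4)[OF that] by (simp add: subtopology_subtopology inf.absorb2)
  qed (use T in auto)
qed

text \<open>
Differentiability is a local property; the local derivatives fit together because derivatives are
unique.
\<close>

lemma C_along_glue:
  assumes "openin (Rn n) W" "j < n"
    and "\<And>x. x \<in> W \<Longrightarrow> \<exists>W'. openin (Rn n) W' \<and> x \<in> W' \<and> W' \<subseteq> W \<and> C_along n j m W' g"
  shows "C_along n j m W g"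
  using assms(3)
proof (induction m arbitrary: g)
  case 0
  then show ?case using continuous_glue by simp
next
  case (Suc m)
  define h where "h x = (THE d. ((\<lambda>t. g (x(j := t))) has_real_derivative d) (at (x j)))" for x
  have h: "h x = d" if "((\<lambda>t. g (x(j := t))) has_real_derivative d) (at (x j))" for x d
    unfolding h_def using that DERIV_unique by blast
  have loc: "\<exists>W'. openin (Rn n) W' \<and> x \<in> W' \<and> W' \<subseteq> W \<and> C_along n j m W' h \<and>
      ((\<lambda>t. g (x(j := t))) has_real_derivative h x) (at (x j))" if x: "x \<in> W" for x
  proof -
    obtain W' h' where W': "openin (Rn n) W'" "x \<in> W'" "W' \<subseteq> W" "C_along n j m W' h'"
      "\<forall>x\<in>W'. ((\<lambda>t. g (x(j := t))) has_real_derivative h' x) (at (x j))"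
      using Suc.prems[OF x] by auto
    then have "h y = h' y" if "y \<in> W'" for y using h that by blast
    then have "C_along n j m W' h" using W' assms(2) by (intro C_along_cong[of n W' j h' h]) auto
    then show ?thesis using W' h by (intro exI[of _ W']) auto
  qed
  then have "C_along n j m W h" by (intro Suc.IH) blast
  moreover have "continuous_map (subtopology (Rn n) W) euclideanreal g"
  proof (rule continuous_glue)
    fix x assume "x \<in> W"
    from Suc.prems[OF this] obtain W' where "openin (Rn n) W'" "x \<in> W'" "W' \<subseteq> W" "C_along n j (Suc m) W' g" by blast
    then show "\<exists>W'. openin (Rn n) W' \<and> x \<in> W' \<and> W' \<subseteq> W \<and> continuous_map (subtopology (Rn n) W') euclideanreal g"
      using C_along_continuous[of n j "Suc m" W' g] by blast
  qed
  ultimately show ?case using loc by auto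
qed

lemma C_along_const: "C_along n j m W (\<lambda>_. c)"
proof (induction m arbitrary: c)
  case (Suc m)
  then show ?case by (auto intro!: exI[of _ "\<lambda>_. 0"])
qed simp

lemma C_along_add: "C_along n j m W f \<Longrightarrow> C_along n j m W g \<Longrightarrow> C_along n j m W (\<lambda>x. f x + g x)"
proof (induction m arbitrary: f g)
  case (Suc m)
  then obtain f' g' where "C_along n j m W f'" "C_along n j m W g'"
    and *: "\<forall>x\<in>W. ((\<lambda>t. f (x(j := t))) has_real_derivative f' x) (at (x j))"
       "\<forall>x\<in>W. ((\<lambda>t. g (x(j := t))) has_real_derivative g' x) (at (x j))" by auto
  then have "C_along n j m W (\<lambda>x. f' x + g' x)" using Suc.IH by blast
  moreover have "continuous_map (subtopology (Rn n) W) euclideanreal (\<lambda>x. f x + g x)"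
    using Suc.prems by (intro continuous_map_add C_along_continuous)
  moreover have "\<forall>x\<in>W. ((\<lambda>t. f (x(j := t)) + g (x(j := t))) has_real_derivative f' x + g' x) (at (x j))"
    using * by (auto intro!: DERIV_add)
  ultimately show ?case by auto
qed (auto intro: continuous_map_add)

lemma C_along_mult: "C_along n j m W f \<Longrightarrow> C_along n j m W g \<Longrightarrow> C_along n j m W (\<lambda>x. f x * g x)"
proof (induction m arbitrary: f g)
  case (Suc m)
  then obtain f' g' where fg: "C_along n j m W f'" "C_along n j m W g'"
    and *: "\<forall>x\<in>W. ((\<lambda>t. f (x(j := t))) has_real_derivative f' x) (at (x j))"
       "\<forall>x\<in>W. ((\<lambda>t. g (x(j := t))) has_real_derivative g' x) (at (x j))" by auto
  have "C_along n j m W (\<lambda>x. f' x * g x + g' x * f x)"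
    using C_along_add[OF Suc.IH[OF fg(1) C_along_SucD[OF Suc.prems(2)]] Suc.IH[OF fg(2) C_along_SucD[OF Suc.prems(1)]]] .
  moreover have "continuous_map (subtopology (Rn n) W) euclideanreal (\<lambda>x. f x * g x)"
    using Suc.prems by (intro continuous_map_real_mult C_along_continuous)
  moreover have "((\<lambda>t. f (x(j := t)) * g (x(j := t))) has_real_derivative f' x * g x + g' x * f x) (at (x j))"
    if "x \<in> W" for x
    using DERIV_mult[OF *(1)[rule_format, OF that] *(2)[rule_format, OF that]] by simp
  ultimately show ?case by auto
qed (auto intro: continuous_map_real_mult)

lemma C_along_inverse: "C_along n j m W f \<Longrightarrow> (\<And>x. x \<in> W \<Longrightarrow> f x \<noteq> 0) \<Longrightarrow> C_along n j m W (\<lambda>x. inverse (f x))"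
proof (induction m arbitrary: f)
  case (Suc m)
  then obtain f' where f': "C_along n j m W f'"
    and *: "\<forall>x\<in>W. ((\<lambda>t. f (x(j := t))) has_real_derivative f' x) (at (x j))" by auto
  have "C_along n j m W (\<lambda>x. inverse (f x))" by (rule Suc.IH[OF C_along_SucD[OF Suc.prems(1)] Suc.prems(2)])
  then have "C_along n j m W (\<lambda>x. (-1) * (inverse (f x) * f' x * inverse (f x)))"
    using f' by (intro C_along_mult C_along_const)
  moreover have "continuous_map (subtopology (Rn n) W) euclideanreal (\<lambda>x. inverse (f x))"
    using C_along_continuous[OF Suc.prems(1)] Suc.prems(2) by (intro continuous_map_real_inverse) auto
  moreover have "((\<lambda>t. inverse (f (x(j := t)))) has_real_derivative (-1) * (inverse (f x) * f' x * inverse (f x))) (at (x j))"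
    if "x \<in> W" for x
    using DERIV_inverse'[OF *[rule_format, OF that]] Suc.prems(2)[OF that] by simp
  ultimately show ?case by auto
qed (auto intro: continuous_map_real_inverse)

lemma continuous_affine_functional:
  "continuous_map (subtopology (Rn n) W) euclideanreal (\<lambda>x. (\<Sum>i<n. c i * x i) + d)"
  unfolding Rn_def by (intro continuous_intros continuous_map_from_subtopology) auto

lemma truncated_power_derivative:
  "((\<lambda>u::real. max 0 u ^ Suc (Suc m)) has_real_derivative real (Suc (Suc m)) * max 0 u ^ Suc m) (at u)"
proof -
  consider "u < 0" | "u > 0" | "u = 0" by linarith
  then show ?thesis
  proof cases
    case 1
    have "((\<lambda>u::real. 0) has_real_derivative 0) (at u)" by simp
    then have "((\<lambda>u::real. max 0 u ^ Suc (Suc m)) has_real_derivative 0) (at u)"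
      by (rule has_field_derivative_transform_within_open[of _ _ _ "{..<0}"]) (use 1 in auto)
    then show ?thesis using 1 by simp
  next
    case 2
    have "((\<lambda>u::real. u ^ Suc (Suc m)) has_real_derivative real (Suc (Suc m)) * u ^ Suc m) (at u)"
      using DERIV_pow[of "Suc (Suc m)" u] by simp
    then have "((\<lambda>u::real. max 0 u ^ Suc (Suc m)) has_real_derivative real (Suc (Suc m)) * u ^ Suc m) (at u)"
      by (rule has_field_derivative_transform_within_open[of _ _ _ "{0<..}"]) (use 2 in auto)
    then show ?thesis using 2 by simp
  next
    case 3
    have "(\<lambda>h. max 0 h ^ Suc (Suc m) / h) = (\<lambda>h::real. max 0 h ^ Suc m)"
      by (auto simp: max_def)
    moreover have "((\<lambda>h::real. max 0 h ^ Suc m) \<longlongrightarrow> max 0 0 ^ Suc m) (at 0)"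
      by (intro tendsto_intros)
    ultimately show ?thesis using 3 by (simp add: DERIV_def)
  qed
qed

text \<open>
Truncated powers of affine functionals are the building blocks of bump functions. An affine change
of coordinates only changes the functional, so the bumps have the same form in every chart.
\<close>

lemma C_along_truncated_power:
  assumes "j < n"
  shows "C_along n j m W (\<lambda>x. max 0 ((\<Sum>i<n. c i * x i) + d) ^ Suc m)"
proof (induction m)
  case 0
  show ?case by (simp only: C_along.simps) (intro continuous_intros continuous_affine_functional)
next
  case (Suc m)
  let ?l = "\<lambda>x. (\<Sum>i<n. c i * x i) + d"
  have "((\<lambda>t. max 0 (?l (x(j := t))) ^ Suc (Suc m)) has_real_derivative
      real (Suc (Suc m)) * max 0 (?l x) ^ Suc m * c j) (at (x j))" for x
  proof -
    have l: "?l (x(j := t)) = c j * t + (?l x - c j * x j)" for t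
    proof -
      have "(\<Sum>i<n. c i * (x(j := t)) i) = (\<Sum>i\<in>{..<n} - {j}. c i * (x(j := t)) i) + c j * t"
        using assms by (subst sum.remove[of _ j]) auto
      also have "(\<Sum>i\<in>{..<n} - {j}. c i * (x(j := t)) i) = (\<Sum>i\<in>{..<n} - {j}. c i * x i)"
        by (intro sum.cong) auto
      also have "\<dots> = (\<Sum>i<n. c i * x i) - c j * x j" using assms by (subst sum.remove[of "{..<n}" j]) auto
      finally show ?thesis by simp
    qed
    have d: "((\<lambda>t. ?l (x(j := t))) has_real_derivative c j) (at (x j))"
      unfolding l by (auto intro!: derivative_eq_intros)
    have "((\<lambda>u. max 0 u ^ Suc (Suc m)) has_real_derivative real (Suc (Suc m)) * max 0 (?l (x(j := x j))) ^ Suc m) (at (?l (x(j := x j))))"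
      by (rule truncated_power_derivative)
    from DERIV_chain2[OF this d] show ?thesis by simp
  qed
  moreover have "C_along n j m W (\<lambda>x. real (Suc (Suc m)) * max 0 (?l x) ^ Suc m * c j)"
    by (intro C_along_mult C_along_const Suc.IH)
  moreover have "continuous_map (subtopology (Rn n) W) euclideanreal (\<lambda>x. max 0 (?l x) ^ Suc (Suc m))"
    by (intro continuous_intros continuous_affine_functional)
  ultimately show ?case unfolding C_along.simps(2) by blast
qed

lemma measurable_continuous_Rn:
  assumes "continuous_map (Rn n) euclideanreal g"
  shows "g \<in> borel_measurable (lebesgue_Rn n)"
proof (rule borel_measurableI)
  fix S :: "real set" assume "open S"
  then have "openin (Rn n) {x \<in> topspace (Rn n). g x \<in> S}"
    using assms by (intro openin_continuous_map_preimage[OF assms]) auto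
  then have "{x \<in> topspace (Rn n). g x \<in> S} \<in> sets (lebesgue_Rn n)" by (rule sets_openin_Rn)
  also have "{x \<in> topspace (Rn n). g x \<in> S} = g -` S \<inter> space (lebesgue_Rn n)"
    by (auto simp: topspace_Rn)
  finally show "g -` S \<inter> space (lebesgue_Rn n) \<in> sets (lebesgue_Rn n)" .
qed

section \<open>Lattice sums of smooth functions\<close>

definition grid_box :: "nat \<Rightarrow> nat \<Rightarrow> nat \<Rightarrow> (nat \<Rightarrow> real) set" where
  "grid_box n R k = grid n k \<inter> cube n R"

lemma grid_box_subset_image:
  assumes k: "k > 0"
  shows "grid_box n R k \<subseteq> (\<lambda>z. \<lambda>i\<in>{..<n}. of_int (z i) / real k) ` ({..<n} \<rightarrow>\<^sub>E {- int (R * k)..int (R * k)})"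
proof
  fix y assume y: "y \<in> grid_box n R k"
  define z where "z = (\<lambda>i\<in>{..<n}. \<lfloor>real k * y i\<rfloor>)"
  have yi: "real k * y i \<in> \<int>" "- real R \<le> y i" "y i \<le> real R" if "i < n" for i
    using y that by (auto simp: grid_box_def grid_def cbox_Rn_def PiE_iff)
  have fl: "real_of_int \<lfloor>real k * y i\<rfloor> = real k * y i" if "i < n" for i
    using yi(1)[OF that] by (metis Ints_cases floor_of_int)
  have "z \<in> {..<n} \<rightarrow>\<^sub>E {- int (R * k)..int (R * k)}"
    unfolding z_def
  proof (rule restrict_PiE_iff[THEN iffD2], intro ballI)
    fix i assume "i \<in> {..<n}"
    then have i: "i < n" by simp
    have "real k * y i \<le> real k * real R" "real k * (- real R) \<le> real k * y i"
      using yi[OF i] by (intro mult_left_mono; simp)+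
    then have "real_of_int \<lfloor>real k * y i\<rfloor> \<le> of_int (int (R * k))" "of_int (- int (R * k)) \<le> real_of_int \<lfloor>real k * y i\<rfloor>"
      unfolding fl[OF i] by (simp_all add: mult.commute)
    then show "\<lfloor>real k * y i\<rfloor> \<in> {- int (R * k)..int (R * k)}" by (simp only: of_int_le_iff atLeastAtMost_iff)
  qed
  moreover have "y = (\<lambda>i\<in>{..<n}. of_int (z i) / real k)"
  proof
    fix i show "y i = (\<lambda>i\<in>{..<n}. of_int (z i) / real k) i"
    proof (cases "i < n")
      case True then show ?thesis using k by (simp add: z_def fl)
    next
      case False then show ?thesis using y by (simp add: grid_box_def grid_def PiE_iff extensional_def)
    qed
  qed
  ultimately show "y \<in> (\<lambda>z. \<lambda>i\<in>{..<n}. of_int (z i) / real k) ` ({..<n} \<rightarrow>\<^sub>E {- int (R * k)..int (R * k)})"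
    unfolding image_iff by (intro bexI[of _ z])
qed

lemma finite_grid_box: "k > 0 \<Longrightarrow> finite (grid_box n R k)"
  by (rule finite_subset[OF grid_box_subset_image]) (auto intro!: finite_imageI finite_PiE)

lemma card_grid_box:
  assumes "k > 0"
  shows "real (card (grid_box n R k)) \<le> (real (2 * R + 1) * real k) ^ n"
proof -
  have "card (grid_box n R k) \<le> card ({..<n} \<rightarrow>\<^sub>E {- int (R * k)..int (R * k)})"
    using assms by (intro order_trans[OF card_mono[OF _ grid_box_subset_image[OF assms]] card_image_le])
      (auto intro!: finite_imageI finite_PiE)
  also have "\<dots> = (2 * (R * k) + 1) ^ n"
    by (subst card_PiE) (auto simp: nat_add_distrib nat_mult_distrib)
  also have "\<dots> \<le> ((2 * R + 1) * k) ^ n"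
    using assms by (intro power_mono) (auto simp: algebra_simps)
  finally show ?thesis by (metis of_nat_le_iff of_nat_mult of_nat_power)
qed

text \<open>
For \<open>t\<close> in the cell and \<open>g\<close> supported in the cube of radius \<open>R\<close>, the cube of radius \<open>R + 1\<close> contains
every lattice point that contributes.
\<close>

definition lattice_sum :: "nat \<Rightarrow> nat \<Rightarrow> nat \<Rightarrow> ((nat \<Rightarrow> real) \<Rightarrow> real) \<Rightarrow> (nat \<Rightarrow> real) \<Rightarrow> real" where
  "lattice_sum n R k g t = (\<Sum>y\<in>grid_box n (Suc R) k. g (vadd n y t))"

definition vanishes_outside :: "nat \<Rightarrow> nat \<Rightarrow> ((nat \<Rightarrow> real) \<Rightarrow> real) \<Rightarrow> bool" where
  "vanishes_outside n R g \<longleftrightarrow>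
     (\<forall>x\<in>space_Rn n. x \<notin> cube n R \<longrightarrow> g x = 0)"

lemma openin_outside_cbox: "openin (Rn n) ((space_Rn n) - cbox_Rn n a b)"
proof -
  have "closedin (Rn n) (cbox_Rn n a b)" unfolding Rn_def cbox_Rn_def by (subst closedin_product_topology) auto
  then show ?thesis using topspace_Rn[of n] by (metis openin_diff openin_topspace)
qed

text \<open>
Moving by a full lattice step permutes the lattice, and lattice points that enter or leave the
larger cube lie outside the support.
\<close>

lemma lattice_sum_endpoints:
  assumes g: "vanishes_outside n R g" and k: "k > 0" and j: "j < n"
  shows "lattice_sum n R k g (t(j := 1 / real k)) = lattice_sum n R k g (t(j := 0))"
proof -
  define F where "F = grid_box n (Suc R) k"
  define s where "s y = y(j := y j + 1 / real k)" for y :: "nat \<Rightarrow> real"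
  have k1: "1 / real k \<le> 1" using k by simp
  have fin: "finite F" unfolding F_def by (rule finite_grid_box[OF k])
  have inj: "inj_on s F"
  proof (rule inj_on_inverseI[where g = "\<lambda>y. y(j := y j - 1 / real k)"])
  qed (simp add: s_def)
  have shift: "vadd n y (t(j := 1 / real k)) = vadd n (s y) (t(j := 0))" for y
    by (rule ext) (simp add: vadd_def s_def restrict_def)
  have zero: "g (vadd n y (t(j := 0))) = 0" if "\<bar>y j\<bar> > real R" for y
  proof -
    have "vadd n y (t(j := 0)) j = y j" using j by (simp add: vadd_def)
    then have "vadd n y (t(j := 0)) \<notin> cube n R"
      using that j unfolding cbox_Rn_def by (auto dest!: PiE_mem[where x = j])
    then show ?thesis using g unfolding vanishes_outside_def by simp
  qed
  have F_iff: "y \<in> F \<longleftrightarrow> y \<in> space_Rn n \<and> (\<forall>i<n. real k * y i \<in> \<int> \<and> - real (Suc R) \<le> y i \<and> y i \<le> real (Suc R))" for y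
    by (auto simp: F_def grid_box_def grid_def cbox_Rn_def PiE_iff)
  have s_int: "real k * s y i \<in> \<int> \<longleftrightarrow> real k * y i \<in> \<int>" for y i
  proof (cases "i = j")
    case True
    have "real k * s y i = real k * y i + 1" using True k by (simp add: s_def field_simps)
    then show ?thesis by (metis Ints_1 Ints_add Ints_diff add_diff_cancel_right')
  qed (simp add: s_def)
  have "lattice_sum n R k g (t(j := 1 / real k)) = (\<Sum>y\<in>s ` F. g (vadd n y (t(j := 0))))"
    unfolding lattice_sum_def F_def[symmetric] shift by (simp add: sum.reindex[OF inj] o_def)
  also have "\<dots> = (\<Sum>y\<in>s ` F \<union> F. g (vadd n y (t(j := 0))))"
  proof (rule sum.mono_neutral_left)
    show "\<forall>y\<in>(s ` F \<union> F) - s ` F. g (vadd n y (t(j := 0))) = 0"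
    proof
      fix y assume "y \<in> (s ` F \<union> F) - s ` F"
      then have y: "y \<in> F" "y \<notin> s ` F" by auto
      define z where "z = y(j := y j - 1 / real k)"
      have sz: "s z = y" by (simp add: s_def z_def)
      have "z \<notin> F" using y(2) sz by blast
      moreover have "z \<in> space_Rn n" using y(1) j unfolding F_iff z_def by (auto simp: PiE_iff extensional_def)
      moreover have "real k * z i \<in> \<int>" if "i < n" for i using s_int[of z i] y(1) that unfolding F_iff sz by simp
      ultimately obtain i where i: "i < n" "\<not> (- real (Suc R) \<le> z i \<and> z i \<le> real (Suc R))" unfolding F_iff by blast
      have "i = j" using i y(1) unfolding F_iff z_def by (cases "i = j") auto
      then have "y j - 1 / real k < - real (Suc R)"
        using i y(1) j k unfolding F_iff z_def by (auto simp: not_le) (smt (verit) divide_pos_pos of_nat_0_less_iff)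
      then have "\<bar>y j\<bar> > real R" using k1 by simp
      then show "g (vadd n y (t(j := 0))) = 0" by (rule zero)
    qed
  qed (use fin in auto)
  also have "\<dots> = (\<Sum>y\<in>F. g (vadd n y (t(j := 0))))"
  proof (rule sum.mono_neutral_right)
    show "\<forall>y\<in>(s ` F \<union> F) - F. g (vadd n y (t(j := 0))) = 0"
    proof
      fix y assume "y \<in> (s ` F \<union> F) - F"
      then obtain z where z: "z \<in> F" "y = s z" "y \<notin> F" by auto
      have "y \<in> space_Rn n" using z(1) j unfolding F_iff z(2) s_def by (auto simp: PiE_iff extensional_def)
      moreover have "real k * y i \<in> \<int>" if "i < n" for i using s_int[of z i] z(1) that unfolding F_iff z(2) by simp
      ultimately obtain i where i: "i < n" "\<not> (- real (Suc R) \<le> y i \<and> y i \<le> real (Suc R))" using z(3) unfolding F_iff by blast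
      have ij: "i = j" using i z(1) unfolding F_iff z(2) s_def by (cases "i = j") auto
      have "- real (Suc R) \<le> y j" using z(1) j unfolding F_iff z(2) s_def by (auto intro: add_increasing2)
      then have "\<bar>y j\<bar> > real R" using i(2) unfolding ij by simp
      then show "g (vadd n y (t(j := 0))) = 0" by (rule zero)
    qed
  qed (use fin in auto)
  also have "\<dots> = lattice_sum n R k g (t(j := 0))" by (simp add: lattice_sum_def F_def)
  finally show ?thesis .
qed

lemma bounded_of_vanishes:
  assumes "continuous_map (Rn n) euclideanreal g" "vanishes_outside n R g"
  shows "\<exists>C\<ge>0. \<forall>x\<in>space_Rn n. \<bar>g x\<bar> \<le> C"
proof -
  have "compactin euclideanreal (g ` cube n R)"
    by (rule image_compactin[OF compactin_cbox assms(1)])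
  then have "bounded (g ` cube n R)" by (simp add: compact_imp_bounded)
  then obtain C where C: "C > 0" "\<And>x. x \<in> cube n R \<Longrightarrow> \<bar>g x\<bar> \<le> C"
    unfolding bounded_pos by auto
  have "\<bar>g x\<bar> \<le> C" if "x \<in> space_Rn n" for x
    using that C assms(2) by (cases "x \<in> cube n R") (auto simp: vanishes_outside_def)
  with C show ?thesis by (intro exI[of _ C]) auto
qed

text \<open>
As a function of the \<open>j\<close>-th coordinate of \<open>t\<close>, the lattice sum takes equal values at the ends of an
interval of length \<open>1/k\<close>, so its derivative has a zero there. The derivative is therefore bounded by
its own oscillation, and the lattice sum oscillates by at most \<open>1/k\<close> times that. The derivative is the
lattice sum of the derivative of \<open>g\<close>, and induction gains a factor \<open>1/k\<close> for each derivative. The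
trivial bound at the start is the number of summands, of order \<open>k\<^sup>n\<close>.
\<close>

lemma lattice_sum_oscillation:
  assumes "C_along n j m (space_Rn n) g" "vanishes_outside n R g" and j: "j < n"
  shows "\<exists>B\<ge>0. \<forall>k>0. \<forall>t. \<forall>s\<in>{0..1 / real k}. \<forall>s'\<in>{0..1 / real k}.
    \<bar>lattice_sum n R k g (t(j := s)) - lattice_sum n R k g (t(j := s'))\<bar> \<le> B * real k ^ n / real k ^ m"
  using assms(1,2)
proof (induction m arbitrary: g)
  case 0
  have "continuous_map (Rn n) euclideanreal g"
    using 0(1) topspace_Rn[of n] by (metis C_along.simps(1) subtopology_topspace)
  from bounded_of_vanishes[OF this 0(2)] obtain C where C: "C \<ge> 0" "\<And>x. x \<in> space_Rn n \<Longrightarrow> \<bar>g x\<bar> \<le> C" by blast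
  define B where "B = real (2 * Suc R + 1) ^ n * C"
  have b: "\<bar>lattice_sum n R k g t\<bar> \<le> B * real k ^ n" if k: "k > 0" for k t
  proof -
    have "\<bar>lattice_sum n R k g t\<bar> \<le> (\<Sum>y\<in>grid_box n (Suc R) k. \<bar>g (vadd n y t)\<bar>)"
      unfolding lattice_sum_def by (rule sum_abs)
    also have "\<dots> \<le> (\<Sum>y\<in>grid_box n (Suc R) k. C)" by (intro sum_mono C vadd_E)
    also have "\<dots> = real (card (grid_box n (Suc R) k)) * C" by simp
    also have "\<dots> \<le> (real (2 * Suc R + 1) * real k) ^ n * C"
      by (intro mult_right_mono card_grid_box k C)
    finally show ?thesis by (simp add: B_def power_mult_distrib mult_ac)
  qed
  have "\<bar>lattice_sum n R k g (t(j := s)) - lattice_sum n R k g (t(j := s'))\<bar> \<le> (2 * B) * real k ^ n / real k ^ 0" if k: "k > 0" for k t s s'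
    using b[OF k, of "t(j := s)"] b[OF k, of "t(j := s')"] by simp
  moreover have "B \<ge> 0" using C by (simp add: B_def)
  ultimately show ?case by (intro exI[of _ "2 * B"] conjI allI impI ballI) (simp, blast)
next
  case (Suc m)
  then obtain h where h: "C_along n j m (space_Rn n) h"
    "\<And>x. x \<in> space_Rn n \<Longrightarrow> ((\<lambda>t. g (x(j := t))) has_real_derivative h x) (at (x j))" by auto
  have "vanishes_outside n R h"
    unfolding vanishes_outside_def
  proof (intro ballI impI)
    fix x assume x: "x \<in> space_Rn n" "x \<notin> cube n R"
    have "((\<lambda>t. (\<lambda>_. 0) (x(j := t))) has_real_derivative h x) (at (x j))"
      by (rule derivative_line_cong[OF openin_outside_cbox[of n "\<lambda>_. - real R" "\<lambda>_. real R"] _ j _ h(2)[OF x(1)]])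
        (use x Suc.prems(2) in \<open>simp_all add: vanishes_outside_def\<close>)
    moreover have "((\<lambda>t. (\<lambda>_. 0) (x(j := t))) has_real_derivative 0) (at (x j))" by simp
    ultimately show "h x = 0" using DERIV_unique by blast
  qed
  from Suc.IH[OF h(1) this] obtain B where B: "B \<ge> 0" "\<forall>k>0. \<forall>t. \<forall>s\<in>{0..1 / real k}. \<forall>s'\<in>{0..1 / real k}.
    \<bar>lattice_sum n R k h (t(j := s)) - lattice_sum n R k h (t(j := s'))\<bar> \<le> B * real k ^ n / real k ^ m"
    by (elim exE conjE)
  have "\<bar>lattice_sum n R k g (t(j := s)) - lattice_sum n R k g (t(j := s'))\<bar> \<le> B * real k ^ n / real k ^ Suc m"
    if k: "k > 0" and s: "s \<in> {0..1 / real k}" "s' \<in> {0..1 / real k}" for k t s s'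
  proof -
    let ?\<phi> = "\<lambda>s. lattice_sum n R k g (t(j := s))"
    have der: "(?\<phi> has_real_derivative lattice_sum n R k h (t(j := s))) (at s)" for s
      unfolding lattice_sum_def
    proof (rule DERIV_sum)
      fix y
      have v: "vadd n y (t(j := r)) = (vadd n y t)(j := y j + r)" for r
        using j by (auto simp: vadd_def restrict_def fun_eq_iff)
      have "((\<lambda>r. g ((vadd n y (t(j := s)))(j := r))) has_real_derivative h (vadd n y (t(j := s)))) (at (y j + s))"
        using h(2)[of "vadd n y (t(j := s))"] j by (simp add: vadd_def)
      moreover have "((\<lambda>r. y j + r) has_real_derivative 1) (at s)" by (auto intro!: derivative_eq_intros)
      ultimately have "((\<lambda>r. g ((vadd n y (t(j := s)))(j := y j + r))) has_real_derivative h (vadd n y (t(j := s))) * 1) (at s)"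
        by (rule DERIV_chain2)
      then show "((\<lambda>r. g (vadd n y (t(j := r)))) has_real_derivative h (vadd n y (t(j := s)))) (at s)"
        by (simp add: v)
    qed
    \<comment> \<open>By equality at the endpoints, the derivative vanishes at \<open>c\<close>.\<close>
    obtain c where c: "0 < c" "c < 1 / real k" "?\<phi> (1 / real k) - ?\<phi> 0 = (1 / real k - 0) * lattice_sum n R k h (t(j := c))"
      using MVT2[of 0 "1 / real k" ?\<phi> "\<lambda>s. lattice_sum n R k h (t(j := s))"] der k by auto
    then have c0: "lattice_sum n R k h (t(j := c)) = 0"
      using lattice_sum_endpoints[OF Suc.prems(2) k j, of t] k by simp
    have "norm (?\<phi> s - ?\<phi> s') \<le> B * real k ^ n / real k ^ m * norm (s - s')"
    proof (rule field_differentiable_bound[where S = "{0..1 / real k}"])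
      fix z assume z: "z \<in> {0..1 / real k}"
      show "(?\<phi> has_real_derivative lattice_sum n R k h (t(j := z))) (at z within {0..1 / real k})"
        using der by (rule has_field_derivative_at_within)
      show "norm (lattice_sum n R k h (t(j := z))) \<le> B * real k ^ n / real k ^ m"
        using B(2)[rule_format, OF k z, of c t] c c0 by simp
    qed (use s in auto)
    also have "\<dots> \<le> B * real k ^ n / real k ^ m * (1 / real k)"
      using s B(1) by (intro mult_left_mono) (auto simp: abs_le_iff)
    finally show ?thesis by (simp add: mult.commute)
  qed
  with B(1) show ?case by (intro exI[of _ B] conjI allI impI ballI) blast+
qed

text \<open>
The coordinates of \<open>t\<close> are changed one at a time.
\<close>

lemma lattice_sum_near_origin:
  assumes g: "\<And>j. j < n \<Longrightarrow> C_along n j m (space_Rn n) g" "vanishes_outside n R g"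
  shows "\<exists>B\<ge>0. \<forall>k>0. \<forall>t\<in>lattice_cell n k.
    \<bar>lattice_sum n R k g t - lattice_sum n R k g (\<lambda>i\<in>{..<n}. 0)\<bar> \<le> B * real k ^ n / real k ^ m"
proof -
  have "\<forall>j\<in>{..<n}. \<exists>B\<ge>0. \<forall>k>0. \<forall>t. \<forall>s\<in>{0..1 / real k}. \<forall>s'\<in>{0..1 / real k}.
    \<bar>lattice_sum n R k g (t(j := s)) - lattice_sum n R k g (t(j := s'))\<bar> \<le> B * real k ^ n / real k ^ m"
    using lattice_sum_oscillation[OF g(1) g(2)] by simp
  from bchoice[OF this] obtain B where B: "\<And>j. j < n \<Longrightarrow> B j \<ge> 0"
    "\<And>j k t s s'. j < n \<Longrightarrow> k > 0 \<Longrightarrow> s \<in> {0..1 / real k} \<Longrightarrow> s' \<in> {0..1 / real k} \<Longrightarrow>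
    \<bar>lattice_sum n R k g (t(j := s)) - lattice_sum n R k g (t(j := s'))\<bar> \<le> B j * real k ^ n / real k ^ m"
    by (metis lessThan_iff)
  define u where "u l t = (\<lambda>i\<in>{..<n}. if i < l then t i else (0::real))" for l :: nat and t
  have "\<bar>lattice_sum n R k g (u l t) - lattice_sum n R k g (u 0 t)\<bar> \<le> (\<Sum>j<l. B j) * real k ^ n / real k ^ m"
    if k: "k > 0" and t: "t \<in> lattice_cell n k" and l: "l \<le> n" for k t l
    using l
  proof (induction l)
    case (Suc l)
    then have ln: "l < n" by simp
    have u: "u (Suc l) t = (u l t)(l := t l)" "u l t = (u l t)(l := 0)"
      using ln by (auto simp: u_def restrict_def fun_eq_iff)
    have "t l \<in> {0..<1 / real k}" using t ln unfolding lattice_cell_def by blast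
    then have "\<bar>lattice_sum n R k g ((u l t)(l := t l)) - lattice_sum n R k g ((u l t)(l := 0))\<bar> \<le> B l * real k ^ n / real k ^ m"
      by (intro B(2)[OF ln k]) auto
    then have "\<bar>lattice_sum n R k g (u (Suc l) t) - lattice_sum n R k g (u l t)\<bar> \<le> B l * real k ^ n / real k ^ m"
      using u by metis
    with Suc.IH ln show ?case by (simp add: distrib_right add_divide_distrib)
  qed (simp add: u_def)
  moreover have "u n t = t" if "t \<in> lattice_cell n k" for t k
    using that by (auto simp: u_def lattice_cell_def restrict_def PiE_iff extensional_def fun_eq_iff)
  moreover have "u 0 t = (\<lambda>i\<in>{..<n}. 0)" for t by (simp add: u_def)
  ultimately have "\<bar>lattice_sum n R k g t - lattice_sum n R k g (\<lambda>i\<in>{..<n}. 0)\<bar> \<le> (\<Sum>j<n. B j) * real k ^ n / real k ^ m"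
    if "k > 0" "t \<in> lattice_cell n k" for k t using that by (metis order_refl)
  moreover have "(\<Sum>j<n. B j) \<ge> 0" using B(1) by (intro sum_nonneg) auto
  ultimately show ?thesis by blast
qed

lemma lattice_sum_origin: "lattice_sum n R k g (\<lambda>i\<in>{..<n}. 0) = (\<Sum>y\<in>grid_box n (Suc R) k. g y)"
  unfolding lattice_sum_def
proof (intro sum.cong refl)
  fix y assume "y \<in> grid_box n (Suc R) k"
  then have "y \<in> extensional {..<n}" by (auto simp: grid_box_def grid_def PiE_iff)
  then have "vadd n y (\<lambda>i\<in>{..<n}. 0) = y" by (auto simp: vadd_def restrict_def extensional_def fun_eq_iff)
  then show "g (vadd n y (\<lambda>i\<in>{..<n}. 0)) = g y" by simp
qed

lemma nn_integral_lattice_sum: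
  assumes g: "g \<in> borel_measurable (lebesgue_Rn n)" "vanishes_outside n R g" and k: "k > 0"
    and pos: "\<And>x. g x \<ge> 0"
  shows "(\<integral>\<^sup>+x. ennreal (g x) \<partial>lebesgue_Rn n) =
    (\<integral>\<^sup>+t. ennreal (lattice_sum n R k g t) * indicator (lattice_cell n k) t \<partial>lebesgue_Rn n)"
proof -
  have "(\<integral>\<^sup>+x. ennreal (g x) \<partial>lebesgue_Rn n) = (\<integral>\<^sup>+t. (\<integral>\<^sup>+y. ennreal (g (vadd n y t)) \<partial>count_space (grid n k)) * indicator (lattice_cell n k) t \<partial>lebesgue_Rn n)"
    by (rule nn_integral_tiling[OF _ k]) (use g in measurable)
  also have "\<dots> = (\<integral>\<^sup>+t. ennreal (lattice_sum n R k g t) * indicator (lattice_cell n k) t \<partial>lebesgue_Rn n)"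
  proof (rule nn_integral_cong)
    fix t
    show "(\<integral>\<^sup>+y. ennreal (g (vadd n y t)) \<partial>count_space (grid n k)) * indicator (lattice_cell n k) t =
      ennreal (lattice_sum n R k g t) * indicator (lattice_cell n k) t"
    proof (cases "t \<in> lattice_cell n k")
      case True
      have "(\<integral>\<^sup>+y. ennreal (g (vadd n y t)) \<partial>count_space (grid n k)) = (\<Sum>y\<in>grid_box n (Suc R) k. ennreal (g (vadd n y t)))"
      proof (rule nn_integral_count_space')
        fix y assume y: "y \<in> grid n k" "y \<notin> grid_box n (Suc R) k"
        then obtain i where i: "i < n" "y i < - real (Suc R) \<or> real (Suc R) < y i"
          by (auto simp: grid_box_def cbox_Rn_def grid_def PiE_iff not_le)
        have "t i \<in> {0..<1 / real k}" using True i unfolding lattice_cell_def by blast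
        moreover have "1 / real k \<le> 1" using k by simp
        ultimately have "y i + t i < - real R \<or> real R < y i + t i" using i(2) by auto
        then have "vadd n y t i \<notin> {- real R..real R}" using i(1) by (auto simp: vadd_def)
        then have "vadd n y t \<notin> cube n R"
          using i(1) unfolding cbox_Rn_def by blast
        then show "ennreal (g (vadd n y t)) = 0" using g(2) by (simp add: vanishes_outside_def)
      next
        show "finite (grid_box n (Suc R) k)" by (rule finite_grid_box[OF k])
        show "grid_box n (Suc R) k \<subseteq> grid n k" unfolding grid_box_def by blast
      qed
      also have "\<dots> = ennreal (lattice_sum n R k g t)"
        unfolding lattice_sum_def by (rule sum_ennreal) (rule pos)
      finally show ?thesis by simp
    qed simp
  qed
  finally show ?thesis .
qed

text \<open>
The integral of \<open>g\<close> is the integral over the cell, which has volume \<open>1 / k\<^sup>n\<close>, of the lattice sum shifted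
by \<open>t\<close>. With \<open>n + 1\<close> derivatives all these shifted sums agree up to \<open>k\<^sup>n / k\<^bsup>n+1\<^esup> = 1 / k\<close>.
\<close>

theorem smooth_lattice_sum_asymptotics:
  assumes g: "\<And>j. j < n \<Longrightarrow> C_along n j (Suc n) (space_Rn n) g" "vanishes_outside n R g"
    and cont: "continuous_map (Rn n) euclideanreal g" and pos: "\<And>x. g x \<ge> 0"
  shows "\<exists>I\<ge>0. \<exists>B. (\<integral>\<^sup>+x. ennreal (g x) \<partial>lebesgue_Rn n) = ennreal I \<and>
    (\<forall>k>0. \<bar>(\<Sum>y\<in>grid_box n (Suc R) k. g y) - real k ^ n * I\<bar> \<le> B / real k)"
proof -
  obtain B where B: "B \<ge> 0" "\<And>k t. k > 0 \<Longrightarrow> t \<in> lattice_cell n k \<Longrightarrow>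
    \<bar>lattice_sum n R k g t - (\<Sum>y\<in>grid_box n (Suc R) k. g y)\<bar> \<le> B * real k ^ n / real k ^ Suc n"
    using lattice_sum_near_origin[OF g] unfolding lattice_sum_origin by blast
  define S where "S k = (\<Sum>y\<in>grid_box n (Suc R) k. g y)" for k
  define J where "J = (\<integral>\<^sup>+x. ennreal (g x) \<partial>lebesgue_Rn n)"
  have const: "(\<integral>\<^sup>+t. ennreal c * indicator (lattice_cell n k) t \<partial>lebesgue_Rn n) = ennreal (c / real k ^ n)" if "k > 0" "c \<ge> 0" for c k
    using that by (simp add: nn_integral_cmult_indicator emeasure_lattice_cell ennreal_mult[symmetric])
  have near: "\<bar>lattice_sum n R k g t - S k\<bar> \<le> B / real k" if "k > 0" "t \<in> lattice_cell n k" for k t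
    using B(2)[OF that] that(1) by (simp add: S_def)
  have J: "J = (\<integral>\<^sup>+t. ennreal (lattice_sum n R k g t) * indicator (lattice_cell n k) t \<partial>lebesgue_Rn n)" if "k > 0" for k
    unfolding J_def by (rule nn_integral_lattice_sum[OF measurable_continuous_Rn[OF cont] g(2) that pos])
  have S0: "S k \<ge> 0" for k unfolding S_def by (intro sum_nonneg pos)
  have upper: "J \<le> ennreal ((S k + B / real k) / real k ^ n)" if k: "k > 0" for k
  proof -
    have "J \<le> (\<integral>\<^sup>+t. ennreal (S k + B / real k) * indicator (lattice_cell n k) t \<partial>lebesgue_Rn n)"
      unfolding J[OF k]
    proof (rule nn_integral_mono)
      fix t show "ennreal (lattice_sum n R k g t) * indicator (lattice_cell n k) t \<le> ennreal (S k + B / real k) * indicator (lattice_cell n k) t"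
        using near[OF k, of t] by (cases "t \<in> lattice_cell n k") (auto intro!: ennreal_leI)
    qed
    then show ?thesis using const[OF k, of "S k + B / real k"] S0[of k] B(1) k by simp
  qed
  have lower: "ennreal (max 0 (S k - B / real k) / real k ^ n) \<le> J" if k: "k > 0" for k
  proof -
    have "(\<integral>\<^sup>+t. ennreal (max 0 (S k - B / real k)) * indicator (lattice_cell n k) t \<partial>lebesgue_Rn n) \<le> J"
      unfolding J[OF k]
    proof (rule nn_integral_mono)
      fix t
      have "lattice_sum n R k g t \<ge> 0" unfolding lattice_sum_def by (intro sum_nonneg pos)
      then show "ennreal (max 0 (S k - B / real k)) * indicator (lattice_cell n k) t \<le> ennreal (lattice_sum n R k g t) * indicator (lattice_cell n k) t"
        using near[OF k, of t] by (cases "t \<in> lattice_cell n k") (auto intro!: ennreal_leI)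
    qed
    then show ?thesis using const[OF k, of "max 0 (S k - B / real k)"] by simp
  qed
  obtain I where I: "I \<ge> 0" "J = ennreal I"
  proof -
    have "J < top" using upper[of 1] by (meson ennreal_less_top le_less_trans zero_less_one)
    then show thesis using that by (cases J) auto
  qed
  have "\<bar>S k - real k ^ n * I\<bar> \<le> B / real k" if k: "k > 0" for k
  proof -
    have kn: "real k ^ n > 0" using k by simp
    have "I \<le> (S k + B / real k) / real k ^ n"
      using upper[OF k] S0[of k] B(1) k unfolding I(2) by (subst (asm) ennreal_le_iff) auto
    moreover have "max 0 (S k - B / real k) / real k ^ n \<le> I"
      using lower[OF k] I by (simp add: I(2) ennreal_le_iff)
    ultimately have "real k ^ n * I \<le> S k + B / real k" "max 0 (S k - B / real k) \<le> real k ^ n * I"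
      using kn by (simp_all add: pos_le_divide_eq pos_divide_le_eq mult.commute)
    then show ?thesis by (simp add: abs_le_iff)
  qed
  with I show ?thesis unfolding J_def S_def by blast
qed

section \<open>Charts and lattice points of integral affine manifolds\<close>

lemma Zn_eq_grid: "Zn n = grid n 1"
  by (simp add: Zn_def grid_def)

lemma openin_finite_Inter:
  assumes "finite J" "\<And>j. j \<in> J \<Longrightarrow> openin X (N j)" "openin X W"
  shows "openin X (W \<inter> (\<Inter>j\<in>J. N j))"
  using assms(1,2)
proof (induction J rule: finite_induct)
  case (insert x J)
  have "W \<inter> (\<Inter>j\<in>insert x J. N j) = N x \<inter> (W \<inter> (\<Inter>j\<in>J. N j))" by auto
  then show ?case using insert by (auto intro: openin_Int)
qed (use assms(3) in simp)

locale integral_affine_manifold =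
  fixes n :: nat and M :: "'a topology" and \<A> :: "'a chart set"
  assumes manifold: "int_affine_manifold n M \<A>"
begin

lemma hausdorff: "Hausdorff_space M"
  using manifold by (simp add: int_affine_manifold_def)

lemma atlas: "int_affine_atlas n M \<A>"
  using manifold by (simp add: int_affine_manifold_def int_affine_structure_def)

lemma atlas_cover: "(\<Union>c\<in>\<A>. fst c) = topspace M"
  using atlas by (simp add: int_affine_atlas_def)

lemma chart:
  assumes "(U, \<phi>) \<in> \<A>"
  shows "openin M U" "U \<subseteq> topspace M" "openin (Rn n) (\<phi> ` U)"
    "homeomorphic_map (subtopology M U) (subtopology (Rn n) (\<phi> ` U)) \<phi>" "inj_on \<phi> U"
    "\<And>x. x \<in> U \<Longrightarrow> \<phi> x \<in> space_Rn n"
proof -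
  have c: "is_chart n M (U, \<phi>)" using atlas assms unfolding int_affine_atlas_def by blast
  then show 1: "openin M U" "openin (Rn n) (\<phi> ` U)"
    and h: "homeomorphic_map (subtopology M U) (subtopology (Rn n) (\<phi> ` U)) \<phi>"
    by (auto simp: is_chart_def)
  show U: "U \<subseteq> topspace M" using 1 openin_subset by blast
  then show "inj_on \<phi> U" using homeomorphic_imp_injective_map[OF h] by (simp add: inf.absorb2)
  show "\<phi> x \<in> space_Rn n" if "x \<in> U" for x
    using openin_subset[OF 1(2)] that unfolding topspace_Rn by blast
qed

lemma chart_open_image:
  assumes "(U, \<phi>) \<in> \<A>" "openin M W" "W \<subseteq> U"
  shows "openin (Rn n) (\<phi> ` W)"
proof -
  have "openin (subtopology M U) W" using assms chart(1) by (simp add: openin_open_subtopology)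
  then have "openin (subtopology (Rn n) (\<phi> ` U)) (\<phi> ` W)"
    using homeomorphic_imp_open_map[OF chart(4)[OF assms(1)]] by (simp add: open_map_def)
  then show ?thesis using chart(3)[OF assms(1)] by (simp add: openin_open_subtopology)
qed

lemma chart_open_vimage:
  assumes "(U, \<phi>) \<in> \<A>" "openin (Rn n) V"
  shows "openin M {x \<in> U. \<phi> x \<in> V}"
proof -
  have "continuous_map (subtopology M U) (subtopology (Rn n) (\<phi> ` U)) \<phi>"
    using homeomorphic_imp_continuous_map[OF chart(4)[OF assms(1)]] .
  then have "continuous_map (subtopology M U) (Rn n) \<phi>" by (simp add: continuous_map_in_subtopology)
  from openin_continuous_map_preimage[OF this assms(2)]
  have "openin (subtopology M U) {x \<in> U. \<phi> x \<in> V}"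
    using chart(2)[OF assms(1)] by (simp add: inf.absorb2)
  then show ?thesis using chart(1)[OF assms(1)] by (simp add: openin_open_subtopology)
qed

lemma chart_compact_vimage:
  assumes "(U, \<phi>) \<in> \<A>" "compactin (Rn n) K" "K \<subseteq> \<phi> ` U"
  shows "closedin M {x \<in> U. \<phi> x \<in> K}"
proof -
  have img: "\<phi> ` {x \<in> U. \<phi> x \<in> K} = K" using assms(3) by auto
  have "compactin (subtopology (Rn n) (\<phi> ` U)) (\<phi> ` {x \<in> U. \<phi> x \<in> K})"
    unfolding img using assms(2,3) by (simp add: compactin_subtopology)
  then have "compactin (subtopology M U) {x \<in> U. \<phi> x \<in> K}"
    using homeomorphic_map_compactness[OF chart(4)[OF assms(1)]] chart(2)[OF assms(1)] by (auto simp: inf.absorb2)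
  then have "compactin M {x \<in> U. \<phi> x \<in> K}" by (simp add: compactin_subtopology)
  then show ?thesis using hausdorff compactin_imp_closedin by blast
qed

lemma transition:
  assumes "(U, \<phi>) \<in> \<A>" "(V, \<psi>) \<in> \<A>"
  shows "locally_int_affine n (\<phi> ` (U \<inter> V)) (\<psi> \<circ> inv_into U \<phi>)"
proof -
  have "\<forall>(U, \<phi>)\<in>\<A>. \<forall>(V, \<psi>)\<in>\<A>. locally_int_affine n (\<phi> ` (U \<inter> V)) (\<psi> \<circ> inv_into U \<phi>)"
    using atlas by (simp add: int_affine_atlas_def)
  from bspec[OF bspec[OF this assms(1), unfolded prod.case] assms(2)] show ?thesis by simp
qed

lemma transition_local:
  assumes c: "(U, \<phi>) \<in> \<A>" "(V, \<psi>) \<in> \<A>" and x: "x \<in> U" "x \<in> V"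
  shows "\<exists>N g. openin (Rn n) N \<and> \<phi> x \<in> N \<and> N \<subseteq> \<phi> ` U \<and> g \<in> Aff_int n \<and>
    (\<forall>z\<in>U. \<phi> z \<in> N \<longrightarrow> z \<in> V \<and> \<psi> z = g (\<phi> z))"
proof -
  have "\<phi> x \<in> \<phi> ` (U \<inter> V)" using x by blast
  then obtain N g where N: "openin (Rn n) N" "\<phi> x \<in> N" "N \<subseteq> \<phi> ` (U \<inter> V)" "g \<in> Aff_int n"
    "\<forall>y\<in>N. (\<psi> \<circ> inv_into U \<phi>) y = g y"
    using transition[OF c] unfolding locally_int_affine_def by blast
  have "z \<in> V \<and> \<psi> z = g (\<phi> z)" if z: "z \<in> U" "\<phi> z \<in> N" for z
  proof
    obtain z' where "z' \<in> U \<inter> V" "\<phi> z = \<phi> z'" using N(3) z by blast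
    then show "z \<in> V" using inj_onD[OF chart(5)[OF c(1)]] z(1) by blast
    show "\<psi> z = g (\<phi> z)" using N(5)[rule_format, OF z(2)] z(1) chart(5)[OF c(1)] by (simp add: inv_into_f_f)
  qed
  moreover have "N \<subseteq> \<phi> ` U" using N(3) by blast
  ultimately show ?thesis using N(1,2,4) by (intro exI[of _ N] exI[of _ g] conjI ballI impI) simp_all
qed

definition lattice_points :: "nat \<Rightarrow> 'a set" where
  "lattice_points k = {x \<in> topspace M. \<exists>(U, \<psi>)\<in>\<A>. x \<in> U \<and> \<psi> x \<in> grid n k}"

text \<open>
Integral affine maps preserve the lattice, so any chart around the point can be used.
\<close>

lemma lattice_points_chart:
  assumes "(U, \<phi>) \<in> \<A>" "x \<in> U" "k > 0"
  shows "x \<in> lattice_points k \<longleftrightarrow> \<phi> x \<in> grid n k"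
proof
  assume "x \<in> lattice_points k"
  then obtain V \<psi> where V: "(V, \<psi>) \<in> \<A>" "x \<in> V" "\<psi> x \<in> grid n k" unfolding lattice_points_def by blast
  obtain g where g: "g \<in> Aff_int n" "\<psi> x = g (\<phi> x)" using transition_local[OF assms(1) V(1) assms(2) V(2)] assms(2) by blast
  then show "\<phi> x \<in> grid n k" using Aff_int_grid[OF g(1) chart(6)[OF assms(1,2)] assms(3)] V(3) by simp
next
  assume "\<phi> x \<in> grid n k"
  then show "x \<in> lattice_points k" using assms chart(2) unfolding lattice_points_def by blast
qed

lemma integral_points_eq: "integral_points n M \<A> = lattice_points 1"
  unfolding integral_points_def lattice_points_def Zn_eq_grid ..

lemma finite_box_cover_exists:
  assumes "compact_space M"
  shows "\<exists>(m::nat) U \<phi> a b. (\<forall>i<m. (U i, \<phi> i) \<in> \<A> \<and> a i \<in> rational_points n \<and> b i \<in> rational_points n \<and>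
     cbox_Rn n (a i) (b i) \<subseteq> \<phi> i ` U i) \<and> topspace M = (\<Union>i<m. {x \<in> U i. \<phi> i x \<in> obox n (a i) (b i)})"
proof -
  have "\<exists>U \<phi> a b. (U, \<phi>) \<in> \<A> \<and> a \<in> rational_points n \<and> b \<in> rational_points n \<and>
     cbox_Rn n a b \<subseteq> \<phi> ` U \<and> x \<in> U \<and> \<phi> x \<in> obox n a b" if x: "x \<in> topspace M" for x
  proof -
    from x atlas_cover obtain U \<phi> where U: "(U, \<phi>) \<in> \<A>" "x \<in> U" by fastforce
    from obox_nbhd[OF chart(3)[OF U(1)], of "\<phi> x"] U(2) obtain a b where
      "a \<in> rational_points n" "b \<in> rational_points n" "\<phi> x \<in> obox n a b" "cbox_Rn n a b \<subseteq> \<phi> ` U" by blast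
    with U show ?thesis by blast
  qed
  then obtain U \<phi> a b where d: "\<And>x. x \<in> topspace M \<Longrightarrow> (U x, \<phi> x) \<in> \<A> \<and> a x \<in> rational_points n \<and> b x \<in> rational_points n \<and>
     cbox_Rn n (a x) (b x) \<subseteq> \<phi> x ` U x \<and> x \<in> U x \<and> \<phi> x x \<in> obox n (a x) (b x)" by metis
  define W where "W x = {z \<in> U x. \<phi> x z \<in> obox n (a x) (b x)}" for x
  have "openin M (W x)" if "x \<in> topspace M" for x
    unfolding W_def using d[OF that] by (intro chart_open_vimage openin_obox) blast
  moreover have "topspace M \<subseteq> \<Union>(W ` topspace M)" using d by (auto simp: W_def)
  ultimately obtain F where F: "finite F" "F \<subseteq> W ` topspace M" "topspace M \<subseteq> \<Union>F"
    using assms unfolding compact_space_alt by (metis (no_types, lifting) imageE)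
  obtain X where X: "X \<subseteq> topspace M" "finite X" "F = W ` X" using finite_subset_image[OF F(1,2)] by blast
  obtain e where e: "bij_betw e {0..<card X} X" using ex_bij_betw_nat_finite[OF X(2)] by blast
  have eX: "e i \<in> topspace M" if "i < card X" for i using bij_betwE[OF e] X(1) that by auto
  have "W x \<subseteq> topspace M" if "x \<in> topspace M" for x using d[OF that] chart(2) by (auto simp: W_def)
  then have WX: "\<Union>(W ` X) = topspace M" using F(3) X by blast
  have eq: "e ` {..<card X} = X" using e by (simp add: bij_betw_def atLeast0LessThan)
  have "topspace M = \<Union>(W ` (e ` {..<card X}))" unfolding eq WX ..
  then have "topspace M = (\<Union>i<card X. W (e i))" by (simp only: image_image)
  then show ?thesis
    using d eX by (intro exI[of _ "card X"] exI[of _ "\<lambda>i. U (e i)"] exI[of _ "\<lambda>i. \<phi> (e i)"]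
      exI[of _ "\<lambda>i. a (e i)"] exI[of _ "\<lambda>i. b (e i)"]) (simp add: W_def)
qed

end

section \<open>Rational polyhedral pieces of a compact manifold\<close>

locale finite_box_cover = integral_affine_manifold n M \<A> for n :: nat and M :: "'a topology" and \<A> +
  fixes m :: nat and U :: "nat \<Rightarrow> 'a set" and \<phi> :: "nat \<Rightarrow> 'a \<Rightarrow> nat \<Rightarrow> real" and a b :: "nat \<Rightarrow> nat \<Rightarrow> real"
  assumes charts: "i < m \<Longrightarrow> (U i, \<phi> i) \<in> \<A>"
    and rational: "i < m \<Longrightarrow> a i \<in> rational_points n" "i < m \<Longrightarrow> b i \<in> rational_points n"
    and boxes: "i < m \<Longrightarrow> cbox_Rn n (a i) (b i) \<subseteq> \<phi> i ` U i"
    and cover: "topspace M = (\<Union>i<m. {x \<in> U i. \<phi> i x \<in> obox n (a i) (b i)})"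
begin

definition patch :: "nat \<Rightarrow> 'a set" where
  "patch i = {x \<in> U i. \<phi> i x \<in> obox n (a i) (b i)}"

lemma patch_cover: "topspace M = (\<Union>i<m. patch i)"
  using cover by (simp add: patch_def)

lemma image_patch: "i < m \<Longrightarrow> \<phi> i ` patch i = obox n (a i) (b i)"
  using boxes obox_subset_cbox unfolding patch_def by blast

text \<open>
If \<open>y\<close> comes from a point of \<open>U j\<close>, the transition map is affine near it. Otherwise the closed box in
\<open>U j\<close> is compact, hence closed in the Hausdorff space \<open>M\<close>, and misses that point together with a
neighbourhood.
\<close>

lemma local_form:
  assumes i: "i < m" and j: "j < m" and y: "y \<in> \<phi> i ` U i"
  shows "\<exists>N. openin (Rn n) N \<and> y \<in> N \<and> N \<subseteq> \<phi> i ` U i \<and>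
    ((\<forall>x\<in>U i. \<phi> i x \<in> N \<longrightarrow> x \<notin> patch j) \<or>
     (\<exists>g\<in>Aff_int n. \<forall>x\<in>U i. \<phi> i x \<in> N \<longrightarrow> x \<in> U j \<and> \<phi> j x = g (\<phi> i x)))"
proof -
  from y obtain x where x: "x \<in> U i" "y = \<phi> i x" by blast
  show ?thesis
  proof (cases "x \<in> U j")
    case True
    from transition_local[OF charts[OF i] charts[OF j] x(1) True] show ?thesis unfolding x(2) by blast
  next
    case False
    define C where "C = {x \<in> U j. \<phi> j x \<in> cbox_Rn n (a j) (b j)}"
    have "closedin M C" unfolding C_def by (rule chart_compact_vimage[OF charts[OF j] compactin_cbox boxes[OF j]])
    then have "openin M (U i - C)" using chart(1)[OF charts[OF i]] by (rule openin_diff[rotated])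
    then have "openin (Rn n) (\<phi> i ` (U i - C))" using chart_open_image[OF charts[OF i]] by blast
    moreover have "y \<in> \<phi> i ` (U i - C)" using x False by (auto simp: C_def)
    moreover have "z \<notin> patch j" if "z \<in> U i" "\<phi> i z \<in> \<phi> i ` (U i - C)" for z
    proof -
      have "z \<in> U i - C" using that inj_onD[OF chart(5)[OF charts[OF i]]] by blast
      then show ?thesis using obox_subset_cbox by (auto simp: C_def patch_def)
    qed
    ultimately show ?thesis by (intro exI[of _ "\<phi> i ` (U i - C)"]) blast
  qed
qed

lemma local_form_all:
  assumes i: "i < m" and y: "y \<in> \<phi> i ` U i"
  shows "\<exists>N. openin (Rn n) N \<and> y \<in> N \<and> N \<subseteq> \<phi> i ` U i \<and> (\<forall>j<m.
    (\<forall>x\<in>U i. \<phi> i x \<in> N \<longrightarrow> x \<notin> patch j) \<or>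
     (\<exists>g\<in>Aff_int n. \<forall>x\<in>U i. \<phi> i x \<in> N \<longrightarrow> x \<in> U j \<and> \<phi> j x = g (\<phi> i x)))"
proof -
  have "\<forall>j\<in>{..<m}. \<exists>N. openin (Rn n) N \<and> y \<in> N \<and> N \<subseteq> \<phi> i ` U i \<and>
    ((\<forall>x\<in>U i. \<phi> i x \<in> N \<longrightarrow> x \<notin> patch j) \<or>
     (\<exists>g\<in>Aff_int n. \<forall>x\<in>U i. \<phi> i x \<in> N \<longrightarrow> x \<in> U j \<and> \<phi> j x = g (\<phi> i x)))"
    using local_form[OF i _ y] by blast
  from bchoice[OF this] obtain N where N: "\<And>j. j < m \<Longrightarrow> openin (Rn n) (N j) \<and> y \<in> N j \<and> N j \<subseteq> \<phi> i ` U i \<and>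
    ((\<forall>x\<in>U i. \<phi> i x \<in> N j \<longrightarrow> x \<notin> patch j) \<or>
     (\<exists>g\<in>Aff_int n. \<forall>x\<in>U i. \<phi> i x \<in> N j \<longrightarrow> x \<in> U j \<and> \<phi> j x = g (\<phi> i x)))" by blast
  have 1: "openin (Rn n) (\<phi> i ` U i \<inter> (\<Inter>j\<in>{..<m}. N j))"
    by (rule openin_finite_Inter) (use N chart(3)[OF charts[OF i]] in auto)
  show ?thesis
  proof (intro exI[of _ "\<phi> i ` U i \<inter> (\<Inter>j\<in>{..<m}. N j)"] conjI allI impI 1)
    fix j assume j: "j < m"
    then have "\<phi> i ` U i \<inter> (\<Inter>j\<in>{..<m}. N j) \<subseteq> N j" by blast
    then show "(\<forall>x\<in>U i. \<phi> i x \<in> \<phi> i ` U i \<inter> (\<Inter>j\<in>{..<m}. N j) \<longrightarrow> x \<notin> patch j) \<or>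
     (\<exists>g\<in>Aff_int n. \<forall>x\<in>U i. \<phi> i x \<in> \<phi> i ` U i \<inter> (\<Inter>j\<in>{..<m}. N j) \<longrightarrow> x \<in> U j \<and> \<phi> j x = g (\<phi> i x))"
      using N[OF j] by (elim conjE disjE) (blast, meson subsetD)
  qed (use N y in auto)
qed

definition piece :: "nat \<Rightarrow> 'a set" where
  "piece i = patch i - (\<Union>j<i. patch j)"

lemma piece_image_subset: "i < m \<Longrightarrow> \<phi> i ` piece i \<subseteq> obox n (a i) (b i)"
  using image_patch unfolding piece_def by blast

text \<open>
The closed box is compact, so it is covered by finitely many small rational boxes on each of which
every other patch is either absent or described through a single integral affine map, hence by
rational inequalities.
\<close>

lemma definable_piece:
  assumes i: "i < m"
  shows "definable n (\<phi> i ` piece i)"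
proof -
  let ?K = "cbox_Rn n (a i) (b i)"
  have inj: "inj_on (\<phi> i) (U i)" by (rule chart(5)[OF charts[OF i]])
  have "\<exists>c d. c \<in> rational_points n \<and> d \<in> rational_points n \<and> y \<in> obox n c d \<and> definable n (\<phi> i ` piece i \<inter> obox n c d)"
    if y: "y \<in> ?K" for y
  proof -
    have "y \<in> \<phi> i ` U i" using boxes[OF i] y by blast
    from local_form_all[OF i this] obtain N where N: "openin (Rn n) N" "y \<in> N" "N \<subseteq> \<phi> i ` U i"
      "\<And>j. j < m \<Longrightarrow> (\<forall>x\<in>U i. \<phi> i x \<in> N \<longrightarrow> x \<notin> patch j) \<or>
     (\<exists>g\<in>Aff_int n. \<forall>x\<in>U i. \<phi> i x \<in> N \<longrightarrow> x \<in> U j \<and> \<phi> j x = g (\<phi> i x))" by blast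
    obtain c d where cd: "c \<in> rational_points n" "d \<in> rational_points n" "y \<in> obox n c d" "cbox_Rn n c d \<subseteq> N"
      using obox_nbhd[OF N(1,2)] .
    then have CN: "obox n c d \<subseteq> N" using obox_subset_cbox by blast
    have "\<exists>T. definable n T \<and> (\<forall>x\<in>U i. \<phi> i x \<in> obox n c d \<longrightarrow> (x \<in> patch j \<longleftrightarrow> \<phi> i x \<in> T))" if j: "j < m" for j
      using N(4)[OF j]
    proof
      assume "\<forall>x\<in>U i. \<phi> i x \<in> N \<longrightarrow> x \<notin> patch j"
      then show ?thesis using CN definable_Compl[OF definable_UNIV] by (intro exI[of _ "{}"]) auto
    next
      assume "\<exists>g\<in>Aff_int n. \<forall>x\<in>U i. \<phi> i x \<in> N \<longrightarrow> x \<in> U j \<and> \<phi> j x = g (\<phi> i x)"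
      then obtain A v where g: "\<And>x. x \<in> U i \<Longrightarrow> \<phi> i x \<in> N \<Longrightarrow> x \<in> U j \<and> \<phi> j x = affine_map n A v (\<phi> i x)"
        unfolding Aff_int_def by blast
      have "definable n {y. affine_map n A v y \<in> obox n (a j) (b j)}"
        by (rule definable_affine_preimage[OF rational[OF j]])
      then show ?thesis using g CN by (intro exI[of _ "{y. affine_map n A v y \<in> obox n (a j) (b j)}"]) (auto simp: patch_def)
    qed
    then obtain T where T: "\<And>j. j < m \<Longrightarrow> definable n (T j)"
      "\<And>j x. j < m \<Longrightarrow> x \<in> U i \<Longrightarrow> \<phi> i x \<in> obox n c d \<Longrightarrow> x \<in> patch j \<longleftrightarrow> \<phi> i x \<in> T j" by metis
    have "\<phi> i ` piece i \<inter> obox n c d = obox n c d \<inter> (obox n (a i) (b i) \<inter> (\<Inter>j\<in>{..<i}. - T j))"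
    proof (intro equalityI subsetI)
      fix z assume "z \<in> \<phi> i ` piece i \<inter> obox n c d"
      then obtain x where x: "x \<in> piece i" "z = \<phi> i x" "\<phi> i x \<in> obox n c d" by blast
      then have "x \<in> U i" "\<phi> i x \<in> obox n (a i) (b i)" by (auto simp: piece_def patch_def)
      moreover have "\<phi> i x \<notin> T j" if "j < i" for j
        using T(2)[of j x] that x i \<open>x \<in> U i\<close> by (auto simp: piece_def)
      ultimately show "z \<in> obox n c d \<inter> (obox n (a i) (b i) \<inter> (\<Inter>j\<in>{..<i}. - T j))" using x by auto
    next
      fix z assume z: "z \<in> obox n c d \<inter> (obox n (a i) (b i) \<inter> (\<Inter>j\<in>{..<i}. - T j))"
      then obtain x where x: "x \<in> patch i" "z = \<phi> i x" using image_patch[OF i] by blast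
      then have "x \<in> U i" by (simp add: patch_def)
      moreover have "x \<notin> patch j" if "j < i" for j
        using T(2)[of j x] that x i z \<open>x \<in> U i\<close> by auto
      ultimately show "z \<in> \<phi> i ` piece i \<inter> obox n c d" using x z by (auto simp: piece_def)
    qed
    moreover have "definable n (obox n c d \<inter> (obox n (a i) (b i) \<inter> (\<Inter>j\<in>{..<i}. - T j)))"
      using i by (intro definable_Int definable_INT definable_obox cd rational definable_Compl T) auto
    ultimately show ?thesis using cd by (intro exI[of _ c] exI[of _ d]) simp
  qed
  then obtain c d where cd: "\<And>y. y \<in> ?K \<Longrightarrow> y \<in> obox n (c y) (d y) \<and> definable n (\<phi> i ` piece i \<inter> obox n (c y) (d y))"
    by metis
  have "\<forall>C\<in>(\<lambda>y. obox n (c y) (d y)) ` ?K. openin (Rn n) C" using openin_obox by blast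
  moreover have "?K \<subseteq> \<Union>((\<lambda>y. obox n (c y) (d y)) ` ?K)" using cd by blast
  ultimately obtain F where F: "finite F" "F \<subseteq> (\<lambda>y. obox n (c y) (d y)) ` ?K" "?K \<subseteq> \<Union>F"
    using compactin_cbox[of n "a i" "b i"] unfolding compactin_def by (metis (no_types, lifting))
  obtain Y where Y: "Y \<subseteq> ?K" "finite Y" "F = (\<lambda>y. obox n (c y) (d y)) ` Y"
    using finite_subset_image[OF F(1,2)] by blast
  have "\<phi> i ` piece i \<subseteq> ?K" using piece_image_subset[OF i] obox_subset_cbox by blast
  then have "\<phi> i ` piece i = (\<Union>y\<in>Y. \<phi> i ` piece i \<inter> obox n (c y) (d y))"
    using F(3) Y by blast
  moreover have "definable n (\<Union>y\<in>Y. \<phi> i ` piece i \<inter> obox n (c y) (d y))"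
    using Y cd by (intro definable_UN) auto
  ultimately show ?thesis by simp
qed

lemma patch_radius: "\<exists>R::nat. \<forall>i<m. cbox_Rn n (a i) (b i) \<subseteq> cube n R"
proof -
  obtain R :: nat where R: "(\<Sum>i<m. \<Sum>l<n. \<bar>a i l\<bar> + \<bar>b i l\<bar>) \<le> real R" using real_arch_simple by blast
  have "\<bar>a i l\<bar> + \<bar>b i l\<bar> \<le> real R" if "i < m" "l < n" for i l
  proof -
    have "\<bar>a i l\<bar> + \<bar>b i l\<bar> \<le> (\<Sum>l<n. \<bar>a i l\<bar> + \<bar>b i l\<bar>)" using that by (intro member_le_sum) auto
    also have "\<dots> \<le> (\<Sum>i<m. \<Sum>l<n. \<bar>a i l\<bar> + \<bar>b i l\<bar>)" using that by (intro member_le_sum[where f = "\<lambda>i. \<Sum>l<n. \<bar>a i l\<bar> + \<bar>b i l\<bar>"] sum_nonneg) auto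
    finally show ?thesis using R by linarith
  qed
  then have "cbox_Rn n (a i) (b i) \<subseteq> cube n R" if "i < m" for i
    unfolding cbox_Rn_def using that by (intro PiE_mono) (fastforce simp: abs_le_iff)
  then show ?thesis by blast
qed

lemma piece_cover: "topspace M = (\<Union>i<m. piece i)"
proof (intro equalityI subsetI)
  fix x assume "x \<in> topspace M"
  then have ex: "\<exists>i. i < m \<and> x \<in> patch i" using patch_cover by blast
  define i where "i = (LEAST i. i < m \<and> x \<in> patch i)"
  have "i < m \<and> x \<in> patch i" unfolding i_def using ex by (rule LeastI_ex)
  moreover have "\<not> (j < m \<and> x \<in> patch j)" if "j < i" for j using that unfolding i_def by (rule not_less_Least)
  ultimately show "x \<in> (\<Union>i<m. piece i)" by (auto simp: piece_def intro!: bexI[of _ i])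
next
  fix x assume "x \<in> (\<Union>i<m. piece i)"
  then show "x \<in> topspace M" using patch_cover by (auto simp: piece_def)
qed

lemma piece_disjoint: "i \<noteq> j \<Longrightarrow> piece i \<inter> piece j = {}"
  by (cases i j rule: linorder_cases) (auto simp: piece_def)

lemma piece_lattice_points:
  assumes "i < m" "k > 0"
  shows "bij_betw (\<phi> i) (piece i \<inter> lattice_points k) (\<phi> i ` piece i \<inter> grid n k)"
proof -
  have pU: "piece i \<subseteq> U i" by (auto simp: piece_def patch_def)
  have "inj_on (\<phi> i) (piece i \<inter> lattice_points k)"
    using chart(5)[OF charts[OF assms(1)]] pU by (meson Int_lower1 inj_on_subset order_trans)
  moreover have "\<phi> i ` (piece i \<inter> lattice_points k) = \<phi> i ` piece i \<inter> grid n k"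
    using lattice_points_chart[OF charts[OF assms(1)] _ assms(2)] pU by blast
  ultimately show ?thesis by (simp add: bij_betw_def)
qed

lemma lattice_points_pieces: "lattice_points k = (\<Union>i<m. piece i \<inter> lattice_points k)"
  using piece_cover unfolding lattice_points_def by blast

lemma finite_piece_lattice_points:
  assumes "i < m" "k > 0"
  shows "finite (piece i \<inter> lattice_points k)"
proof -
  obtain R where "cbox_Rn n (a i) (b i) \<subseteq> cube n R" using patch_radius assms(1) by blast
  then have "\<phi> i ` piece i \<inter> grid n k \<subseteq> grid_box n R k"
    using piece_image_subset[OF assms(1)] obox_subset_cbox unfolding grid_box_def by blast
  then have "finite (\<phi> i ` piece i \<inter> grid n k)" using finite_grid_box[OF assms(2)] finite_subset by blast
  then show ?thesis using bij_betw_finite[OF piece_lattice_points[OF assms]] by simp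
qed

lemma finite_lattice_points: "k > 0 \<Longrightarrow> finite (lattice_points k)"
  by (subst lattice_points_pieces, rule finite_UN_I[OF finite_lessThan]) (simp add: finite_piece_lattice_points)

lemma card_lattice_points:
  assumes "k > 0"
  shows "card (lattice_points k) = (\<Sum>i<m. card (\<phi> i ` piece i \<inter> grid n k))"
proof -
  have "card (lattice_points k) = (\<Sum>i<m. card (piece i \<inter> lattice_points k))"
    by (subst lattice_points_pieces, rule card_UN_disjoint)
      (use finite_piece_lattice_points[OF _ assms] piece_disjoint in blast)+
  also have "\<dots> = (\<Sum>i<m. card (\<phi> i ` piece i \<inter> grid n k))"
    by (intro sum.cong refl bij_betw_same_card[OF piece_lattice_points[OF _ assms]]) auto
  finally show ?thesis .
qed

text \<open>
The step \<open>Q\<close> is a common multiple of the steps that Ehrhart's theorem gives for the pieces.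
\<close>

theorem card_lattice_points_polynomial:
  "\<exists>q>0. \<exists>p. \<forall>j. real (card (lattice_points (1 + q * j))) = poly p (real j)"
proof -
  obtain R where R: "\<And>i. i < m \<Longrightarrow> cbox_Rn n (a i) (b i) \<subseteq> cube n R" using patch_radius by blast
  have "\<forall>i\<in>{..<m}. \<exists>q>0. \<forall>l. \<exists>p. \<forall>j. real (card (\<phi> i ` piece i \<inter> grid n (1 + q * l * j))) = poly p (real j)"
  proof
    fix i assume "i \<in> {..<m}"
    then have i: "i < m" by simp
    have "\<phi> i ` piece i \<subseteq> cube n R"
      using piece_image_subset[OF i] obox_subset_cbox R[OF i] by blast
    from Ehrhart_quasi_polynomial[OF definable_piece[OF i] this]
    show "\<exists>q>0. \<forall>l. \<exists>p. \<forall>j. real (card (\<phi> i ` piece i \<inter> grid n (1 + q * l * j))) = poly p (real j)" .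
  qed
  from bchoice[OF this] obtain q where q: "\<And>i. i < m \<Longrightarrow> q i > 0"
    "\<And>i l. i < m \<Longrightarrow> \<exists>p. \<forall>j. real (card (\<phi> i ` piece i \<inter> grid n (1 + q i * l * j))) = poly p (real j)" by blast
  define Q where "Q = (\<Prod>i<m. q i)"
  have "\<exists>p. \<forall>j. real (card (\<phi> i ` piece i \<inter> grid n (1 + Q * j))) = poly p (real j)" if i: "i < m" for i
  proof -
    have "Q = q i * (\<Prod>j\<in>{..<m} - {i}. q j)" unfolding Q_def using i by (subst prod.remove[of _ i]) auto
    then show ?thesis using q(2)[OF i, of "\<Prod>j\<in>{..<m} - {i}. q j"] by simp
  qed
  then obtain p where p: "\<And>i j. i < m \<Longrightarrow> real (card (\<phi> i ` piece i \<inter> grid n (1 + Q * j))) = poly (p i) (real j)" by metis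
  have "real (card (lattice_points (1 + Q * j))) = poly (\<Sum>i<m. p i) (real j)" for j
    by (subst card_lattice_points) (simp_all add: p[simplified] poly_sum)
  moreover have "Q > 0" unfolding Q_def using q(1) by (intro prod_pos) auto
  ultimately show ?thesis by blast
qed

end

section \<open>A smooth partition of unity\<close>

text \<open>
Continuity is listed separately because there are no coordinate directions if \<open>n = 0\<close>.
\<close>

definition smooth_on :: "nat \<Rightarrow> (nat \<Rightarrow> real) set \<Rightarrow> ((nat \<Rightarrow> real) \<Rightarrow> real) \<Rightarrow> bool" where
  "smooth_on n W g \<longleftrightarrow> continuous_map (subtopology (Rn n) W) euclideanreal g \<and> (\<forall>j<n. C_along n j (Suc n) W g)"

lemma smooth_on_const: "smooth_on n W (\<lambda>_. c)"
  unfolding smooth_on_def using C_along_const by simp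

lemma smooth_on_mult: "smooth_on n W f \<Longrightarrow> smooth_on n W g \<Longrightarrow> smooth_on n W (\<lambda>x. f x * g x)"
  unfolding smooth_on_def by (auto intro: C_along_mult continuous_map_real_mult simp del: C_along.simps)

lemma smooth_on_add: "smooth_on n W f \<Longrightarrow> smooth_on n W g \<Longrightarrow> smooth_on n W (\<lambda>x. f x + g x)"
  unfolding smooth_on_def by (auto intro: C_along_add continuous_map_add simp del: C_along.simps)

lemma smooth_on_inverse: "smooth_on n W f \<Longrightarrow> (\<And>x. x \<in> W \<Longrightarrow> f x \<noteq> 0) \<Longrightarrow> smooth_on n W (\<lambda>x. inverse (f x))"
  unfolding smooth_on_def by (auto intro: C_along_inverse continuous_map_real_inverse simp del: C_along.simps)

lemma smooth_on_sum: "finite I \<Longrightarrow> (\<And>i. i \<in> I \<Longrightarrow> smooth_on n W (f i)) \<Longrightarrow> smooth_on n W (\<lambda>x. \<Sum>i\<in>I. f i x)"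
  by (induction I rule: finite_induct) (auto intro: smooth_on_const smooth_on_add)

lemma smooth_on_prod: "finite I \<Longrightarrow> (\<And>i. i \<in> I \<Longrightarrow> smooth_on n W (f i)) \<Longrightarrow> smooth_on n W (\<lambda>x. \<Prod>i\<in>I. f i x)"
  by (induction I rule: finite_induct) (auto intro: smooth_on_const smooth_on_mult)

lemma smooth_on_truncated_power:
  "smooth_on n W (\<lambda>x. max 0 ((\<Sum>i<n. c i * x i) + d) ^ Suc (Suc n))"
  unfolding smooth_on_def
  by (intro conjI allI impI C_along_truncated_power continuous_map_real_pow continuous_map_real_max
      continuous_affine_functional) auto

lemma smooth_on_cong:
  assumes "openin (Rn n) W" "\<And>y. y \<in> W \<Longrightarrow> f y = g y" "smooth_on n W f"
  shows "smooth_on n W g"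
proof -
  have "continuous_map (subtopology (Rn n) W) euclideanreal g"
    by (rule continuous_map_eq[of _ _ f]) (use assms in \<open>auto simp: smooth_on_def\<close>)
  moreover have "C_along n j (Suc n) W g" if "j < n" for j
    by (rule C_along_cong[OF assms(1) that assms(2)]) (use assms(3) that in \<open>auto simp: smooth_on_def simp del: C_along.simps\<close>)
  ultimately show ?thesis by (simp add: smooth_on_def del: C_along.simps)
qed

lemma smooth_on_glue:
  assumes "openin (Rn n) W"
    and loc: "\<And>x. x \<in> W \<Longrightarrow> \<exists>W'. openin (Rn n) W' \<and> x \<in> W' \<and> W' \<subseteq> W \<and> smooth_on n W' g"
  shows "smooth_on n W g"
proof -
  have "continuous_map (subtopology (Rn n) W) euclideanreal g"
  proof (rule continuous_glue)
    fix x assume "x \<in> W"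
    from loc[OF this] obtain W' where "openin (Rn n) W'" "x \<in> W'" "W' \<subseteq> W" "smooth_on n W' g" by blast
    then show "\<exists>W'. openin (Rn n) W' \<and> x \<in> W' \<and> W' \<subseteq> W \<and> continuous_map (subtopology (Rn n) W') euclideanreal g"
      unfolding smooth_on_def by (intro exI[of _ W']) simp
  qed
  moreover have "C_along n j (Suc n) W g" if j: "j < n" for j
  proof (rule C_along_glue[OF assms(1) j])
    fix x assume "x \<in> W"
    from loc[OF this] obtain W' where "openin (Rn n) W'" "x \<in> W'" "W' \<subseteq> W" "smooth_on n W' g" by blast
    then show "\<exists>W'. openin (Rn n) W' \<and> x \<in> W' \<and> W' \<subseteq> W \<and> C_along n j (Suc n) W' g"
      using j unfolding smooth_on_def by (intro exI[of _ W']) (simp del: C_along.simps)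
  qed
  ultimately show ?thesis by (simp add: smooth_on_def del: C_along.simps)
qed

context finite_box_cover
begin

text \<open>
Of class \<open>C\<^bsup>n+1\<^esup>\<close> and positive exactly on the open box.
\<close>

definition bump :: "nat \<Rightarrow> (nat \<Rightarrow> real) \<Rightarrow> real" where
  "bump j y = (\<Prod>l<n. max 0 (y l - a j l) ^ Suc (Suc n) * max 0 (b j l - y l) ^ Suc (Suc n))"

definition bump_M :: "nat \<Rightarrow> 'a \<Rightarrow> real" where
  "bump_M j x = (if x \<in> U j then bump j (\<phi> j x) else 0)"

text \<open>
A partition of unity subordinate to the patches.
\<close>

definition weight :: "nat \<Rightarrow> 'a \<Rightarrow> real" where
  "weight i x = bump_M i x / (\<Sum>j<m. bump_M j x)"

definition local_weight :: "nat \<Rightarrow> (nat \<Rightarrow> real) \<Rightarrow> real" where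
  "local_weight i y = (if y \<in> \<phi> i ` U i then weight i (inv_into (U i) (\<phi> i) y) else 0)"

lemma bump_nonneg: "bump j y \<ge> 0"
  unfolding bump_def by (intro prod_nonneg) auto

lemma bump_M_nonneg: "bump_M j x \<ge> 0"
  by (simp add: bump_M_def bump_nonneg)

lemma bump_M_pos: "x \<in> patch j \<Longrightarrow> bump_M j x > 0"
  unfolding bump_M_def bump_def patch_def obox_def by (auto intro!: prod_pos simp: PiE_iff)

lemma bump_M_zero:
  assumes "j < m" "x \<notin> patch j"
  shows "bump_M j x = 0"
proof (cases "x \<in> U j")
  case True
  then have "\<phi> j x \<in> space_Rn n" using chart(6)[OF charts[OF assms(1)]] by blast
  then obtain l where l: "l < n" "\<not> (a j l < \<phi> j x l \<and> \<phi> j x l < b j l)"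
    using assms(2) True unfolding patch_def obox_def by (auto simp: PiE_iff)
  have "bump j (\<phi> j x) = 0"
    unfolding bump_def by (rule prod_zero) (use l in \<open>auto simp: not_less max_def intro!: bexI[of _ l]\<close>)
  then show ?thesis by (simp add: bump_M_def)
qed (simp add: bump_M_def)

lemma bump_sum_pos:
  assumes "x \<in> topspace M"
  shows "(\<Sum>j<m. bump_M j x) > 0"
proof -
  obtain i where "i < m" "x \<in> patch i" using assms patch_cover by blast
  then show ?thesis using bump_M_pos bump_M_nonneg by (intro sum_pos2[of _ i]) auto
qed

lemma weight_nonneg: "weight i x \<ge> 0"
  unfolding weight_def by (intro divide_nonneg_nonneg sum_nonneg bump_M_nonneg)

lemma weight_zero: "i < m \<Longrightarrow> x \<notin> patch i \<Longrightarrow> weight i x = 0"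
  by (simp add: weight_def bump_M_zero)

lemma weight_sum: "x \<in> topspace M \<Longrightarrow> (\<Sum>i<m. weight i x) = 1"
  using bump_sum_pos[of x] by (simp add: weight_def flip: sum_divide_distrib)

lemma local_weight_nonneg: "local_weight i y \<ge> 0"
  by (simp add: local_weight_def weight_nonneg)

lemma local_weight_chart: "i < m \<Longrightarrow> x \<in> U i \<Longrightarrow> local_weight i (\<phi> i x) = weight i x"
  using chart(5)[OF charts] by (simp add: local_weight_def inv_into_f_f)

lemma local_weight_zero:
  assumes "i < m" "y \<notin> obox n (a i) (b i)"
  shows "local_weight i y = 0"
proof (cases "y \<in> \<phi> i ` U i")
  case True
  then obtain x where x: "x \<in> U i" "y = \<phi> i x" by blast
  then have "x \<notin> patch i" using assms(2) by (simp add: patch_def)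
  then show ?thesis using assms(1) x local_weight_chart weight_zero by simp
qed (simp add: local_weight_def)

lemma smooth_bump_affine: "smooth_on n W (\<lambda>y. bump j (affine_map n A v y))"
proof -
  have "smooth_on n W (\<lambda>y. max 0 ((\<Sum>r<n. of_int (A l r) * y r) + (of_int (v l) - a j l)) ^ Suc (Suc n) *
     max 0 ((\<Sum>r<n. - of_int (A l r) * y r) + (b j l - of_int (v l))) ^ Suc (Suc n))" for l
    by (intro smooth_on_mult smooth_on_truncated_power)
  then have "smooth_on n W (\<lambda>y. \<Prod>l<n. max 0 ((\<Sum>r<n. of_int (A l r) * y r) + (of_int (v l) - a j l)) ^ Suc (Suc n) *
     max 0 ((\<Sum>r<n. - of_int (A l r) * y r) + (b j l - of_int (v l))) ^ Suc (Suc n))"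
    by (intro smooth_on_prod) auto
  also have "(\<lambda>y. \<Prod>l<n. max 0 ((\<Sum>r<n. of_int (A l r) * y r) + (of_int (v l) - a j l)) ^ Suc (Suc n) *
     max 0 ((\<Sum>r<n. - of_int (A l r) * y r) + (b j l - of_int (v l))) ^ Suc (Suc n)) = (\<lambda>y. bump j (affine_map n A v y))"
    unfolding bump_def by (intro ext prod.cong refl) (simp add: affine_map_def sum_negf algebra_simps)
  finally show ?thesis .
qed

text \<open>
Near a point of the closed box the bumps of all charts are \<open>0\<close> or bumps composed with affine maps,
and their sum is positive. Near any other point the weight vanishes.
\<close>

lemma smooth_local_weight:
  assumes i: "i < m"
  shows "smooth_on n (space_Rn n) (local_weight i)"
proof (rule smooth_on_glue)
  show "openin (Rn n) (space_Rn n)" using openin_topspace[of "Rn n"] by (simp add: topspace_Rn)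
  have inj: "inj_on (\<phi> i) (U i)" by (rule chart(5)[OF charts[OF i]])
  fix y :: "nat \<Rightarrow> real" assume y: "y \<in> space_Rn n"
  show "\<exists>W'. openin (Rn n) W' \<and> y \<in> W' \<and> W' \<subseteq> space_Rn n \<and> smooth_on n W' (local_weight i)"
  proof (cases "y \<in> cbox_Rn n (a i) (b i)")
    case False
    let ?W = "(space_Rn n) - cbox_Rn n (a i) (b i)"
    have "smooth_on n ?W (local_weight i)"
    proof (rule smooth_on_cong[OF openin_outside_cbox _ smooth_on_const])
      fix z assume "z \<in> ?W"
      then show "0 = local_weight i z" using local_weight_zero[OF i] obox_subset_cbox by fastforce
    qed
    then show ?thesis using y False by (intro exI[of _ ?W]) (auto simp: openin_outside_cbox)
  next
    case True
    then have "y \<in> \<phi> i ` U i" using boxes[OF i] by blast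
    from local_form_all[OF i this] obtain N where N: "openin (Rn n) N" "y \<in> N" "N \<subseteq> \<phi> i ` U i"
      "\<And>j. j < m \<Longrightarrow> (\<forall>x\<in>U i. \<phi> i x \<in> N \<longrightarrow> x \<notin> patch j) \<or>
     (\<exists>g\<in>Aff_int n. \<forall>x\<in>U i. \<phi> i x \<in> N \<longrightarrow> x \<in> U j \<and> \<phi> j x = g (\<phi> i x))" by blast
    have "\<exists>B. smooth_on n N B \<and> (\<forall>x\<in>U i. \<phi> i x \<in> N \<longrightarrow> bump_M j x = B (\<phi> i x))" if j: "j < m" for j
      using N(4)[OF j]
    proof
      assume "\<forall>x\<in>U i. \<phi> i x \<in> N \<longrightarrow> x \<notin> patch j"
      then show ?thesis using bump_M_zero[OF j] smooth_on_const[of n N 0] by (intro exI[of _ "\<lambda>_. 0"]) auto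
    next
      assume "\<exists>g\<in>Aff_int n. \<forall>x\<in>U i. \<phi> i x \<in> N \<longrightarrow> x \<in> U j \<and> \<phi> j x = g (\<phi> i x)"
      then obtain A v where g: "\<And>x. x \<in> U i \<Longrightarrow> \<phi> i x \<in> N \<Longrightarrow> x \<in> U j \<and> \<phi> j x = affine_map n A v (\<phi> i x)"
        unfolding Aff_int_def by blast
      then show ?thesis using smooth_bump_affine[of N j A v]
        by (intro exI[of _ "\<lambda>y. bump j (affine_map n A v y)"]) (auto simp: bump_M_def)
    qed
    then obtain B where B: "\<And>j. j < m \<Longrightarrow> smooth_on n N (B j)"
      "\<And>j x. j < m \<Longrightarrow> x \<in> U i \<Longrightarrow> \<phi> i x \<in> N \<Longrightarrow> bump_M j x = B j (\<phi> i x)" by metis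
    have pre: "\<exists>x. x \<in> U i \<and> z = \<phi> i x" if "z \<in> N" for z using N(3) that by blast
    have sum_eq: "(\<Sum>j<m. bump_M j x) = (\<Sum>j<m. B j (\<phi> i x))" if "x \<in> U i" "\<phi> i x \<in> N" for x
      using B(2) that by simp
    have "smooth_on n N (\<lambda>y. \<Sum>j<m. B j y)" using B(1) by (intro smooth_on_sum) auto
    then have "smooth_on n N (\<lambda>y. inverse (\<Sum>j<m. B j y))"
    proof (rule smooth_on_inverse)
      fix z assume "z \<in> N"
      with pre obtain x where x: "x \<in> U i" "z = \<phi> i x" by blast
      then have "x \<in> topspace M" using chart(2)[OF charts[OF i]] by blast
      then show "(\<Sum>j<m. B j z) \<noteq> 0" using bump_sum_pos sum_eq x \<open>z \<in> N\<close> by fastforce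
    qed
    from smooth_on_mult[OF B(1)[OF i] this]
    have "smooth_on n N (\<lambda>y. B i y * inverse (\<Sum>j<m. B j y))" .
    then have "smooth_on n N (local_weight i)"
    proof (rule smooth_on_cong[OF N(1), rotated])
      fix z assume "z \<in> N"
      with pre obtain x where x: "x \<in> U i" "z = \<phi> i x" by blast
      then show "B i z * inverse (\<Sum>j<m. B j z) = local_weight i z"
        using local_weight_chart[OF i] sum_eq[of x] B(2)[OF i, of x] \<open>z \<in> N\<close> by (simp add: weight_def divide_inverse)
    qed
    moreover have "N \<subseteq> space_Rn n" using openin_subset[OF N(1)] by (simp add: topspace_Rn)
    ultimately show ?thesis using N(1,2) by blast
  qed
qed

text \<open>
This moves the count from \<open>M\<close> to \<open>\<real>\<^sup>n\<close>, where lattice sums of smooth functions can be estimated.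
\<close>

lemma weight_lattice_sum:
  assumes i: "i < m" and k: "k > 0" and R: "cbox_Rn n (a i) (b i) \<subseteq> cube n R"
  shows "(\<Sum>x\<in>lattice_points k. weight i x) = (\<Sum>y\<in>grid_box n (Suc R) k. local_weight i y)"
proof -
  have bU: "patch i \<subseteq> U i" "patch i \<subseteq> topspace M" using chart(2)[OF charts[OF i]] by (auto simp: patch_def)
  have "inj_on (\<phi> i) (lattice_points k \<inter> patch i)"
    using chart(5)[OF charts[OF i]] bU by (meson Int_lower2 inj_on_subset order_trans)
  moreover have img: "\<phi> i ` (lattice_points k \<inter> patch i) = grid n k \<inter> obox n (a i) (b i)"
    unfolding image_patch[OF i, symmetric] using lattice_points_chart[OF charts[OF i] _ k] bU(1) by blast
  ultimately have "(\<Sum>y\<in>grid n k \<inter> obox n (a i) (b i). local_weight i y) = (\<Sum>x\<in>lattice_points k \<inter> patch i. local_weight i (\<phi> i x))"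
    by (metis (no_types, lifting) comp_apply sum.cong sum.reindex)
  also have "\<dots> = (\<Sum>x\<in>lattice_points k \<inter> patch i. weight i x)"
    using local_weight_chart[OF i] bU by (intro sum.cong) auto
  also have "\<dots> = (\<Sum>x\<in>lattice_points k. weight i x)"
    by (rule sum.mono_neutral_left) (use finite_lattice_points[OF k] weight_zero[OF i] in auto)
  finally have "(\<Sum>x\<in>lattice_points k. weight i x) = (\<Sum>y\<in>grid n k \<inter> obox n (a i) (b i). local_weight i y)" by simp
  also have "\<dots> = (\<Sum>y\<in>grid_box n (Suc R) k. local_weight i y)"
  proof (rule sum.mono_neutral_left[OF finite_grid_box[OF k]])
    have "cube n R \<subseteq> cube n (Suc R)"
      unfolding cbox_Rn_def by (intro PiE_mono) auto
    then show "grid n k \<inter> obox n (a i) (b i) \<subseteq> grid_box n (Suc R) k"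
      using R obox_subset_cbox unfolding grid_box_def by blast
    show "\<forall>y\<in>grid_box n (Suc R) k - grid n k \<inter> obox n (a i) (b i). local_weight i y = 0"
      using local_weight_zero[OF i] unfolding grid_box_def by blast
  qed
  finally show ?thesis .
qed

lemma continuous_local_weight: "i < m \<Longrightarrow> continuous_map (Rn n) euclideanreal (local_weight i)"
  using smooth_local_weight[of i] topspace_Rn[of n] unfolding smooth_on_def by (metis subtopology_topspace)

text \<open>
The weights sum to \<open>1\<close> at each lattice point, so the count is a sum of lattice sums of smooth functions.
\<close>

theorem card_lattice_points_asymptotics:
  "\<exists>V\<ge>0. \<exists>B. (\<Sum>i<m. \<integral>\<^sup>+y. ennreal (local_weight i y) \<partial>lebesgue_Rn n) = ennreal V \<and>
     (\<forall>k>0. \<bar>real (card (lattice_points k)) - real k ^ n * V\<bar> \<le> B / real k)"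
proof -
  obtain R where R: "\<And>i. i < m \<Longrightarrow> cbox_Rn n (a i) (b i) \<subseteq> cube n R" using patch_radius by blast
  have "\<forall>i\<in>{..<m}. \<exists>I. \<exists>B. I \<ge> 0 \<and> (\<integral>\<^sup>+y. ennreal (local_weight i y) \<partial>lebesgue_Rn n) = ennreal I \<and>
    (\<forall>k>0. \<bar>(\<Sum>y\<in>grid_box n (Suc R) k. local_weight i y) - real k ^ n * I\<bar> \<le> B / real k)"
  proof
    fix i assume "i \<in> {..<m}"
    then have i: "i < m" by simp
    have "vanishes_outside n R (local_weight i)"
      unfolding vanishes_outside_def using local_weight_zero[OF i] R[OF i] obox_subset_cbox by blast
    from smooth_lattice_sum_asymptotics[OF _ this continuous_local_weight[OF i] local_weight_nonneg]
    show "\<exists>I. \<exists>B. I \<ge> 0 \<and> (\<integral>\<^sup>+y. ennreal (local_weight i y) \<partial>lebesgue_Rn n) = ennreal I \<and>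
    (\<forall>k>0. \<bar>(\<Sum>y\<in>grid_box n (Suc R) k. local_weight i y) - real k ^ n * I\<bar> \<le> B / real k)"
      using smooth_local_weight[OF i] unfolding smooth_on_def by blast
  qed
  from bchoice[OF this] obtain I where "\<forall>i\<in>{..<m}. \<exists>B. I i \<ge> 0 \<and> (\<integral>\<^sup>+y. ennreal (local_weight i y) \<partial>lebesgue_Rn n) = ennreal (I i) \<and>
    (\<forall>k>0. \<bar>(\<Sum>y\<in>grid_box n (Suc R) k. local_weight i y) - real k ^ n * I i\<bar> \<le> B / real k)" ..
  from bchoice[OF this] obtain B where IB: "\<And>i. i < m \<Longrightarrow> I i \<ge> 0"
    "\<And>i. i < m \<Longrightarrow> (\<integral>\<^sup>+y. ennreal (local_weight i y) \<partial>lebesgue_Rn n) = ennreal (I i)"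
    "\<And>i k. i < m \<Longrightarrow> k > 0 \<Longrightarrow> \<bar>(\<Sum>y\<in>grid_box n (Suc R) k. local_weight i y) - real k ^ n * I i\<bar> \<le> B i / real k"
    by (metis lessThan_iff)
  have "\<bar>real (card (lattice_points k)) - real k ^ n * (\<Sum>i<m. I i)\<bar> \<le> (\<Sum>i<m. B i) / real k" if k: "k > 0" for k
  proof -
    have "real (card (lattice_points k)) = (\<Sum>x\<in>lattice_points k. \<Sum>i<m. weight i x)"
      using weight_sum by (simp add: lattice_points_def)
    also have "\<dots> = (\<Sum>i<m. \<Sum>x\<in>lattice_points k. weight i x)" by (rule sum.swap)
    also have "\<dots> = (\<Sum>i<m. \<Sum>y\<in>grid_box n (Suc R) k. local_weight i y)"
      by (intro sum.cong refl weight_lattice_sum k R) auto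
    finally have "real (card (lattice_points k)) - real k ^ n * (\<Sum>i<m. I i) =
      (\<Sum>i<m. (\<Sum>y\<in>grid_box n (Suc R) k. local_weight i y) - real k ^ n * I i)"
      by (simp add: sum_subtractf sum_distrib_left)
    then have "\<bar>real (card (lattice_points k)) - real k ^ n * (\<Sum>i<m. I i)\<bar> \<le>
      (\<Sum>i<m. \<bar>(\<Sum>y\<in>grid_box n (Suc R) k. local_weight i y) - real k ^ n * I i\<bar>)"
      by (simp only: sum_abs)
    also have "\<dots> \<le> (\<Sum>i<m. B i / real k)" by (intro sum_mono IB(3) k) auto
    finally show ?thesis by (simp add: sum_divide_distrib)
  qed
  moreover have "(\<Sum>i<m. \<integral>\<^sup>+y. ennreal (local_weight i y) \<partial>lebesgue_Rn n) = ennreal (\<Sum>i<m. I i)"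
  proof -
    have "(\<Sum>i<m. \<integral>\<^sup>+y. ennreal (local_weight i y) \<partial>lebesgue_Rn n) = (\<Sum>i<m. ennreal (I i))"
      by (intro sum.cong refl IB(2)) simp
    also have "\<dots> = ennreal (\<Sum>i<m. I i)" by (rule sum_ennreal) (simp add: IB(1))
    finally show ?thesis .
  qed
  moreover have "(\<Sum>i<m. I i) \<ge> 0" using IB(1) by (intro sum_nonneg) auto
  ultimately show ?thesis by blast
qed

end

section \<open>The measure of an integral affine manifold\<close>

context integral_affine_manifold
begin

definition borel_M :: "'a measure" where
  "borel_M = sigma (topspace M) {W. openin M W}"

lemma space_borel_M [simp]: "space borel_M = topspace M"
  unfolding borel_M_def by (rule space_measure_of) (use openin_subset in auto)

lemma sets_borel_M: "sets borel_M = sigma_sets (topspace M) {W. openin M W}"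
  unfolding borel_M_def by (rule sets_measure_of) (use openin_subset in auto)

lemma open_borel_M: "openin M W \<Longrightarrow> W \<in> sets borel_M"
  by (simp add: sets_borel_M sigma_sets.Basic)

lemma chart_vimage_borel:
  assumes c: "(U, \<phi>) \<in> \<A>" and B: "B \<in> sets (lebesgue_Rn n)"
  shows "{x \<in> U. \<phi> x \<in> B} \<in> sets borel_M"
proof -
  have U: "U \<in> sets borel_M" using open_borel_M chart(1)[OF c] by blast
  have U': "U \<inter> space borel_M \<in> sets borel_M" using U by (rule sets.Int[OF _ sets.top])
  have sp: "space (restrict_space borel_M U) = U" using chart(2)[OF c] by (auto simp: space_restrict_space)
  have "\<phi> \<in> measurable (restrict_space borel_M U) (lebesgue_Rn n)"
  proof (rule measurable_into_Rn')
    fix i assume i: "i < n"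
    show "(\<lambda>x. \<phi> x i) \<in> borel_measurable (restrict_space borel_M U)"
    proof (rule borel_measurableI)
      fix S :: "real set" assume S: "open S"
      have "continuous_map (Rn n) euclideanreal (\<lambda>y. y i)"
        unfolding Rn_def using i by (intro continuous_map_product_projection) auto
      from openin_continuous_map_preimage[OF this, of S] S
      have "openin (Rn n) {y \<in> topspace (Rn n). y i \<in> S}" by simp
      from chart_open_vimage[OF c this] have "{x \<in> U. \<phi> x \<in> {y \<in> topspace (Rn n). y i \<in> S}} \<in> sets borel_M"
        by (rule open_borel_M)
      also have "{x \<in> U. \<phi> x \<in> {y \<in> topspace (Rn n). y i \<in> S}} = (\<lambda>x. \<phi> x i) -` S \<inter> space (restrict_space borel_M U)"
        unfolding sp using chart(6)[OF c] by (auto simp: topspace_Rn)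
      finally show "(\<lambda>x. \<phi> x i) -` S \<inter> space (restrict_space borel_M U) \<in> sets (restrict_space borel_M U)"
        unfolding sets_restrict_space_iff[OF U'] sp by blast
    qed
  next
    fix x assume "x \<in> space (restrict_space borel_M U)"
    then show "\<phi> x \<in> space_Rn n" unfolding sp by (rule chart(6)[OF c])
  qed
  from measurable_sets[OF this B] have "\<phi> -` B \<inter> U \<in> sets (restrict_space borel_M U)" unfolding sp .
  then have "\<phi> -` B \<inter> U \<in> sets borel_M" unfolding sets_restrict_space_iff[OF U'] by blast
  then show ?thesis by (simp add: vimage_def Int_def conj_commute)
qed

lemma measurable_chart_inverse:
  assumes c: "(U, \<phi>) \<in> \<A>"
  shows "inv_into U \<phi> \<in> measurable (restrict_space (lebesgue_Rn n) (\<phi> ` U)) borel_M"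
proof -
  have im: "\<phi> ` U \<in> sets (lebesgue_Rn n)" by (rule sets_openin_Rn[OF chart(3)[OF c]])
  then have sp: "space (restrict_space (lebesgue_Rn n) (\<phi> ` U)) = \<phi> ` U"
    by (rule space_restrict_space2)
  have im': "\<phi> ` U \<inter> space (lebesgue_Rn n) \<in> sets (lebesgue_Rn n)" using im by (rule sets.Int[OF _ sets.top])
  show ?thesis
    unfolding borel_M_def
  proof (rule measurable_measure_of)
    show "{W. openin M W} \<subseteq> Pow (topspace M)" using openin_subset by auto
    show "inv_into U \<phi> \<in> space (restrict_space (lebesgue_Rn n) (\<phi> ` U)) \<rightarrow> topspace M"
      unfolding sp using inv_into_into[of _ \<phi> U] chart(2)[OF c] by blast
    fix W assume "W \<in> {W. openin M W}"
    then have "openin M (U \<inter> W)" using chart(1)[OF c] by auto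
    from chart_open_image[OF c this] have "\<phi> ` (U \<inter> W) \<in> sets (lebesgue_Rn n)" by (intro sets_openin_Rn) auto
    also have "\<phi> ` (U \<inter> W) = inv_into U \<phi> -` W \<inter> space (restrict_space (lebesgue_Rn n) (\<phi> ` U))"
      unfolding sp using inv_into_f_f[OF chart(5)[OF c]] by auto
    finally show "inv_into U \<phi> -` W \<inter> space (restrict_space (lebesgue_Rn n) (\<phi> ` U)) \<in> sets (restrict_space (lebesgue_Rn n) (\<phi> ` U))"
      unfolding sets_restrict_space_iff[OF im'] sp by blast
  qed
qed

lemma chart_image_borel:
  assumes c: "(U, \<phi>) \<in> \<A>" and T: "T \<in> sets borel_M"
  shows "\<phi> ` (T \<inter> U) \<in> sets (lebesgue_Rn n)"
proof -
  have im: "\<phi> ` U \<in> sets (lebesgue_Rn n)" by (rule sets_openin_Rn[OF chart(3)[OF c]])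
  then have sp: "space (restrict_space (lebesgue_Rn n) (\<phi> ` U)) = \<phi> ` U"
    by (rule space_restrict_space2)
  have im': "\<phi> ` U \<inter> space (lebesgue_Rn n) \<in> sets (lebesgue_Rn n)" using im by (rule sets.Int[OF _ sets.top])
  have "inv_into U \<phi> -` T \<inter> \<phi> ` U = \<phi> ` (T \<inter> U)" using inv_into_f_f[OF chart(5)[OF c]] by auto
  then have "\<phi> ` (T \<inter> U) \<in> sets (restrict_space (lebesgue_Rn n) (\<phi> ` U))"
    using measurable_sets[OF measurable_chart_inverse[OF c] T] by (simp add: sp)
  then show ?thesis unfolding sets_restrict_space_iff[OF im'] by blast
qed

lemma inj_on_transition:
  assumes "(U, \<phi>) \<in> \<A>" "(V, \<psi>) \<in> \<A>"
  shows "inj_on (\<psi> \<circ> inv_into U \<phi>) (\<phi> ` (U \<inter> V))"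
proof (rule inj_onI)
  fix y z assume "y \<in> \<phi> ` (U \<inter> V)" "z \<in> \<phi> ` (U \<inter> V)" and eq: "(\<psi> \<circ> inv_into U \<phi>) y = (\<psi> \<circ> inv_into U \<phi>) z"
  then obtain x x' where x: "x \<in> U \<inter> V" "y = \<phi> x" "x' \<in> U \<inter> V" "z = \<phi> x'" by blast
  then have "\<psi> x = \<psi> x'" using eq inv_into_f_f[OF chart(5)[OF assms(1)]] by simp
  then show "y = z" using x inj_onD[OF chart(5)[OF assms(2)]] by blast
qed

end

context finite_box_cover
begin

text \<open>
The weights serve as densities, so that the total mass is the constant in
\<open>card_lattice_points_asymptotics\<close>.
\<close>

definition volume_on :: "'a set \<Rightarrow> ennreal" where
  "volume_on S = (\<Sum>i<m. \<integral>\<^sup>+y. ennreal (local_weight i y) * indicator (\<phi> i ` (S \<inter> U i)) y \<partial>lebesgue_Rn n)"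

lemma measurable_local_weight: "i < m \<Longrightarrow> local_weight i \<in> borel_measurable (lebesgue_Rn n)"
  by (rule measurable_continuous_Rn[OF continuous_local_weight])

lemma measurable_weight:
  assumes i: "i < m"
  shows "weight i \<in> borel_measurable borel_M"
proof (rule borel_measurableI)
  fix S :: "real set" assume "open S"
  then have "local_weight i -` S \<inter> space (lebesgue_Rn n) \<in> sets (lebesgue_Rn n)"
    by (intro measurable_sets[OF measurable_local_weight[OF i]]) simp
  from chart_vimage_borel[OF charts[OF i] this]
  have 1: "{x \<in> U i. \<phi> i x \<in> local_weight i -` S \<inter> space (lebesgue_Rn n)} \<in> sets borel_M" .
  have 2: "(if 0 \<in> S then topspace M - U i else {}) \<in> sets borel_M"
    using sets.compl_sets[OF open_borel_M[OF chart(1)[OF charts[OF i]]]] by simp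
  have U: "x \<in> U i \<Longrightarrow> x \<in> topspace M" for x using chart(2)[OF charts[OF i]] by blast
  have out: "weight i x = 0" if "x \<notin> U i" for x using that weight_zero[OF i] by (simp add: patch_def)
  have "weight i -` S \<inter> space borel_M =
    {x \<in> U i. \<phi> i x \<in> local_weight i -` S \<inter> space (lebesgue_Rn n)} \<union> (if 0 \<in> S then topspace M - U i else {})"
  proof (rule set_eqI)
    fix x
    show "x \<in> weight i -` S \<inter> space borel_M \<longleftrightarrow>
      x \<in> {x \<in> U i. \<phi> i x \<in> local_weight i -` S \<inter> space (lebesgue_Rn n)} \<union> (if 0 \<in> S then topspace M - U i else {})"
    proof (cases "x \<in> U i")
      case True
      then show ?thesis using local_weight_chart[OF i True] chart(6)[OF charts[OF i] True] U[OF True] by simp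
    next
      case False
      then show ?thesis using out[OF False] by auto
    qed
  qed
  then show "weight i -` S \<inter> space borel_M \<in> sets borel_M" using sets.Un[OF 1 2] by simp
qed

lemma volume_on_countably_additive: "countably_additive (sets borel_M) volume_on"
  unfolding countably_additive_def
proof (intro allI impI)
  fix T :: "nat \<Rightarrow> 'a set"
  assume T: "range T \<subseteq> sets borel_M" "disjoint_family T" "(\<Union>l. T l) \<in> sets borel_M"
  have "(\<Sum>l. \<integral>\<^sup>+y. ennreal (local_weight i y) * indicator (\<phi> i ` (T l \<inter> U i)) y \<partial>lebesgue_Rn n) =
     (\<integral>\<^sup>+y. ennreal (local_weight i y) * indicator (\<phi> i ` ((\<Union>l. T l) \<inter> U i)) y \<partial>lebesgue_Rn n)" if i: "i < m" for i
  proof -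
    have "disjoint_family (\<lambda>l. \<phi> i ` (T l \<inter> U i))"
      unfolding disjoint_family_on_def
    proof (intro ballI impI)
      fix l l' :: nat assume "l \<noteq> l'"
      then have "T l \<inter> T l' = {}" using T(2) by (auto simp: disjoint_family_on_def)
      then show "\<phi> i ` (T l \<inter> U i) \<inter> \<phi> i ` (T l' \<inter> U i) = {}"
        using inj_onD[OF chart(5)[OF charts[OF i]]] by blast
    qed
    moreover have "\<phi> i ` (T l \<inter> U i) \<in> sets (lebesgue_Rn n)" for l
      using T(1) by (intro chart_image_borel[OF charts[OF i]]) auto
    moreover have "(\<lambda>y. ennreal (local_weight i y)) \<in> borel_measurable (lebesgue_Rn n)"
      using measurable_local_weight[OF i] by simp
    ultimately have "(\<integral>\<^sup>+y\<in>(\<Union>l. \<phi> i ` (T l \<inter> U i)). ennreal (local_weight i y) \<partial>lebesgue_Rn n) =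
       (\<Sum>l. \<integral>\<^sup>+y\<in>\<phi> i ` (T l \<inter> U i). ennreal (local_weight i y) \<partial>lebesgue_Rn n)"
      by (intro nn_integral_disjoint_family)
    moreover have "(\<Union>l. \<phi> i ` (T l \<inter> U i)) = \<phi> i ` ((\<Union>l. T l) \<inter> U i)" by blast
    ultimately show ?thesis by simp
  qed
  then have "volume_on (\<Union>l. T l) = (\<Sum>i<m. \<Sum>l. \<integral>\<^sup>+y. ennreal (local_weight i y) * indicator (\<phi> i ` (T l \<inter> U i)) y \<partial>lebesgue_Rn n)"
    by (simp add: volume_on_def)
  also have "\<dots> = (\<Sum>l. volume_on (T l))"
    unfolding volume_on_def by (rule suminf_sum[symmetric]) simp
  finally show "(\<Sum>l. volume_on (T l)) = volume_on (\<Union>l. T l)" by simp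
qed

text \<open>
In the chart \<open>\<psi>\<close>, the change of variables along the transition maps turns the \<open>i\<close>-th summand into the
integral of the \<open>i\<close>-th weight over \<open>B\<close>, and the weights sum to \<open>1\<close>.
\<close>

lemma volume_on_chart:
  assumes c: "(V, \<psi>) \<in> \<A>" and B: "B \<in> sets (lebesgue_Rn n)" "B \<subseteq> \<psi> ` V"
  shows "volume_on (V \<inter> \<psi> -` B) = emeasure (lebesgue_Rn n) B"
proof -
  let ?S = "V \<inter> \<psi> -` B"
  have S: "?S \<in> sets borel_M" using chart_vimage_borel[OF c B(1)] by (simp add: vimage_def Int_def)
  have im: "\<psi> ` V \<in> sets (lebesgue_Rn n)" by (rule sets_openin_Rn[OF chart(3)[OF c]])
  have Bim: "B \<inter> \<psi> ` V = B" using B(2) by blast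
  let ?w = "\<lambda>i z. ennreal (weight i (inv_into V \<psi> z)) * indicator B z"
  have meas: "?w i \<in> borel_measurable (lebesgue_Rn n)" if i: "i < m" for i
  proof -
    have "(\<lambda>z. ennreal (weight i (inv_into V \<psi> z))) \<in> borel_measurable (restrict_space (lebesgue_Rn n) (\<psi> ` V))"
      using measurable_compose[OF measurable_chart_inverse[OF c] measurable_weight[OF i]] by simp
    then have "(\<lambda>z. ennreal (weight i (inv_into V \<psi> z)) * indicator (\<psi> ` V) z) \<in> borel_measurable (lebesgue_Rn n)"
      unfolding borel_measurable_restrict_space_iff_ennreal[OF sets.Int[OF im sets.top]] .
    from borel_measurable_times_ennreal[OF this borel_measurable_indicator[OF B(1)]]
    have "(\<lambda>z. ennreal (weight i (inv_into V \<psi> z)) * indicator (\<psi> ` V) z * indicator B z) \<in> borel_measurable (lebesgue_Rn n)" .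
    also have "(\<lambda>z. ennreal (weight i (inv_into V \<psi> z)) * indicator (\<psi> ` V) z * indicator B z) = ?w i"
      using B(2) by (auto simp: indicator_def fun_eq_iff)
    finally show ?thesis .
  qed
  have piece: "(\<integral>\<^sup>+y. ennreal (local_weight i y) * indicator (\<phi> i ` (?S \<inter> U i)) y \<partial>lebesgue_Rn n) =
     (\<integral>\<^sup>+z. ?w i z \<partial>lebesgue_Rn n)" if i: "i < m" for i
  proof -
    let ?\<Omega> = "\<psi> ` (V \<inter> U i)" and ?f = "\<phi> i \<circ> inv_into V \<psi>"
    let ?h = "\<lambda>y. ennreal (local_weight i y) * indicator (\<phi> i ` (?S \<inter> U i)) y"
    have inv: "inv_into V \<psi> (\<psi> x) = x" if "x \<in> V" for x using inv_into_f_f[OF chart(5)[OF c] that] .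
    have f\<Omega>: "?f ` ?\<Omega> = \<phi> i ` (V \<inter> U i)"
      unfolding image_image comp_def by (intro image_cong refl) (simp add: inv)
    have h: "?h \<in> borel_measurable (lebesgue_Rn n)"
      using measurable_local_weight[OF i] chart_image_borel[OF charts[OF i] S]
      by (intro borel_measurable_times_ennreal borel_measurable_indicator) auto
    have "(\<integral>\<^sup>+y. ?h y \<partial>lebesgue_Rn n) = (\<integral>\<^sup>+y\<in>?f ` ?\<Omega>. ?h y \<partial>lebesgue_Rn n)"
      unfolding f\<Omega> by (intro nn_integral_cong) (auto simp: indicator_def)
    also have "\<dots> = (\<integral>\<^sup>+z\<in>?\<Omega>. ?h (?f z) \<partial>lebesgue_Rn n)"
      by (rule nn_integral_locally_int_affine[OF transition[OF c charts[OF i]] inj_on_transition[OF c charts[OF i]] h, symmetric])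
    also have "\<dots> = (\<integral>\<^sup>+z. ?w i z \<partial>lebesgue_Rn n)"
    proof (rule nn_integral_cong)
      fix z
      show "?h (?f z) * indicator ?\<Omega> z = ?w i z"
      proof (cases "z \<in> \<psi> ` V")
        case False
        then show ?thesis using B(2) by (auto simp: indicator_def)
      next
        case True
        then obtain x where x: "x \<in> V" "z = \<psi> x" by blast
        show ?thesis
        proof (cases "x \<in> U i")
          case True
          have "\<phi> i x \<in> \<phi> i ` (?S \<inter> U i) \<longleftrightarrow> x \<in> ?S"
            using inj_onD[OF chart(5)[OF charts[OF i]]] True by blast
          moreover have "z \<in> ?\<Omega>" using x True by blast
          ultimately show ?thesis using x True local_weight_chart[OF i True] by (simp add: inv indicator_def)
        next
          case False
          then have "x \<notin> patch i" by (simp add: patch_def)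
          moreover have "z \<notin> ?\<Omega>" using False x inj_onD[OF chart(5)[OF c]] by blast
          ultimately show ?thesis using x weight_zero[OF i] by (simp add: inv)
        qed
      qed
    qed
    finally show ?thesis .
  qed
  have "volume_on ?S = (\<Sum>i<m. \<integral>\<^sup>+z. ?w i z \<partial>lebesgue_Rn n)"
    unfolding volume_on_def by (intro sum.cong refl piece) simp
  also have "\<dots> = (\<integral>\<^sup>+z. (\<Sum>i<m. ?w i z) \<partial>lebesgue_Rn n)"
    by (rule nn_integral_sum[symmetric]) (use meas in simp)
  also have "\<dots> = (\<integral>\<^sup>+z. indicator B z \<partial>lebesgue_Rn n)"
  proof (rule nn_integral_cong)
    fix z
    show "(\<Sum>i<m. ?w i z) = indicator B z"
    proof (cases "z \<in> B")
      case True
      then have "inv_into V \<psi> z \<in> topspace M" using B(2) inv_into_into[of z \<psi> V] chart(2)[OF c] by blast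
      then have "(\<Sum>i<m. ennreal (weight i (inv_into V \<psi> z))) = 1"
        using weight_sum weight_nonneg by (subst sum_ennreal) auto
      then show ?thesis using True by simp
    qed simp
  qed
  also have "\<dots> = emeasure (lebesgue_Rn n) B" using B(1) by simp
  finally show ?thesis .
qed

text \<open>
Any other measure for which the charts are measure preserving has the same value on each Borel
subset of a piece, since a piece lies in the domain of a chart. So the definite description in
the definition of the volume denotes the measure given by \<open>volume_on\<close>.
\<close>

lemma vol_eq: "vol n M \<A> = (\<Sum>i<m. \<integral>\<^sup>+y. ennreal (local_weight i y) \<partial>lebesgue_Rn n)"
proof -
  define \<mu> where "\<mu> = measure_of (topspace M) {W. openin M W} volume_on"
  have Pow: "{W. openin M W} \<subseteq> Pow (topspace M)" using openin_subset by auto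
  have space\<mu>: "space \<mu> = topspace M" unfolding \<mu>_def by (rule space_measure_of[OF Pow])
  have sets\<mu>: "sets \<mu> = sigma_sets (topspace M) {W. openin M W}" unfolding \<mu>_def by (rule sets_measure_of[OF Pow])
  have pos: "positive (sets \<mu>) volume_on" by (simp add: positive_def volume_on_def)
  have add: "countably_additive (sets \<mu>) volume_on"
    using volume_on_countably_additive by (simp add: sets\<mu> sets_borel_M)
  have em: "emeasure \<mu> S = volume_on S" if "S \<in> sets borel_M" for S
    by (rule emeasure_measure_of[OF \<mu>_def Pow pos add]) (use that in \<open>simp add: sets\<mu> sets_borel_M\<close>)
  have pres: "\<forall>c\<in>\<A>. chart_measure_preserving n \<mu> c"
  proof
    fix c assume "c \<in> \<A>"
    then obtain V \<psi> where c: "c = (V, \<psi>)" "(V, \<psi>) \<in> \<A>" by (cases c) auto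
    have "emeasure \<mu> (V \<inter> \<psi> -` B) = emeasure (lebesgue_Rn n) B" if B: "B \<in> sets (lebesgue_Rn n)" "B \<subseteq> \<psi> ` V" for B
    proof -
      have "V \<inter> \<psi> -` B \<in> sets borel_M" using chart_vimage_borel[OF c(2) B(1)] by (simp add: vimage_def Int_def)
      then show ?thesis using em volume_on_chart[OF c(2) B] by simp
    qed
    then show "chart_measure_preserving n \<mu> c" by (simp add: chart_measure_preserving_def c(1))
  qed
  have unique: "\<nu> = \<mu>" if \<nu>: "space \<nu> = topspace M" "sets \<nu> = sigma_sets (topspace M) {W. openin M W}"
    "\<forall>c\<in>\<A>. chart_measure_preserving n \<nu> c" for \<nu>
  proof (rule measure_eqI)
    show "sets \<nu> = sets \<mu>" using \<nu>(2) sets\<mu> by simp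
    fix S assume "S \<in> sets \<nu>"
    then have S: "S \<in> sets borel_M" using \<nu>(2) by (simp add: sets_borel_M)
    have patchS: "patch j \<in> sets borel_M" if "j < m" for j
      unfolding patch_def by (rule open_borel_M[OF chart_open_vimage[OF charts[OF that] openin_obox]])
    have pS: "S \<inter> piece i \<in> sets borel_M" if "i < m" for i
      unfolding piece_def using that by (intro sets.Int S sets.Diff patchS sets.finite_UN) auto
    have eq: "emeasure \<kappa> S = (\<Sum>i<m. emeasure (lebesgue_Rn n) (\<phi> i ` (S \<inter> piece i)))"
      if \<kappa>: "sets \<kappa> = sets borel_M" "\<forall>c\<in>\<A>. chart_measure_preserving n \<kappa> c" for \<kappa>
    proof -
      have "(\<Union>i<m. S \<inter> piece i) = S" using piece_cover sets.sets_into_space[OF S] by auto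
      then have "emeasure \<kappa> S = emeasure \<kappa> (\<Union>i<m. S \<inter> piece i)" by simp
      also have "\<dots> = (\<Sum>i<m. emeasure \<kappa> (S \<inter> piece i))"
      proof (rule sum_emeasure[symmetric])
        show "(\<lambda>i. S \<inter> piece i) ` {..<m} \<subseteq> sets \<kappa>" using pS \<kappa>(1) by auto
        show "disjoint_family_on (\<lambda>i. S \<inter> piece i) {..<m}"
          unfolding disjoint_family_on_def using piece_disjoint by blast
      qed simp
      also have "\<dots> = (\<Sum>i<m. emeasure (lebesgue_Rn n) (\<phi> i ` (S \<inter> piece i)))"
      proof (intro sum.cong refl)
        fix i assume "i \<in> {..<m}"
        then have i: "i < m" by simp
        have pU: "S \<inter> piece i \<subseteq> U i" by (auto simp: piece_def patch_def)
        then have im: "\<phi> i ` (S \<inter> piece i) \<in> sets (lebesgue_Rn n)" "\<phi> i ` (S \<inter> piece i) \<subseteq> \<phi> i ` U i"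
          using chart_image_borel[OF charts[OF i] pS[OF i]] by (auto simp: inf.absorb1)
        have "S \<inter> piece i = U i \<inter> \<phi> i -` (\<phi> i ` (S \<inter> piece i))"
          using pU inj_onD[OF chart(5)[OF charts[OF i]]] by blast
        then have "emeasure \<kappa> (S \<inter> piece i) = emeasure \<kappa> (U i \<inter> \<phi> i -` (\<phi> i ` (S \<inter> piece i)))" by (rule arg_cong)
        moreover have "chart_measure_preserving n \<kappa> (U i, \<phi> i)" using \<kappa>(2) charts[OF i] by blast
        ultimately show "emeasure \<kappa> (S \<inter> piece i) = emeasure (lebesgue_Rn n) (\<phi> i ` (S \<inter> piece i))"
          using im unfolding chart_measure_preserving_def prod.case by metis
      qed
      finally show ?thesis .
    qed
    show "emeasure \<nu> S = emeasure \<mu> S"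
      using eq[of \<nu>] eq[of \<mu>] \<nu> sets\<mu> pres by (simp add: sets_borel_M)
  qed
  have "manifold_measure n M \<A> = \<mu>"
    unfolding manifold_measure_def
  proof (rule the_equality)
    show "space \<mu> = topspace M \<and> sets \<mu> = sigma_sets (topspace M) {W. openin M W} \<and>
      (\<forall>c\<in>\<A>. chart_measure_preserving n \<mu> c)"
      by (intro conjI space\<mu> sets\<mu> pres)
  next
    fix \<nu> assume "space \<nu> = topspace M \<and> sets \<nu> = sigma_sets (topspace M) {U. openin M U} \<and>
      (\<forall>c\<in>\<A>. chart_measure_preserving n \<nu> c)"
    then show "\<nu> = \<mu>" by (elim conjE) (rule unique)
  qed
  then have "vol n M \<A> = volume_on (topspace M)"
    unfolding vol_def using em sets.top[of borel_M] by simp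
  also have "\<dots> = (\<Sum>i<m. \<integral>\<^sup>+y. ennreal (local_weight i y) \<partial>lebesgue_Rn n)"
    unfolding volume_on_def
  proof (intro sum.cong refl nn_integral_cong)
    fix i y assume "i \<in> {..<m}"
    then have "topspace M \<inter> U i = U i" using chart(2)[OF charts[of i]] by auto
    then show "ennreal (local_weight i y) * indicator (\<phi> i ` (topspace M \<inter> U i)) y = ennreal (local_weight i y)"
      by (simp add: local_weight_def indicator_def)
  qed
  finally show ?thesis .
qed

end

section \<open>The number of integral points\<close>

text \<open>
A polynomial with positive leading coefficient eventually stays above that coefficient.
\<close>

lemma poly_tendsto_zero:
  fixes r :: "real poly"
  assumes "(\<lambda>j. poly r (real j)) \<longlonglongrightarrow> 0"
  shows "r = 0"
proof -
  have "\<not> lead_coeff s > 0" if lim: "(\<lambda>j. poly s (real j)) \<longlonglongrightarrow> 0" for s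
  proof
    assume pos: "lead_coeff s > 0"
    from poly_pinfty_gt_lc[OF this] obtain x0 where x0: "\<And>x. x \<ge> x0 \<Longrightarrow> poly s x \<ge> lead_coeff s" by blast
    obtain N where "x0 \<le> real N" using real_arch_simple by blast
    then have "\<forall>j\<ge>N. lead_coeff s \<le> poly s (real j)" using x0 by (meson of_nat_le_iff order_trans)
    then have "lead_coeff s \<le> 0" using LIMSEQ_le_const[OF lim] by blast
    then show False using pos by simp
  qed
  from this[OF assms] this[of "- r"] tendsto_minus[OF assms] have "lead_coeff r = 0" by (simp add: not_less)
  then show ?thesis by simp
qed

lemma finite_box_cover_of_compact:
  fixes n :: nat and M :: "'a topology"
  assumes "int_affine_manifold n M \<A>" "compact_space M"
  shows "\<exists>m U \<phi> a b. finite_box_cover n M \<A> m U \<phi> a b"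
proof -
  interpret integral_affine_manifold n M \<A> by standard (rule assms(1))
  from finite_box_cover_exists[OF assms(2)] show ?thesis
  proof (elim exE conjE)
    fix m :: nat and U \<phi> a b
    assume "\<forall>i<m. (U i, \<phi> i) \<in> \<A> \<and> a i \<in> rational_points n \<and> b i \<in> rational_points n \<and>
       cbox_Rn n (a i) (b i) \<subseteq> \<phi> i ` U i"
      "topspace M = (\<Union>i<m. {x \<in> U i. \<phi> i x \<in> obox n (a i) (b i)})"
    then have "finite_box_cover n M \<A> m U \<phi> a b" by unfold_locales simp_all
    then show ?thesis by blast
  qed
qed

theorem theorem1p2:
  fixes n :: nat and M :: "'a topology" and \<A> :: "'a chart set"
  assumes "int_affine_manifold n M \<A>" and "compact_space M"
  shows "finite (integral_points n M \<A>) \<and>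
         of_nat (card (integral_points n M \<A>)) = vol n M \<A>"
proof -
  obtain m U \<phi> a b where "finite_box_cover n M \<A> m U \<phi> a b"
    using finite_box_cover_of_compact[OF assms] by blast
  then interpret finite_box_cover n M \<A> m U \<phi> a b .
  obtain V B where V: "V \<ge> 0" "vol n M \<A> = ennreal V"
    and B: "\<And>k. k > 0 \<Longrightarrow> \<bar>real (card (lattice_points k)) - real k ^ n * V\<bar> \<le> B / real k"
    using card_lattice_points_asymptotics unfolding vol_eq by blast
  obtain q p where q: "q > 0" and p: "\<And>j. real (card (lattice_points (1 + q * j))) = poly p (real j)"
    using card_lattice_points_polynomial by blast
  define r where "r = p - smult V ([:1, real q:] ^ n)"
  have r: "poly r (real j) = real (card (lattice_points (1 + q * j))) - real (1 + q * j) ^ n * V" for j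
    by (simp add: r_def p[symmetric] poly_power mult.commute)
  have "(\<lambda>j. poly r (real j)) \<longlonglongrightarrow> 0"
  proof (rule Lim_null_comparison)
    have bound: "\<bar>poly r (real j)\<bar> \<le> B / real (1 + q * j)" for j
      unfolding r by (rule B) simp
    then show "\<forall>\<^sub>F j in sequentially. norm (poly r (real j)) \<le> B / real (1 + q * j)" by simp
    have "filterlim (\<lambda>j. 1 + q * j) at_top sequentially"
      by (rule filterlim_subseq) (use q in \<open>simp add: strict_mono_def\<close>)
    then have "filterlim (\<lambda>j. real (1 + q * j)) at_top sequentially"
      by (rule filterlim_compose[OF filterlim_real_sequentially])
    then show "(\<lambda>j. B / real (1 + q * j)) \<longlonglongrightarrow> 0"
      by (intro tendsto_divide_0[OF tendsto_const] filterlim_at_top_imp_at_infinity)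
  qed
  then have "r = 0" by (rule poly_tendsto_zero)
  then have "real (card (lattice_points 1)) = V" using r[of 0] by simp
  moreover have "finite (lattice_points 1)" by (rule finite_lattice_points) simp
  ultimately show ?thesis unfolding integral_points_eq V(2) by (auto simp: ennreal_of_nat_eq_real_of_nat)
qed

end
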